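(* Let $K$ be a field, let $R=K[x_1,\dots,x_n]$ with $n\ge 1$, and let $G$ be a finite group acting linearly on $R$ such that the characteristic of $K$ does not divide $|G|$. Let $R^G=\{r\in R : g.r=r \text{ for all } g\in G\}$. Then the algorithm Invariant Algebra (described in the context) terminates, and the finite set $S$ it returns consists of homogeneous invariant polynomials and is a minimal generating set of $R^G$ as a $K$-algebra; that is, $S$ generates $R^G$ as a $K$-algebra and no proper subset of $S$ does. If, moreover, $G$ acts on $R$ by permuting the variables $x_1,\dots,x_n$, then the same conclusion holds for the variant of the algorithm in which, in step (b), the set $B_d(S)$ is replaced by the set of orbit sums $m^\circ$ of the monomials $m\in \mathrm{mon}_d(S)$.
   Context: "Acting linearly" means that $G$ acts on $R$ by $K$-algebra automorphisms that preserve the $K$-span of $x_1,\dots,x_n$; $g.r$ denotes the action of $g\in G$ on $r\in R$. Fix a global monomial order on $R$ (a well-ordering of the monomials compatible with multiplication). Notation. For $S\subset R$, $\langle S\rangle$ is the ideal of $R$ generated by $S$. For an ideal $I\subset R$, $lm(I)$ is the set of leading monomials of nonzero elements of $I$. The Reynolds operator $\mathrm{Rey}\colon R\to R^G$ is $\mathrm{Rey}(r)=\frac{1}{|G|}\sum_{g\in G} g.r$. For $S\subset R$ and $d>0$, $\mathrm{mon}_d(S)$ is the set of monomials of degree $d$ not contained in $lm(\langle S\rangle)$, and $B_d(S)=\mathrm{Rey}(\mathrm{mon}_d(S))$. If $G$ permutes the variables, the orbit sum of a monomial $m$ is $m^\circ=\sum_{m'\in G.m} m'$, where $G.m=\{g.m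 : g\in G\}$. A finite set $\mathcal G$ of homogeneous polynomials is a homogeneous Gröbner basis up to degree $d$ of $\langle \mathcal G\rangle$ if every S-polynomial of two elements of $\mathcal G$ either has degree $>d$ (the degree of an S-polynomial of homogeneous $f,g$ being understood as the degree of the least common multiple of their leading monomials) or reduces to $0$ modulo $\mathcal G$; equivalently, every monomial of degree at most $d$ in $lm(\langle\mathcal G\rangle)$ is divisible by the leading monomial of an element of $\mathcal G$. $\mathrm{rem}(b;\mathcal G)$ is the remainder (normal form) of $b$ on division by $\mathcal G$. $\dim(\langle S\rangle)$ is the Krull dimension of $R/\langle S\rangle$. Algorithm Invariant Algebra. (1) Let $S=\mathcal G=\emptyset$ and $d_{max}=0$. (2) For increasing degree $d=1,2,3,\dots$ do the following. (a) If $S$ contains elements of degree $d-2$ but no elements of degree $d-1$: (i) replace $\mathcal G$ by a (complete) Gröbner basis of $\langle S\rangle$; (ii) if $\dim(\langle S\rangle)=0$, then replace $d_{max}$ by the maximal degree of monomials outside $lm(\langle S\rangle)$, and if, moreover, $d$ exceeds the new $d_{max}$, then stop and return $S$. If $S$ contains elements of degree $d-1$, replace $\mathcal G$ by a homogeneous Gröbner basis of $\langle S\rangle$ up to degree $d$. (b) Compute $B_d(S)$ (for the current $S$). (c) For all $b\in B_d(S)$, one after the other: if $\mathrm{rem}(b;\mathcal G)\neq 0$, then replace $S$ by $S\cup\{b\}$ and $\mathcal G$ by $\mathcal G\cup\{\mathrm{rem}(b;\mathcal G)\}$. (d) If $d=d_{max}$, then stop and return $S$.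
   Formalization: In step (a)(i) the complete Gröbner basis of ⟨S⟩ is required to consist of homogeneous polynomials; with an arbitrary inhomogeneous Gröbner basis and arbitrary division choices, the algorithm can add a redundant generator. *)

theory Defs
  imports
    Complex_Main
    "HOL-Library.Poly_Mapping"
    "HOL-Library.Extended_Real"
    "HOL-Algebra.Group_Action"
    "HOL-Algebra.QuotRing"
    "HOL-Algebra.Algebraic_Closure_Type"
begin

section \<open>Polynomials\<close>

text \<open>
  The finite type \<open>'n\<close> indexes the variables. A monomial is its exponent vector, so
  multiplication of monomials is addition of exponent vectors.
\<close>

type_synonym 'n mon = "'n \<Rightarrow>\<^sub>0 nat"
type_synonym ('n, 'k) mpol = "'n mon \<Rightarrow>\<^sub>0 'k"

definition PConst :: "'k::field \<Rightarrow> ('n, 'k) mpol" where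
  "PConst c = Poly_Mapping.single 0 c"

definition PMono :: "'n mon \<Rightarrow> ('n, 'k::field) mpol" where
  "PMono m = Poly_Mapping.single m 1"

definition PVar :: "'n \<Rightarrow> ('n, 'k::field) mpol" where
  "PVar i = PMono (Poly_Mapping.single i 1)"

definition mdeg :: "'n::finite mon \<Rightarrow> nat" where
  "mdeg m = (\<Sum>i\<in>UNIV. Poly_Mapping.lookup m i)"

definition mdvd :: "'n mon \<Rightarrow> 'n mon \<Rightarrow> bool" where
  "mdvd s t \<longleftrightarrow> (\<exists>u. t = s + u)"

lift_definition mlcm :: "'n mon \<Rightarrow> 'n mon \<Rightarrow> 'n mon" is "\<lambda>s t i. max (s i) (t i)"
proof -
  fix s t :: "'n \<Rightarrow> nat"
  assume "finite {i. s i \<noteq> 0}" "finite {i. t i \<noteq> 0}"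
  then show "finite {i. max (s i) (t i) \<noteq> 0}"
    by (rule finite_subset[rotated, OF finite_UnI]) auto
qed

definition pdeg :: "('n::finite, 'k::field) mpol \<Rightarrow> nat" where
  "pdeg p = Max (insert 0 (mdeg ` Poly_Mapping.keys p))"

definition homogeneous :: "('n::finite, 'k::field) mpol \<Rightarrow> bool" where
  "homogeneous p \<longleftrightarrow> (\<exists>d. \<forall>m\<in>Poly_Mapping.keys p. mdeg m = d)"

definition ideal_of :: "('n, 'k::field) mpol set \<Rightarrow> ('n, 'k) mpol set" where
  "ideal_of S = Idl\<^bsub>ring_of_type_algebra\<^esub> S"

text \<open>The value for the zero ring is \<open>-\<infinity>\<close>, the supremum of the empty set of extended reals.\<close>

definition krull_dim :: "('a, 'b) ring_scheme \<Rightarrow> ereal" where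
  "krull_dim R = Sup {ereal (real l) | l.
     \<exists>P :: nat \<Rightarrow> 'a set. (\<forall>i\<le>l. primeideal (P i) R) \<and> (\<forall>i<l. P i \<subset> P (Suc i))}"

definition dim_ideal :: "('n, 'k::field) mpol set \<Rightarrow> ereal" where
  "dim_ideal I = krull_dim (ring_of_type_algebra Quot I)"

section \<open>Monomial orders and Groebner bases\<close>

text \<open>\<open>(s, t) \<in> ord\<close> means that \<open>s\<close> is less than or equal to \<open>t\<close>.\<close>

definition global_monomial_order :: "'n mon rel \<Rightarrow> bool" where
  "global_monomial_order ord \<longleftrightarrow>
     well_order_on UNIV ord \<and> (\<forall>s t u. (s, t) \<in> ord \<longrightarrow> (s + u, t + u) \<in> ord)"

definition lmon :: "'n mon rel \<Rightarrow> ('n, 'k::field) mpol \<Rightarrow> 'n mon" where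
  "lmon ord p = (THE m. m \<in> Poly_Mapping.keys p \<and> (\<forall>k\<in>Poly_Mapping.keys p. (k, m) \<in> ord))"

definition lcoeff :: "'n mon rel \<Rightarrow> ('n, 'k::field) mpol \<Rightarrow> 'k" where
  "lcoeff ord p = Poly_Mapping.lookup p (lmon ord p)"

definition lm_set :: "'n mon rel \<Rightarrow> ('n, 'k::field) mpol set \<Rightarrow> 'n mon set" where
  "lm_set ord I = {lmon ord p | p. p \<in> I \<and> p \<noteq> 0}"

definition spoly :: "'n mon rel \<Rightarrow> ('n, 'k::field) mpol \<Rightarrow> ('n, 'k) mpol \<Rightarrow> ('n, 'k) mpol" where
  "spoly ord f g =
     (let t = mlcm (lmon ord f) (lmon ord g)
      in Poly_Mapping.single (t - lmon ord f) (inverse (lcoeff ord f)) * f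
       - Poly_Mapping.single (t - lmon ord g) (inverse (lcoeff ord g)) * g)"

text \<open>One step of multivariate division: any term, not only the leading one, may be cancelled.\<close>

definition red_step ::
  "'n mon rel \<Rightarrow> ('n, 'k::field) mpol set \<Rightarrow> ('n, 'k) mpol \<Rightarrow> ('n, 'k) mpol \<Rightarrow> bool" where
  "red_step ord GG p q \<longleftrightarrow>
     (\<exists>g\<in>GG. \<exists>u. g \<noteq> 0 \<and> u + lmon ord g \<in> Poly_Mapping.keys p \<and>
        q = p - Poly_Mapping.single u (Poly_Mapping.lookup p (u + lmon ord g) / lcoeff ord g) * g)"

text \<open>
  \<open>is_rem ord GG b r\<close>: \<open>r\<close> is a remainder of \<open>b\<close> on division by \<open>GG\<close>. For a general \<open>GG\<close> the
  remainder depends on the choices made during the division; every outcome is allowed.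
\<close>

definition is_rem ::
  "'n mon rel \<Rightarrow> ('n, 'k::field) mpol set \<Rightarrow> ('n, 'k) mpol \<Rightarrow> ('n, 'k) mpol \<Rightarrow> bool" where
  "is_rem ord GG b r \<longleftrightarrow> (red_step ord GG)\<^sup>*\<^sup>* b r \<and> (\<nexists>q. red_step ord GG r q)"

text \<open>
  A complete Groebner basis is also taken homogeneous: step (c) extends it incrementally, and with
  inhomogeneous elements a member of the ideal could then have a nonzero remainder.
\<close>

definition homogeneous_GB ::
  "'n::finite mon rel \<Rightarrow> ('n, 'k::field) mpol set \<Rightarrow> ('n, 'k) mpol set \<Rightarrow> bool" where
  "homogeneous_GB ord S GG \<longleftrightarrow>
     finite GG \<and> (\<forall>g\<in>GG. homogeneous g) \<and> ideal_of GG = ideal_of S \<and>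
     (\<forall>m\<in>lm_set ord (ideal_of S). \<exists>g\<in>GG. g \<noteq> 0 \<and> mdvd (lmon ord g) m)"

definition homogeneous_GB_upto ::
  "'n::finite mon rel \<Rightarrow> nat \<Rightarrow> ('n, 'k::field) mpol set \<Rightarrow> ('n, 'k) mpol set \<Rightarrow> bool" where
  "homogeneous_GB_upto ord d S GG \<longleftrightarrow>
     finite GG \<and> (\<forall>g\<in>GG. homogeneous g) \<and> ideal_of GG = ideal_of S \<and>
     (\<forall>f\<in>GG. \<forall>g\<in>GG. f \<noteq> 0 \<longrightarrow> g \<noteq> 0 \<longrightarrow>
        mdeg (mlcm (lmon ord f) (lmon ord g)) > d \<or> (red_step ord GG)\<^sup>*\<^sup>* (spoly ord f g) 0)"

section \<open>Linear actions and invariants\<close>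

definition algebra_automorphism :: "(('n, 'k::field) mpol \<Rightarrow> ('n, 'k) mpol) \<Rightarrow> bool" where
  "algebra_automorphism f \<longleftrightarrow>
     bij f \<and> f 1 = 1 \<and> (\<forall>p q. f (p + q) = f p + f q) \<and> (\<forall>p q. f (p * q) = f p * f q) \<and>
     (\<forall>c p. f (PConst c * p) = PConst c * f p)"

definition linear_forms :: "('n, 'k::field) mpol set" where
  "linear_forms = Modules.module.span (\<lambda>c p. PConst c * p) (range PVar)"

definition acts_linearly ::
  "('g, 'b) monoid_scheme \<Rightarrow> ('g \<Rightarrow> ('n, 'k::field) mpol \<Rightarrow> ('n, 'k) mpol) \<Rightarrow> bool" where
  "acts_linearly G \<phi> \<longleftrightarrow>
     group_action G UNIV \<phi> \<and>
     (\<forall>g\<in>carrier G. algebra_automorphism (\<phi> g) \<and> \<phi> g ` linear_forms \<subseteq> linear_forms)"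

definition permutes_variables ::
  "('g, 'b) monoid_scheme \<Rightarrow> ('g \<Rightarrow> ('n, 'k::field) mpol \<Rightarrow> ('n, 'k) mpol) \<Rightarrow> bool" where
  "permutes_variables G \<phi> \<longleftrightarrow> (\<forall>g\<in>carrier G. \<phi> g ` range PVar = range PVar)"

definition invariant_ring ::
  "('g, 'b) monoid_scheme \<Rightarrow> ('g \<Rightarrow> ('n, 'k::field) mpol \<Rightarrow> ('n, 'k) mpol) \<Rightarrow> ('n, 'k) mpol set" where
  "invariant_ring G \<phi> = {r. \<forall>g\<in>carrier G. \<phi> g r = r}"

definition Rey ::
  "('g, 'b) monoid_scheme \<Rightarrow> ('g \<Rightarrow> ('n, 'k::field) mpol \<Rightarrow> ('n, 'k) mpol) \<Rightarrow>
   ('n, 'k) mpol \<Rightarrow> ('n, 'k) mpol" where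
  "Rey G \<phi> r = PConst (1 / of_nat (Coset.order G)) * (\<Sum>g\<in>carrier G. \<phi> g r)"

definition orbit_sum ::
  "('g, 'b) monoid_scheme \<Rightarrow> ('g \<Rightarrow> ('n, 'k::field) mpol \<Rightarrow> ('n, 'k) mpol) \<Rightarrow>
   'n mon \<Rightarrow> ('n, 'k) mpol" where
  "orbit_sum G \<phi> m = (\<Sum>p\<in>orbit G \<phi> (PMono m). p)"

definition K_subalgebra :: "('n, 'k::field) mpol set \<Rightarrow> bool" where
  "K_subalgebra A \<longleftrightarrow>
     range PConst \<subseteq> A \<and> (\<forall>p\<in>A. \<forall>q\<in>A. p + q \<in> A) \<and> (\<forall>p\<in>A. \<forall>q\<in>A. p * q \<in> A)"

definition minimal_generating_set :: "('n, 'k::field) mpol set \<Rightarrow> ('n, 'k) mpol set \<Rightarrow> bool" where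
  "minimal_generating_set S A \<longleftrightarrow>
     K_subalgebra hull S = A \<and> (\<forall>T. T \<subset> S \<longrightarrow> K_subalgebra hull T \<noteq> A)"

section \<open>The algorithm\<close>

definition mon_d :: "'n::finite mon rel \<Rightarrow> nat \<Rightarrow> ('n, 'k::field) mpol set \<Rightarrow> 'n mon set" where
  "mon_d ord d S = {m. mdeg m = d \<and> m \<notin> lm_set ord (ideal_of S)}"

definition reynolds_candidates ::
  "'n::finite mon rel \<Rightarrow> ('g, 'b) monoid_scheme \<Rightarrow>
   ('g \<Rightarrow> ('n, 'k::field) mpol \<Rightarrow> ('n, 'k) mpol) \<Rightarrow> nat \<Rightarrow> ('n, 'k) mpol set \<Rightarrow> ('n, 'k) mpol set"
  where "reynolds_candidates ord G \<phi> d S = (\<lambda>m. Rey G \<phi> (PMono m)) ` mon_d ord d S"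

definition orbit_sum_candidates ::
  "'n::finite mon rel \<Rightarrow> ('g, 'b) monoid_scheme \<Rightarrow>
   ('g \<Rightarrow> ('n, 'k::field) mpol \<Rightarrow> ('n, 'k) mpol) \<Rightarrow> nat \<Rightarrow> ('n, 'k) mpol set \<Rightarrow> ('n, 'k) mpol set"
  where "orbit_sum_candidates ord G \<phi> d S = orbit_sum G \<phi> ` mon_d ord d S"

definition max_std_degree :: "'n::finite mon rel \<Rightarrow> ('n, 'k::field) mpol set \<Rightarrow> nat" where
  "max_std_degree ord S = Max (mdeg ` (- lm_set ord (ideal_of S)))"

definition has_deg_minus :: "('n::finite, 'k::field) mpol set \<Rightarrow> nat \<Rightarrow> nat \<Rightarrow> bool" where
  "has_deg_minus S d j \<longleftrightarrow> (\<exists>p\<in>S. pdeg p + j = d)"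

text \<open>
  \<open>Enter d S GG dmax\<close> is the state at the beginning of the iteration for degree \<open>d\<close>;
  \<open>Scan d S GG dmax M\<close> is the state during step (c), with \<open>M\<close> the candidates still to be treated.
  The transition relation is nondeterministic: it leaves open which Groebner basis is computed,
  in which order the candidates are treated, and how remainders are computed.
\<close>

datatype 'p state =
    Enter nat "'p set" "'p set" nat
  | Scan nat "'p set" "'p set" nat "'p set"
  | Return "'p set"

inductive step ::
  "'n::finite mon rel \<Rightarrow> (nat \<Rightarrow> ('n, 'k::field) mpol set \<Rightarrow> ('n, 'k) mpol set) \<Rightarrow>
   ('n, 'k) mpol state \<Rightarrow> ('n, 'k) mpol state \<Rightarrow> bool"
  for ord :: "'n mon rel" and B :: "nat \<Rightarrow> ('n, 'k) mpol set \<Rightarrow> ('n, 'k) mpol set"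
  where
  gap_stop:
    "\<lbrakk>has_deg_minus S d 2; \<not> has_deg_minus S d 1; homogeneous_GB ord S GG';
      dim_ideal (ideal_of S) = 0; d > max_std_degree ord S\<rbrakk>
     \<Longrightarrow> step ord B (Enter d S GG dmax) (Return S)"
| gap_dim_zero:
    "\<lbrakk>has_deg_minus S d 2; \<not> has_deg_minus S d 1; homogeneous_GB ord S GG';
      dim_ideal (ideal_of S) = 0; \<not> d > max_std_degree ord S\<rbrakk>
     \<Longrightarrow> step ord B (Enter d S GG dmax) (Scan d S GG' (max_std_degree ord S) (B d S))"
| gap_dim_nonzero:
    "\<lbrakk>has_deg_minus S d 2; \<not> has_deg_minus S d 1; homogeneous_GB ord S GG';
      dim_ideal (ideal_of S) \<noteq> 0\<rbrakk>
     \<Longrightarrow> step ord B (Enter d S GG dmax) (Scan d S GG' dmax (B d S))"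
| truncated:
    "\<lbrakk>has_deg_minus S d 1; homogeneous_GB_upto ord d S GG'\<rbrakk>
     \<Longrightarrow> step ord B (Enter d S GG dmax) (Scan d S GG' dmax (B d S))"
| unchanged:
    "\<lbrakk>\<not> has_deg_minus S d 2; \<not> has_deg_minus S d 1\<rbrakk>
     \<Longrightarrow> step ord B (Enter d S GG dmax) (Scan d S GG dmax (B d S))"
| insert_candidate:
    "\<lbrakk>b \<in> M; is_rem ord GG b r; r \<noteq> 0\<rbrakk>
     \<Longrightarrow> step ord B (Scan d S GG dmax M) (Scan d (S \<union> {b}) (GG \<union> {r}) dmax (M - {b}))"
| skip_candidate:
    "\<lbrakk>b \<in> M; is_rem ord GG b r; r = 0\<rbrakk>
     \<Longrightarrow> step ord B (Scan d S GG dmax M) (Scan d S GG dmax (M - {b}))"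
| stop:
    "d = dmax \<Longrightarrow> step ord B (Scan d S GG dmax {}) (Return S)"
| next_degree:
    "d \<noteq> dmax \<Longrightarrow> step ord B (Scan d S GG dmax {}) (Enter (d + 1) S GG dmax)"

definition initial_state :: "'p state" where
  "initial_state = Enter 1 {} {} 0"

definition reachable ::
  "'n::finite mon rel \<Rightarrow> (nat \<Rightarrow> ('n, 'k::field) mpol set \<Rightarrow> ('n, 'k) mpol set) \<Rightarrow>
   ('n, 'k) mpol state \<Rightarrow> bool" where
  "reachable ord B s \<longleftrightarrow> (step ord B)\<^sup>*\<^sup>* initial_state s"

text \<open>There is no infinite run, and no run gets stuck before returning a set.\<close>

definition terminates ::
  "'n::finite mon rel \<Rightarrow> (nat \<Rightarrow> ('n, 'k::field) mpol set \<Rightarrow> ('n, 'k) mpol set) \<Rightarrow> bool" where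
  "terminates ord B \<longleftrightarrow>
     (\<nexists>run :: nat \<Rightarrow> ('n, 'k) mpol state. run 0 = initial_state \<and> (\<forall>i. step ord B (run i) (run (Suc i)))) \<and>
     (\<forall>s. reachable ord B s \<longrightarrow> (\<exists>S. s = Return S) \<or> (\<exists>t. step ord B s t))"

definition returns ::
  "'n::finite mon rel \<Rightarrow> (nat \<Rightarrow> ('n, 'k::field) mpol set \<Rightarrow> ('n, 'k) mpol set) \<Rightarrow>
   ('n, 'k) mpol set \<Rightarrow> bool" where
  "returns ord B S \<longleftrightarrow> reachable ord B (Return S)"

end

theory Submission
  imports Defs
begin

text \<open>
  Both candidate sets consist of nonzero multiples of the \<open>Rey m\<close>, as \<open>m\<^sup>\<circ>\<close> is \<open>|G.m|\<close> times
  \<open>Rey m\<close>. In degree \<open>d\<close> every polynomial is, modulo \<open>\<langle>S\<rangle>\<close>, a combination of the monomials in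
  \<open>mon\<^sub>d S\<close>; applying the Reynolds operator shows that \<open>S\<close> and the candidates together generate an
  ideal containing all invariants of degree \<open>d\<close>. Since \<open>\<G>\<close> is a Groebner basis in degree \<open>d\<close>
  (by a truncated Buchberger criterion), a candidate is inserted exactly if it is not in \<open>\<langle>S\<rangle>\<close>, so no
  element of \<open>S\<close> lies in the ideal generated by the others, and this makes \<open>S\<close> minimal.

  Each variable is a root of \<open>\<Prod>\<^sub>g (T - g.x)\<close>, so \<open>\<langle>S\<rangle>\<close> contains the power \<open>x\<close> to \<open>|G|\<close> as soon as
  the degrees up to \<open>|G|\<close> have been treated. Hence nothing is inserted beyond degree \<open>n |G|\<close>, the
  ideal is then zero-dimensional, and the next gap in the degrees of \<open>S\<close> bounds the remaining run.
  Conversely, if the homogeneous ideal \<open>\<langle>S\<rangle>\<close> has dimension zero, it contains powers of all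
  variables, so that \<open>d_max\<close> is finite and all monomials beyond it lie in \<open>lm \<langle>S\<rangle>\<close>.
\<close>

text \<open>The order \<open>ord\<close> need not refine the degree: a leading monomial may have
  smaller degree than other terms, and infinitely many monomials may lie below a given one. Every
  argument is therefore confined to a single degree. Ideals generated by forms contain the
  homogeneous components of their elements, and \<open>gb_in_degree\<close> records only what a
  basis achieves for forms of degree \<open>d\<close>. A new generator of degree \<open>d\<close>
  enters forms of degree \<open>d\<close> only through scalar multiples, so adjoining its remainder
  preserves this property; in higher degrees it may be lost, which is why step (a) recomputes the
  basis in the next degree and again at the gap.

  Irredundancy is tracked for ideals, because this is what the remainder test decides. It passes to
  algebras because an element of the subalgebra generated by \<open>T\<close> is a constant plus an
  element of the ideal generated by \<open>T\<close>, and a form of positive degree sees no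
  constant.

  The value \<open>dmax = 0\<close> means that no bound is known yet; this is unambiguous because
  \<open>d\<close> starts at 1. A bound once found stays valid, since enlarging \<open>S\<close>
  only removes standard monomials.\<close>

section \<open>Monomials, degrees and coefficients\<close>

lemma mdeg_zero [simp]: "mdeg 0 = 0"
  by (simp add: mdeg_def)

lemma mdeg_add: "mdeg (s + t) = mdeg s + mdeg t"
  by (simp add: mdeg_def lookup_add sum.distrib)

lemma mdeg_single [simp]: "mdeg (Poly_Mapping.single i k) = k"
proof -
  have "mdeg (Poly_Mapping.single i k) = (\<Sum>j\<in>UNIV. if i = j then k else 0)"
    unfolding mdeg_def by (rule sum.cong) (auto simp: lookup_single when_def)
  then show ?thesis
    by simp
qed

lemma lookup_le_mdeg: "Poly_Mapping.lookup m i \<le> mdeg m"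
  unfolding mdeg_def by (rule member_le_sum) auto

lemma mdeg_eq_0_iff: "mdeg m = 0 \<longleftrightarrow> m = 0"
proof
  assume "mdeg m = 0"
  then have "Poly_Mapping.lookup m i = 0" for i
    using lookup_le_mdeg[of m i] by simp
  then show "m = 0"
    by (intro poly_mapping_eqI) simp
qed simp

lemma finite_bounded_mon:
  fixes f :: "'n::finite \<Rightarrow> nat"
  shows "finite {m :: 'n mon. \<forall>i. Poly_Mapping.lookup m i \<le> f i}"
proof -
  have "finite {h :: 'n \<Rightarrow> nat. \<forall>i. (i \<in> UNIV \<longrightarrow> h i \<in> {.. Max (range f)}) \<and> (i \<notin> UNIV \<longrightarrow> h i = 0)}"
    by (rule finite_set_of_finite_funs) auto
  moreover have "Poly_Mapping.lookup ` {m. \<forall>i. Poly_Mapping.lookup m i \<le> f i} \<subseteq>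
      {h. \<forall>i. (i \<in> UNIV \<longrightarrow> h i \<in> {.. Max (range f)}) \<and> (i \<notin> UNIV \<longrightarrow> h i = 0)}"
    by (auto intro: order_trans[OF _ Max_ge])
  ultimately have "finite (Poly_Mapping.lookup ` {m. \<forall>i. Poly_Mapping.lookup m i \<le> f i})"
    by (rule rev_finite_subset)
  then show ?thesis
    by (rule finite_imageD) (auto intro!: inj_onI poly_mapping_eqI)
qed

lemma finite_mdeg: "finite {m :: 'n::finite mon. mdeg m = d}"
  by (rule finite_subset[OF _ finite_bounded_mon[of "\<lambda>_. d"]]) (auto intro: lookup_le_mdeg)

lemma lookup_sum_single:
  "p = (\<Sum>m\<in>Poly_Mapping.keys p. Poly_Mapping.single m (Poly_Mapping.lookup p m))"
proof (rule poly_mapping_eqI)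
  fix k
  show "Poly_Mapping.lookup p k =
    Poly_Mapping.lookup (\<Sum>m\<in>Poly_Mapping.keys p. Poly_Mapping.single m (Poly_Mapping.lookup p m)) k"
    by (cases "k \<in> Poly_Mapping.keys p")
       (auto simp: lookup_sum lookup_single when_def in_keys_iff)
qed

lemma lookup_single_mult:
  fixes g :: "('n, 'k::field) mpol"
  shows "Poly_Mapping.lookup (Poly_Mapping.single u c * g) (u + k) = c * Poly_Mapping.lookup g k"
proof -
  let ?K = "Poly_Mapping.keys g"
  have "Poly_Mapping.single u c * g =
      (\<Sum>m\<in>?K. Poly_Mapping.single (u + m) (c * Poly_Mapping.lookup g m))"
    by (subst lookup_sum_single[of g]) (simp add: sum_distrib_left mult_single)
  then have "Poly_Mapping.lookup (Poly_Mapping.single u c * g) (u + k) =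
      (\<Sum>m\<in>?K. if m = k then c * Poly_Mapping.lookup g m else 0)"
    by (simp add: lookup_sum lookup_single when_def)
  then show ?thesis
    by (cases "k \<in> ?K") (auto simp: in_keys_iff)
qed

lemma keys_single_mult_subset:
  fixes g :: "('n, 'k::field) mpol"
  shows "Poly_Mapping.keys (Poly_Mapping.single u c * g) \<subseteq> (+) u ` Poly_Mapping.keys g"
  using keys_mult[of "Poly_Mapping.single u c" g] by (auto split: if_splits)

lemma PConst_mult: "PConst a * PConst b = PConst (a * b)"
  by (simp add: PConst_def mult_single)

lemma PConst_add: "PConst a + PConst b = PConst (a + b)"
  by (simp add: PConst_def single_add)

lemma PConst_0 [simp]: "PConst 0 = 0" and PConst_1 [simp]: "PConst 1 = 1"
  by (simp_all add: PConst_def)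

lemma lookup_PConst_mult: "Poly_Mapping.lookup (PConst c * p) k = c * Poly_Mapping.lookup p k"
  using lookup_single_mult[of 0 c p k] by (simp add: PConst_def)

lemma single_eq_PConst_mult: "Poly_Mapping.single m c = PConst c * PMono m"
  by (simp add: PConst_def PMono_def mult_single)

lemma PMono_add: "PMono (s + t) = PMono s * PMono t"
  by (simp add: PMono_def mult_single)

lemma PMono_0 [simp]: "PMono 0 = 1"
  by (simp add: PMono_def)

lemma keys_PMono [simp]: "Poly_Mapping.keys (PMono m :: ('n, 'k::field) mpol) = {m}"
  by (simp add: PMono_def)

lemma PMono_power_single:
  "PMono (Poly_Mapping.single i k) = (PVar i :: ('n, 'k::field) mpol) ^ k"
proof (induction k)
  case (Suc k)
  have "PMono (Poly_Mapping.single i (Suc k)) =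
      (PMono (Poly_Mapping.single i 1 + Poly_Mapping.single i k) :: ('n, 'k::field) mpol)"
    by (simp flip: single_add)
  then show ?case
    by (simp only: PMono_add Suc.IH) (simp add: PVar_def)
qed simp


section \<open>Homogeneous components\<close>

definition hcomp :: "nat \<Rightarrow> ('n::finite, 'k::field) mpol \<Rightarrow> ('n, 'k) mpol" where
  "hcomp d p = Poly_Mapping.mapp (\<lambda>m c. c when mdeg m = d) p"

text \<open>With the degree as a parameter, the forms of one degree make up a linear space; in
  particular 0 belongs to every degree.\<close>

definition homog :: "nat \<Rightarrow> ('n::finite, 'k::field) mpol \<Rightarrow> bool" where
  "homog d p \<longleftrightarrow> (\<forall>m\<in>Poly_Mapping.keys p. mdeg m = d)"

lemma homogeneous_iff: "homogeneous p \<longleftrightarrow> (\<exists>d. homog d p)"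
  by (simp add: homogeneous_def homog_def)

lemma lookup_hcomp: "Poly_Mapping.lookup (hcomp d p) m = (Poly_Mapping.lookup p m when mdeg m = d)"
  by (auto simp: hcomp_def lookup_mapp when_def in_keys_iff)

lemma homogD: "homog d p \<Longrightarrow> m \<in> Poly_Mapping.keys p \<Longrightarrow> mdeg m = d"
  by (simp add: homog_def)

lemma homog_zero [simp]: "homog d 0"
  by (simp add: homog_def)

lemma homog_add: "homog d p \<Longrightarrow> homog d q \<Longrightarrow> homog d (p + q)"
  using keys_add[of p q] by (auto simp: homog_def)

lemma homog_uminus: "homog d p \<Longrightarrow> homog d (- p)"
  by (simp add: homog_def in_keys_iff)

lemma homog_diff: "homog d p \<Longrightarrow> homog d q \<Longrightarrow> homog d (p - q)"
  using homog_add[of d p "- q"] by (simp add: homog_uminus)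

lemma homog_sum: "(\<And>i. i \<in> I \<Longrightarrow> homog d (f i)) \<Longrightarrow> homog d (sum f I)"
  by (induction I rule: infinite_finite_induct) (auto simp: homog_add)

lemma homog_mult: "homog d p \<Longrightarrow> homog e q \<Longrightarrow> homog (d + e) (p * q)"
  using keys_mult[of p q] by (fastforce simp: homog_def mdeg_add)

lemma homog_single: "homog (mdeg m) (Poly_Mapping.single m c)"
  by (simp add: homog_def)

lemma homog_PMono: "homog (mdeg m) (PMono m)"
  by (simp add: PMono_def homog_single)

lemma homog_PVar: "homog 1 (PVar i)"
  using homog_PMono[of "Poly_Mapping.single i 1"] by (simp add: PVar_def)

lemma homog_PConst: "homog 0 (PConst c)"
  using homog_single[of 0 c] by (simp add: PConst_def)

lemma homog_PConst_mult: "homog d p \<Longrightarrow> homog d (PConst c * p)"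
  using homog_mult[OF homog_PConst] by fastforce

lemma homog_one: "homog 0 1"
  using homog_PConst[of 1] by simp

lemma homog_power: "homog d p \<Longrightarrow> homog (k * d) (p ^ k)"
  by (induction k) (auto simp: homog_one homog_mult)

lemma pdeg_homog: 
  assumes "homog d p" "p \<noteq> 0"
  shows "pdeg p = d"
proof -
  have "mdeg ` Poly_Mapping.keys p = {d}"
    using assms by (auto simp: homog_def image_iff) (metis keys_eq_empty equals0I)
  then show ?thesis
    by (simp add: pdeg_def)
qed

lemma homog_pdeg: "homogeneous p \<Longrightarrow> homog (pdeg p) p"
  by (cases "p = 0") (auto simp: homogeneous_iff pdeg_homog)

lemma homog_hcomp: "homog d (hcomp d p)"
  by (auto simp: homog_def in_keys_iff lookup_hcomp when_def split: if_splits)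

lemma hcomp_add: "hcomp d (p + q) = hcomp d p + hcomp d q"
  by (rule poly_mapping_eqI) (simp add: lookup_hcomp lookup_add when_def)

lemma hcomp_zero [simp]: "hcomp d 0 = 0"
  by (rule poly_mapping_eqI) (simp add: lookup_hcomp)

lemma hcomp_sum: "hcomp d (sum f A) = (\<Sum>i\<in>A. hcomp d (f i))"
  by (induction A rule: infinite_finite_induct) (auto simp: hcomp_add)

lemma hcomp_diff: "hcomp d (p - q) = hcomp d p - hcomp d q"
  by (rule poly_mapping_eqI) (simp add: lookup_hcomp lookup_minus when_def)

lemma hcomp_homog: "homog d p \<Longrightarrow> hcomp d p = p"
  by (rule poly_mapping_eqI) (auto simp: lookup_hcomp when_def homog_def in_keys_iff)

lemma hcomp_homog_neq: "homog e p \<Longrightarrow> d \<noteq> e \<Longrightarrow> hcomp d p = 0"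
  by (rule poly_mapping_eqI) (auto simp: lookup_hcomp when_def homog_def in_keys_iff)

text \<open>Multiplying by a form of degree \<open>e\<close> raises every degree by
  \<open>e\<close>, so the components of \<open>p\<close> outside degree \<open>d - e\<close>
  contribute nothing. The case split is due to truncated subtraction.\<close>

lemma hcomp_mult_homog:
  assumes "homog e q"
  shows "hcomp d (p * q) = (if e \<le> d then hcomp (d - e) p * q else 0)"
proof (cases "e \<le> d")
  case True
  let ?r = "p - hcomp (d - e) p"
  have "Poly_Mapping.lookup (?r * q) m = 0" if "mdeg m = d" for m
  proof (rule ccontr)
    assume "Poly_Mapping.lookup (?r * q) m \<noteq> 0"
    then have "m \<in> Poly_Mapping.keys (?r * q)"
      by (simp add: in_keys_iff)
    then obtain a b where ab: "m = a + b" "a \<in> Poly_Mapping.keys ?r" "b \<in> Poly_Mapping.keys q"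
      using keys_mult[of ?r q] by blast
    then have "mdeg a = d - e"
      using assms that by (auto simp: homog_def mdeg_add)
    then show False
      using ab(2) by (simp add: in_keys_iff lookup_minus lookup_hcomp)
  qed
  then have "hcomp d (?r * q) = 0"
    by (intro poly_mapping_eqI) (simp add: lookup_hcomp when_def)
  moreover have "hcomp d (hcomp (d - e) p * q) = hcomp (d - e) p * q"
    using homog_mult[OF homog_hcomp[of "d - e" p] assms] True by (intro hcomp_homog) simp
  ultimately show ?thesis
    using True by (simp add: algebra_simps hcomp_diff)
next
  case False
  have "Poly_Mapping.lookup (p * q) m = 0" if "mdeg m = d" for m
  proof (rule ccontr)
    assume "Poly_Mapping.lookup (p * q) m \<noteq> 0"
    then have "m \<in> Poly_Mapping.keys (p * q)"
      by (simp add: in_keys_iff)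
    then obtain a b where ab: "m = a + b" "b \<in> Poly_Mapping.keys q"
      using keys_mult[of p q] by blast
    then show False
      using assms that False by (auto simp: homog_def mdeg_add)
  qed
  then show ?thesis
    using False by (intro poly_mapping_eqI) (simp add: lookup_hcomp when_def)
qed

lemma sum_hcomp:
  assumes "mdeg ` Poly_Mapping.keys p \<subseteq> D" "finite D"
  shows "(\<Sum>d\<in>D. hcomp d p) = p"
proof (rule poly_mapping_eqI)
  fix k
  show "Poly_Mapping.lookup (\<Sum>d\<in>D. hcomp d p) k = Poly_Mapping.lookup p k"
    using assms by (cases "k \<in> Poly_Mapping.keys p")
      (auto simp: lookup_sum lookup_hcomp when_def in_keys_iff)
qed

lemma homog_0_eq_PConst:
  assumes "homog 0 p"
  shows "p = PConst (Poly_Mapping.lookup p 0)"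
  using assms by (intro poly_mapping_eqI)
    (auto simp: homog_def PConst_def lookup_single when_def in_keys_iff mdeg_eq_0_iff)


section \<open>Ideals of polynomials\<close>

text \<open>Over itself the polynomial ring is a module whose submodules are the ideals, which makes
  the lemmas on spans available for ideals. The structure \<open>kv\<close> below is the one over
  the field.\<close>

interpretation pm: Modules.module "(*) :: ('n, 'k::field) mpol \<Rightarrow> ('n, 'k) mpol \<Rightarrow> ('n, 'k) mpol"
  by unfold_locales (auto simp: algebra_simps)

interpretation kv: Modules.module "\<lambda>(c :: 'k::field) (p :: ('n, 'k) mpol). PConst c * p"
  by unfold_locales
    (simp_all add: distrib_left distrib_right PConst_mult mult.assoc[symmetric] PConst_add[symmetric])

(* As simp rules these associate products to the left and loop with mult.assoc. *)
declare pm.scale_scale [simp del] kv.scale_scale [simp del]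

lemma carrier_ring_of_type [simp]: "carrier ring_of_type_algebra = UNIV"
  and mult_ring_of_type [simp]: "x \<otimes>\<^bsub>ring_of_type_algebra\<^esub> y = x * y"
  and add_ring_of_type [simp]: "x \<oplus>\<^bsub>ring_of_type_algebra\<^esub> y = x + y"
  and zero_ring_of_type [simp]: "zero ring_of_type_algebra = 0"
  and one_ring_of_type [simp]: "one ring_of_type_algebra = 1"
  by (simp_all add: ring_of_type_algebra_def)

lemma cring_mpol: "cring (ring_of_type_algebra :: ('n, 'k::field) mpol ring)"
  by (rule cring_from_type_algebra)

text \<open>Both sides are the least ideal containing \<open>S\<close>: on the left in the
  carrier-based ring theory in which the Krull dimension is defined, on the right as a
  submodule.\<close>

lemma ideal_of_eq_span: "ideal_of S = pm.span (S :: ('n, 'k::field) mpol set)"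
proof -
  let ?R = "ring_of_type_algebra :: ('n, 'k) mpol ring"
  interpret R: cring ?R by (rule cring_mpol)
  have "ideal (pm.span S) ?R"
  proof (rule idealI)
    show "subgroup (pm.span S) (add_monoid ?R)"
    proof (rule R.add.subgroupI)
      fix a assume a: "a \<in> pm.span S"
      have "\<ominus>\<^bsub>?R\<^esub> a = - a"
        by (rule R.add.inv_equality) auto
      then show "\<ominus>\<^bsub>?R\<^esub> a \<in> pm.span S"
        using pm.span_neg[OF a] by (simp add: a_inv_def)
    qed (auto intro: pm.span_zero pm.span_add)
  next
    fix a x assume "a \<in> pm.span S"
    then have "x * a \<in> pm.span S"
      by (rule pm.span_scale)
    then show "x \<otimes>\<^bsub>?R\<^esub> a \<in> pm.span S" "a \<otimes>\<^bsub>?R\<^esub> x \<in> pm.span S"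
      by (simp_all add: mult.commute)
  qed (rule R.ring_axioms)
  moreover have "S \<subseteq> pm.span S"
    by (rule pm.span_superset)
  ultimately have "ideal_of S \<subseteq> pm.span S"
    unfolding ideal_of_def by (rule R.genideal_minimal)
  moreover have "pm.span S \<subseteq> ideal_of S"
  proof (rule pm.span_minimal)
    interpret I: ideal "ideal_of S" ?R
      unfolding ideal_of_def by (rule R.genideal_ideal) simp
    show "S \<subseteq> ideal_of S"
      unfolding ideal_of_def by (rule R.genideal_self) simp
    show "pm.subspace (ideal_of S)"
      using I.I_l_closed I.a_closed I.zero_closed by (auto intro!: pm.subspaceI)
  qed
  ultimately show ?thesis by blast
qed

lemma ideal_of_is_ideal: "ideal (ideal_of S) (ring_of_type_algebra :: ('n, 'k::field) mpol ring)"
proof -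
  interpret R: cring "ring_of_type_algebra :: ('n, 'k) mpol ring" by (rule cring_mpol)
  show ?thesis
    unfolding ideal_of_def by (rule R.genideal_ideal) simp
qed

lemma ideal_of_base: "s \<in> S \<Longrightarrow> s \<in> ideal_of S"
  by (simp add: ideal_of_eq_span pm.span_base)

lemma ideal_of_zero [simp]: "0 \<in> ideal_of S"
  by (simp add: ideal_of_eq_span pm.span_zero)

lemma ideal_of_add: "p \<in> ideal_of S \<Longrightarrow> q \<in> ideal_of S \<Longrightarrow> p + q \<in> ideal_of S"
  by (simp add: ideal_of_eq_span pm.span_add)

lemma ideal_of_diff: "p \<in> ideal_of S \<Longrightarrow> q \<in> ideal_of S \<Longrightarrow> p - q \<in> ideal_of S"
  by (simp add: ideal_of_eq_span pm.span_diff)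

lemma ideal_of_mult: "p \<in> ideal_of S \<Longrightarrow> a * p \<in> ideal_of S"
  by (simp add: ideal_of_eq_span pm.span_scale)

lemma ideal_of_sum: "(\<And>i. i \<in> I \<Longrightarrow> f i \<in> ideal_of S) \<Longrightarrow> sum f I \<in> ideal_of S"
  by (simp add: ideal_of_eq_span pm.span_sum)

lemma ideal_of_mono: "S \<subseteq> T \<Longrightarrow> ideal_of S \<subseteq> ideal_of T"
  by (simp add: ideal_of_eq_span pm.span_mono)

lemma ideal_of_subset: "S \<subseteq> ideal_of T \<Longrightarrow> ideal_of S \<subseteq> ideal_of T"
  by (simp add: ideal_of_eq_span pm.span_minimal)

lemma ideal_of_induct [consumes 1, case_names zero step]:
  assumes "p \<in> ideal_of S" "P 0"
    and "\<And>a s p. s \<in> S \<Longrightarrow> p \<in> ideal_of S \<Longrightarrow> P p \<Longrightarrow> P (a * s + p)"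
  shows "P p"
proof -
  have "p \<in> ideal_of S \<and> P p"
    using assms(1)[unfolded ideal_of_eq_span]
  proof (induction rule: pm.span_induct_alt)
    case (step c x y)
    then show ?case using assms(3)[of x y c] by (auto intro: ideal_of_add ideal_of_mult ideal_of_base)
  qed (use assms(2) in auto)
  then show ?thesis ..
qed

lemma ideal_of_empty: "ideal_of {} = {0}"
  by (simp add: ideal_of_eq_span)

text \<open>For a form \<open>s\<close>, every component of \<open>a * s\<close> is again a multiple
  of \<open>s\<close>, and taking components is additive.\<close>

lemma hcomp_in_ideal:
  assumes "\<And>s. s \<in> S \<Longrightarrow> homogeneous s" "p \<in> ideal_of S"
  shows "hcomp d p \<in> ideal_of S"
  using assms(2)
proof (induction rule: ideal_of_induct)
  case (step a s p)
  have "hcomp d (a * s) \<in> ideal_of S"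
    using ideal_of_mult[OF ideal_of_base[OF step.hyps(1)]] assms(1)[OF step.hyps(1)]
    by (auto simp: homogeneous_iff hcomp_mult_homog)
  then show ?case using step by (simp add: hcomp_add ideal_of_add)
qed simp

lemma ideal_of_insertE:
  assumes "p \<in> ideal_of (insert b S)"
  obtains a h where "h \<in> ideal_of S" "p = h + a * b"
proof -
  from assms have "\<exists>k. p - k * b \<in> pm.span S"
    unfolding ideal_of_eq_span pm.span_insert by auto
  then obtain k where "p - k * b \<in> ideal_of S"
    by (auto simp: ideal_of_eq_span)
  then show thesis
    by (intro that[of "p - k * b" k]) auto
qed

text \<open>In degrees up to \<open>d\<close> the multiplier of \<open>b\<close> matters only
  through its constant term, and that only if \<open>e = d\<close>. Both the extension of the basis
  and the irredundancy of \<open>S\<close> rest on this.\<close>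

lemma ideal_of_insert_homogE:
  assumes "p \<in> ideal_of (insert b S)" "homog e p" "homog d b" "e \<le> d"
    and S: "\<And>s. s \<in> S \<Longrightarrow> homogeneous s"
  obtains h c where "h \<in> ideal_of S" "homog e h" "p = h + PConst c * b" "e < d \<Longrightarrow> c = 0"
proof -
  obtain a h where h: "h \<in> ideal_of S" "p = h + a * b"
    using assms(1) by (rule ideal_of_insertE)
  have p: "p = hcomp e h + hcomp e (a * b)"
    using hcomp_homog[OF assms(2)] h(2) by (simp add: hcomp_add)
  show thesis
  proof (cases "e = d")
    case True
    have "hcomp e (a * b) = PConst (Poly_Mapping.lookup a 0) * b"
      using assms(3) True homog_0_eq_PConst[OF homog_hcomp[of 0 a]]
      by (simp add: hcomp_mult_homog lookup_hcomp)
    with p True show ?thesis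
      by (intro that[of "hcomp e h"]) (auto intro: hcomp_in_ideal h S homog_hcomp)
  next
    case False
    with assms(3,4) have "hcomp e (a * b) = 0"
      by (simp add: hcomp_mult_homog)
    with p show ?thesis
      by (intro that[of "hcomp e h" 0]) (auto intro: hcomp_in_ideal h S homog_hcomp)
  qed
qed

text \<open>All multiples of a form of positive degree have zero component in degree 0. This is how
  the ideal is seen to be proper.\<close>

lemma lookup_0_ideal_pos:
  assumes "\<And>s. s \<in> S \<Longrightarrow> homogeneous s \<and> pdeg s \<ge> 1" "p \<in> ideal_of S"
  shows "Poly_Mapping.lookup p 0 = 0"
proof -
  have "hcomp 0 p = 0"
    using assms(2)
  proof (induction rule: ideal_of_induct)
    case (step a s p)
    then show ?case
      using assms(1)[of s] homog_pdeg[of s] by (auto simp: hcomp_add hcomp_mult_homog)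
  qed simp
  then show ?thesis
    using lookup_hcomp[of 0 p 0] by simp
qed

section \<open>Monomial orders and reduction\<close>

locale monomial_order =
  fixes ord :: "'n::finite mon rel"
  assumes global_order: "global_monomial_order ord"
begin

lemma ord_refl: "(s, s) \<in> ord"
  and ord_antisym: "(s, t) \<in> ord \<Longrightarrow> (t, s) \<in> ord \<Longrightarrow> s = t"
  and ord_trans: "(s, t) \<in> ord \<Longrightarrow> (t, u) \<in> ord \<Longrightarrow> (s, u) \<in> ord"
  and ord_total: "(s, t) \<in> ord \<or> (t, s) \<in> ord"
  and wf_ord: "wf (ord - Id)"
  and ord_add: "(s, t) \<in> ord \<Longrightarrow> (s + u, t + u) \<in> ord"
proof -
  from global_order have w: "well_order_on UNIV ord"
    and a: "\<And>s t u. (s, t) \<in> ord \<Longrightarrow> (s + u, t + u) \<in> ord"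
    by (auto simp: global_monomial_order_def)
  from w have l: "refl ord" "trans ord" "antisym ord" "total ord" "wf (ord - Id)"
    by (auto simp: well_order_on_def linear_order_on_def partial_order_on_def preorder_on_def)
  show r: "(s, s) \<in> ord" for s
    using l(1) by (rule reflD)
  show "(s, t) \<in> ord \<Longrightarrow> (t, s) \<in> ord \<Longrightarrow> s = t"
    using l(3) by (rule antisymD)
  show "(s, t) \<in> ord \<Longrightarrow> (t, u) \<in> ord \<Longrightarrow> (s, u) \<in> ord"
    using l(2) by (rule transD)
  show "(s, t) \<in> ord \<or> (t, s) \<in> ord"
    using l(4) r[of s] by (cases "s = t") (auto simp: total_on_def)
  show "wf (ord - Id)" by (rule l)
  show "(s, t) \<in> ord \<Longrightarrow> (s + u, t + u) \<in> ord" by (rule a)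
qed

lemma ord_add_left: "(s, t) \<in> ord \<Longrightarrow> (u + s, u + t) \<in> ord"
  using ord_add[of s t u] by (simp add: add.commute)

lemma ord_Max_ex: "finite A \<Longrightarrow> A \<noteq> {} \<Longrightarrow> \<exists>m\<in>A. \<forall>k\<in>A. (k, m) \<in> ord"
proof (induction A rule: finite_ne_induct)
  case (insert x F)
  then show ?case
    using ord_total ord_trans ord_refl by (metis insert_iff)
qed (auto intro: ord_refl)

lemma lmon_eqI:
  assumes "m \<in> Poly_Mapping.keys p" "\<And>k. k \<in> Poly_Mapping.keys p \<Longrightarrow> (k, m) \<in> ord"
  shows "lmon ord p = m"
  unfolding lmon_def by (rule the_equality) (use assms ord_antisym in auto)

lemma
  assumes "p \<noteq> 0"
  shows lmon_in_keys: "lmon ord p \<in> Poly_Mapping.keys p"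
    and lmon_ge: "k \<in> Poly_Mapping.keys p \<Longrightarrow> (k, lmon ord p) \<in> ord"
proof -
  obtain m where m: "m \<in> Poly_Mapping.keys p" "\<forall>k\<in>Poly_Mapping.keys p. (k, m) \<in> ord"
    using ord_Max_ex[of "Poly_Mapping.keys p"] assms by auto
  then have "lmon ord p = m"
    by (intro lmon_eqI) auto
  with m show "lmon ord p \<in> Poly_Mapping.keys p"
    "k \<in> Poly_Mapping.keys p \<Longrightarrow> (k, lmon ord p) \<in> ord"
    by auto
qed

lemma lcoeff_nonzero: "p \<noteq> 0 \<Longrightarrow> lcoeff ord p \<noteq> 0"
  using lmon_in_keys[of p] by (simp add: lcoeff_def in_keys_iff)

lemma lmon_PMono [simp]: "lmon ord (PMono m :: ('n, 'k::field) mpol) = m"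
  by (rule lmon_eqI) (auto intro: ord_refl)

lemma keys_single_mult_le:
  assumes "k \<in> Poly_Mapping.keys (Poly_Mapping.single u c * g)" "g \<noteq> 0"
  shows "(k, u + lmon ord g) \<in> ord"
  using assms keys_single_mult_subset[of u c g] by (auto intro: ord_add_left lmon_ge)

lemma lookup_single_mult_lmon:
  "Poly_Mapping.lookup (Poly_Mapping.single u c * g) (u + lmon ord g) = c * lcoeff ord g"
  by (simp add: lookup_single_mult lcoeff_def)

lemma mdeg_lmon: "homog d p \<Longrightarrow> p \<noteq> 0 \<Longrightarrow> mdeg (lmon ord p) = d"
  using lmon_in_keys homogD by blast

lemma PMono_in_ideal_lm:
  assumes "PMono m \<in> (I :: ('n, 'k::field) mpol set)" shows "m \<in> lm_set ord I"
proof -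
  have "PMono m \<noteq> (0 :: ('n, 'k) mpol)"
    by (metis keys_PMono keys_zero empty_not_insert)
  then have "\<exists>p. m = lmon ord p \<and> p \<in> I \<and> p \<noteq> 0"
    using assms by (intro exI[of _ "PMono m"]) auto
  then show ?thesis
    by (simp add: lm_set_def)
qed

lemma red_stepE:
  assumes "red_step ord GG p q"
  obtains g u c where "g \<in> GG" "g \<noteq> 0" "u + lmon ord g \<in> Poly_Mapping.keys p"
    "q = p - Poly_Mapping.single u c * g"
  using assms unfolding red_step_def by blast

lemma red_steps_ideal:
  assumes "(red_step ord GG)\<^sup>*\<^sup>* p q"
  shows "p - q \<in> ideal_of GG"
  using assms
proof (induction rule: rtranclp_induct)
  case (step y z)
  from step(2) obtain g u c where "g \<in> GG" "z = y - Poly_Mapping.single u c * g"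
    by (rule red_stepE)
  then have "y - z \<in> ideal_of GG"
    by (auto intro: ideal_of_mult ideal_of_base)
  with step.IH have "(p - y) + (y - z) \<in> ideal_of GG"
    by (rule ideal_of_add)
  then show ?case by simp
qed simp

lemma red_step_homog:
  assumes "red_step ord GG p q" "homog d p" "\<And>g. g \<in> GG \<Longrightarrow> homogeneous g"
  shows "homog d q"
proof -
  from assms(1) obtain g u c where g: "g \<in> GG" "g \<noteq> 0" "u + lmon ord g \<in> Poly_Mapping.keys p"
    "q = p - Poly_Mapping.single u c * g"
    by (rule red_stepE)
  obtain e where e: "homog e g"
    using assms(3)[OF g(1)] by (auto simp: homogeneous_iff)
  have "mdeg u + e = d"
    using homogD[OF assms(2) g(3)] mdeg_lmon[OF e g(2)] by (simp add: mdeg_add)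
  then have "homog d (Poly_Mapping.single u c * g)"
    using homog_mult[OF homog_single e] by blast
  then show ?thesis
    using g(4) assms(2) by (simp add: homog_diff)
qed

lemma red_steps_homog:
  assumes "(red_step ord GG)\<^sup>*\<^sup>* p q" "homog d p" "\<And>g. g \<in> GG \<Longrightarrow> homogeneous g"
  shows "homog d q"
  using assms by (induction rule: rtranclp_induct) (auto intro: red_step_homog)

lemma irreducible_iff:
  "(\<nexists>q. red_step ord GG r q) \<longleftrightarrow>
    (\<forall>g\<in>GG. g \<noteq> 0 \<longrightarrow> (\<forall>k\<in>Poly_Mapping.keys r. \<not> mdvd (lmon ord g) k))"
  unfolding red_step_def mdvd_def by (metis add.commute)

text \<open>Cancelling the largest reducible monomial brings in only smaller monomials, so the
  largest reducible monomial descends in the well-order. Existence of some remainder keeps step (c)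
  from getting stuck.\<close>

lemma is_rem_exists:
  fixes b :: "('n, 'k::field) mpol"
  shows "\<exists>r. is_rem ord GG b r"
proof -
  define red where "red k \<longleftrightarrow> (\<exists>g\<in>GG. g \<noteq> 0 \<and> mdvd (lmon ord g) k)" for k
  have irr: "is_rem ord GG p p" if "\<forall>k\<in>Poly_Mapping.keys p. \<not> red k" for p :: "('n, 'k) mpol"
    unfolding is_rem_def irreducible_iff using that by (auto simp: red_def)
  \<comment> \<open>The bound \<open>m\<close> concerns the reducible monomials of \<open>p\<close>
    only; irreducible ones may exceed it.\<close>
  have main: "\<forall>p :: ('n, 'k) mpol. (\<forall>k\<in>Poly_Mapping.keys p. red k \<longrightarrow> (k, m) \<in> ord) \<longrightarrow> (\<exists>r. is_rem ord GG p r)" for m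
    using wf_ord
  proof (induction m rule: wf_induct_rule)
    case (less m)
    show ?case
    proof (intro allI impI)
      fix p :: "('n, 'k) mpol" assume p: "\<forall>k\<in>Poly_Mapping.keys p. red k \<longrightarrow> (k, m) \<in> ord"
      show "\<exists>r. is_rem ord GG p r"
      proof (cases "{k \<in> Poly_Mapping.keys p. red k} = {}")
        case True
        then show ?thesis using irr[of p] by blast
      next
        case False
        then obtain k where k: "k \<in> Poly_Mapping.keys p" "red k"
          and kmax: "\<And>k'. k' \<in> Poly_Mapping.keys p \<Longrightarrow> red k' \<Longrightarrow> (k', k) \<in> ord"
          using ord_Max_ex[of "{k \<in> Poly_Mapping.keys p. red k}"] by auto
        from k(2) obtain g u where g: "g \<in> GG" "g \<noteq> 0" "k = u + lmon ord g"
          by (auto simp: red_def mdvd_def add.commute)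
        define p' where "p' = p - Poly_Mapping.single u (Poly_Mapping.lookup p k / lcoeff ord g) * g"
        have step: "red_step ord GG p p'"
          unfolding red_step_def p'_def using g k(1) by blast
        have "Poly_Mapping.lookup p' k = 0"
          using lcoeff_nonzero[OF g(2)] by (simp add: p'_def lookup_minus g(3) lookup_single_mult_lmon)
        then have p': "(k', k) \<in> ord \<and> k' \<noteq> k" if "k' \<in> Poly_Mapping.keys p'" "red k'" for k'
        proof -
          have "k' \<in> Poly_Mapping.keys p \<or>
              k' \<in> Poly_Mapping.keys (Poly_Mapping.single u (Poly_Mapping.lookup p k / lcoeff ord g) * g)"
            using that(1) by (auto simp: p'_def in_keys_iff lookup_minus)
          then show ?thesis
            using kmax that keys_single_mult_le[OF _ g(2)] g(3) \<open>Poly_Mapping.lookup p' k = 0\<close>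
            by (auto simp: in_keys_iff)
        qed
        have "\<exists>r. is_rem ord GG p' r"
        proof (cases "{k' \<in> Poly_Mapping.keys p'. red k'} = {}")
          case True
          then show ?thesis using irr[of p'] by blast
        next
          case False
          then obtain m' where m': "m' \<in> Poly_Mapping.keys p'" "red m'"
            "\<And>k'. k' \<in> Poly_Mapping.keys p' \<Longrightarrow> red k' \<Longrightarrow> (k', m') \<in> ord"
            using ord_Max_ex[of "{k' \<in> Poly_Mapping.keys p'. red k'}"] by auto
          have "(k, m) \<in> ord" using p k by blast
          then have "(m', m) \<in> ord - Id"
            using p'[OF m'(1,2)] ord_trans ord_antisym by auto
          from less.IH[OF this] m'(3) show ?thesis by blast
        qed
        then show ?thesis
          using step unfolding is_rem_def by (meson converse_rtranclp_into_rtranclp)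
      qed
    qed
  qed
  show ?thesis
  proof (cases "b = 0")
    case True
    then show ?thesis using irr[of b] by auto
  next
    case False
    then show ?thesis using main[of "lmon ord b"] lmon_ge[OF False] by blast
  qed
qed

text \<open>The common consequence of complete and truncated bases that decides membership for forms
  of degree \<open>d\<close>, and that the insertions of step (c) preserve.\<close>

definition gb_in_degree :: "nat \<Rightarrow> ('n, 'k::field) mpol set \<Rightarrow> ('n, 'k) mpol set \<Rightarrow> bool" where
  "gb_in_degree d S GG \<longleftrightarrow> GG \<subseteq> ideal_of S \<and> (\<forall>g\<in>GG. homogeneous g) \<and>
     (\<forall>p\<in>ideal_of S. homog d p \<longrightarrow> p \<noteq> 0 \<longrightarrow> (\<exists>g\<in>GG. g \<noteq> 0 \<and> mdvd (lmon ord g) (lmon ord p)))"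

text \<open>If \<open>b\<close> is in the ideal, so is \<open>r\<close>; a nonzero \<open>r\<close>
  would then be a form of degree \<open>d\<close> in the ideal whose leading monomial is still
  reducible.\<close>

lemma gb_in_degree_rem:
  assumes gb: "gb_in_degree d S GG" and b: "homog d b" and r: "is_rem ord GG b r"
  shows "homog d r" "b - r \<in> ideal_of S" "r = 0 \<longleftrightarrow> b \<in> ideal_of S"
proof -
  have steps: "(red_step ord GG)\<^sup>*\<^sup>* b r"
    and irr: "\<And>g k. g \<in> GG \<Longrightarrow> g \<noteq> 0 \<Longrightarrow> k \<in> Poly_Mapping.keys r \<Longrightarrow> \<not> mdvd (lmon ord g) k"
    using r unfolding is_rem_def irreducible_iff by blast+
  show h: "homog d r"
    using red_steps_homog[OF steps b] gb by (auto simp: gb_in_degree_def)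
  have "ideal_of GG \<subseteq> ideal_of S"
    using gb by (intro ideal_of_subset) (auto simp: gb_in_degree_def)
  then show m: "b - r \<in> ideal_of S"
    using red_steps_ideal[OF steps] by blast
  show "r = 0 \<longleftrightarrow> b \<in> ideal_of S"
  proof
    assume "b \<in> ideal_of S"
    then have "r \<in> ideal_of S"
      using ideal_of_diff[OF _ m, of b] by simp
    then show "r = 0"
      using gb h irr lmon_in_keys[of r] unfolding gb_in_degree_def by blast
  qed (use m in simp)
qed

text \<open>A form of degree \<open>d\<close> in the larger ideal is \<open>h\<close> plus a scalar
  multiple of \<open>r\<close>, with \<open>h\<close> in the old ideal. No monomial of
  \<open>r\<close> is divisible by a leading monomial of \<open>GG\<close>, so the leading monomial
  of a nonzero \<open>h\<close> survives in the sum, and the sum is led by the leading monomial of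
  \<open>h\<close> or of \<open>r\<close>.\<close>

lemma gb_in_degree_insert:
  assumes gb: "gb_in_degree d S GG" and b: "homog d b" and r: "is_rem ord GG b r" and "r \<noteq> 0"
    and S: "\<And>s. s \<in> S \<Longrightarrow> homogeneous s"
  shows "gb_in_degree d (insert b S) (insert r GG)"
proof -
  note rem = gb_in_degree_rem[OF gb b r]
  have sub: "ideal_of S \<subseteq> ideal_of (insert b S)"
    by (rule ideal_of_mono) auto
  have irr: "\<And>g k. g \<in> GG \<Longrightarrow> g \<noteq> 0 \<Longrightarrow> k \<in> Poly_Mapping.keys r \<Longrightarrow> \<not> mdvd (lmon ord g) k"
    using r unfolding is_rem_def irreducible_iff by blast+
  have "b - (b - r) \<in> ideal_of (insert b S)"
  proof (rule ideal_of_diff)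
    show "b - r \<in> ideal_of (insert b S)" using rem(2) sub by blast
  qed (rule ideal_of_base, simp)
  then have "r \<in> ideal_of (insert b S)" by simp
  moreover have "\<exists>g\<in>insert r GG. g \<noteq> 0 \<and> mdvd (lmon ord g) (lmon ord p)"
    if p: "p \<in> ideal_of (insert b S)" "homog d p" "p \<noteq> 0" for p
  proof -
    obtain h0 c where h0: "h0 \<in> ideal_of S" "homog d h0" "p = h0 + PConst c * b"
      using ideal_of_insert_homogE[OF p(1,2) b order_refl S] by blast
    \<comment> \<open>Trades \<open>b\<close> for its remainder: \<open>b - r\<close> is a form of
      degree \<open>d\<close> in the old ideal.\<close>
    define h where "h = h0 + PConst c * (b - r)"
    have h: "h \<in> ideal_of S" "homog d h" "p = h + PConst c * r"
    proof -
      show "h \<in> ideal_of S"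
        unfolding h_def by (rule ideal_of_add[OF h0(1) ideal_of_mult[OF rem(2)]])
      show "homog d h"
        unfolding h_def by (rule homog_add[OF h0(2) homog_PConst_mult[OF homog_diff[OF b rem(1)]]])
      show "p = h + PConst c * r"
        by (simp add: h_def h0(3) right_diff_distrib)
    qed
    have hdvd: "\<exists>g\<in>GG. g \<noteq> 0 \<and> mdvd (lmon ord g) (lmon ord h)" if "h \<noteq> 0"
      using gb h that by (auto simp: gb_in_degree_def)
    show ?thesis
    proof (cases "h = 0")
      case True
      then have "c \<noteq> 0" and "p = PConst c * r"
        using h p(3) by auto
      then have "lmon ord p = lmon ord r"
        using lmon_in_keys[OF \<open>r \<noteq> 0\<close>] lmon_ge[OF \<open>r \<noteq> 0\<close>]
        by (intro lmon_eqI) (auto simp: in_keys_iff lookup_PConst_mult)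
      then show ?thesis
        using \<open>r \<noteq> 0\<close> by (auto simp: mdvd_def intro: exI[of _ 0])
    next
      case False
      then obtain g where g: "g \<in> GG" "g \<noteq> 0" "mdvd (lmon ord g) (lmon ord h)"
        using hdvd by blast
      have lh: "lmon ord h \<notin> Poly_Mapping.keys r"
        using irr g by blast
      have lp: "lmon ord h \<in> Poly_Mapping.keys p"
        using lh lmon_in_keys[OF False] by (simp add: h(3) in_keys_iff lookup_add lookup_PConst_mult)
      show ?thesis
      proof (cases "lmon ord p = lmon ord h")
        case True
        then show ?thesis using g by auto
      next
        case neq: False
        have "lmon ord p \<notin> Poly_Mapping.keys h"
          using neq lmon_ge[OF False] lmon_ge[OF p(3) lp] ord_antisym by blast
        then have pr: "lmon ord p \<in> Poly_Mapping.keys r"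
          using lmon_in_keys[OF p(3)] by (auto simp: h(3) in_keys_iff lookup_add lookup_PConst_mult)
        \<comment> \<open>Were the leading monomial of \<open>r\<close> cancelled, it would occur in
          \<open>h\<close>; the leading monomial of \<open>p\<close>, which occurs in
          \<open>r\<close>, would then be at most that of \<open>h\<close>, hence equal to
          it.\<close>
        have lr: "lmon ord r \<in> Poly_Mapping.keys p"
        proof (rule ccontr)
          assume n: "lmon ord r \<notin> Poly_Mapping.keys p"
          have "c \<noteq> 0"
            using \<open>lmon ord p \<notin> Poly_Mapping.keys h\<close> lmon_in_keys[OF p(3)]
            by (auto simp: h(3))
          then have "lmon ord r \<in> Poly_Mapping.keys h"
            using n lmon_in_keys[OF \<open>r \<noteq> 0\<close>]
            by (auto simp: h(3) in_keys_iff lookup_add lookup_PConst_mult)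
          then have "(lmon ord r, lmon ord h) \<in> ord" by (rule lmon_ge[OF False])
          moreover have "(lmon ord p, lmon ord r) \<in> ord"
            using pr by (rule lmon_ge[OF \<open>r \<noteq> 0\<close>])
          ultimately have "(lmon ord p, lmon ord h) \<in> ord"
            using ord_trans by blast
          then show False
            using neq lmon_ge[OF p(3) lp] ord_antisym by blast
        qed
        have "lmon ord p = lmon ord r"
          using lmon_ge[OF p(3) lr] lmon_ge[OF \<open>r \<noteq> 0\<close> pr] ord_antisym by blast
        then show ?thesis
          using \<open>r \<noteq> 0\<close> by (auto simp: mdvd_def intro: exI[of _ 0])
      qed
    qed
  qed
  ultimately show ?thesis
    using gb rem(1) sub unfolding gb_in_degree_def homogeneous_iff by blast
qed

text \<open>Macaulay's argument, by induction along the well-order: modulo the ideal, a leading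
  monomial is a combination of smaller monomials of the same degree.\<close>

lemma standard_monomials_span:
  fixes p :: "('n, 'k::field) mpol"
  assumes S: "\<And>s. s \<in> S \<Longrightarrow> homogeneous s" and p: "homog d p"
  shows "p \<in> kv.span (PMono ` mon_d ord d S \<union> ideal_of S)"
proof -
  let ?V = "kv.span (PMono ` mon_d ord d S \<union> ideal_of S :: ('n, 'k) mpol set)"
  have mon: "mdeg m = d \<longrightarrow> PMono m \<in> ?V" for m
    using wf_ord
  proof (induction m rule: wf_induct_rule)
    case (less m)
    show ?case
    proof (rule impI, cases "m \<in> lm_set ord (ideal_of S)")
      case False
      assume "mdeg m = d"
      with False show "PMono m \<in> ?V"
        by (auto simp: mon_d_def intro: kv.span_base)
    next
      case True
      assume m: "mdeg m = d"
      from True obtain p where p: "p \<in> ideal_of S" "p \<noteq> 0" "m = lmon ord p"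
        by (auto simp: lm_set_def)
      \<comment> \<open>The witness \<open>p\<close> may mix degrees. Its component of degree
        \<open>d\<close> stays in the ideal and keeps the leading term, and all its other terms are
        smaller and of degree \<open>d\<close>.\<close>
      define q where "q = hcomp d p"
      let ?c = "Poly_Mapping.lookup q m"
      have q: "q \<in> ideal_of S"
        unfolding q_def using S p(1) by (rule hcomp_in_ideal)
      have c: "?c \<noteq> 0"
        using lmon_in_keys[OF p(2)] m p(3) by (simp add: q_def lookup_hcomp in_keys_iff)
      have k: "Poly_Mapping.single k (Poly_Mapping.lookup q k) \<in> ?V"
        if "k \<in> Poly_Mapping.keys q - {m}" for k
      proof -
        from that have "k \<in> Poly_Mapping.keys p" "mdeg k = d" "k \<noteq> m"
          by (auto simp: q_def lookup_hcomp in_keys_iff when_def split: if_splits)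
        then have "PMono k \<in> ?V"
          using less.IH[of k] lmon_ge[OF p(2)] p(3) by auto
        then show ?thesis
          unfolding single_eq_PConst_mult by (rule kv.span_scale)
      qed
      have "q = Poly_Mapping.single m ?c +
          (\<Sum>k\<in>Poly_Mapping.keys q - {m}. Poly_Mapping.single k (Poly_Mapping.lookup q k))"
        using c lookup_sum_single[of q]
          sum.remove[of "Poly_Mapping.keys q" m "\<lambda>k. Poly_Mapping.single k (Poly_Mapping.lookup q k)"]
        by (simp add: in_keys_iff)
      then have "PConst ?c * PMono m =
          q - (\<Sum>k\<in>Poly_Mapping.keys q - {m}. Poly_Mapping.single k (Poly_Mapping.lookup q k))"
        by (metis add_diff_cancel_right' single_eq_PConst_mult)
      also have "\<dots> \<in> ?V"
      proof (rule kv.span_diff)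
        show "q \<in> ?V" using q by (intro kv.span_base) blast
      qed (use k in \<open>rule kv.span_sum\<close>)
      finally have "PConst (1 / ?c) * (PConst ?c * PMono m) \<in> ?V"
        by (rule kv.span_scale)
      then show "PMono m \<in> ?V"
        using c by (simp add: mult.assoc[symmetric] PConst_mult)
    qed
  qed
  have "(\<Sum>m\<in>Poly_Mapping.keys p. Poly_Mapping.single m (Poly_Mapping.lookup p m)) \<in> ?V"
    using mon homogD[OF p] unfolding single_eq_PConst_mult
    by (intro kv.span_sum kv.span_scale) auto
  then show ?thesis
    using lookup_sum_single[of p] by simp
qed

end

section \<open>Groebner bases\<close>

lemma mdvd_iff: "mdvd s t \<longleftrightarrow> (\<forall>i. Poly_Mapping.lookup s i \<le> Poly_Mapping.lookup t i)"
proof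
  assume "\<forall>i. Poly_Mapping.lookup s i \<le> Poly_Mapping.lookup t i"
  then have "t = s + (t - s)"
    by (intro poly_mapping_eqI) (simp add: lookup_add lookup_minus)
  then show "mdvd s t"
    unfolding mdvd_def by blast
qed (auto simp: mdvd_def lookup_add)

lemma mdvd_trans: "mdvd s t \<Longrightarrow> mdvd t u \<Longrightarrow> mdvd s u"
  unfolding mdvd_iff by (meson le_trans)

text \<open>Every sequence has a monotone subsequence, and a decreasing sequence of naturals is
  constant from the place of its minimum on.\<close>

lemma nat_seq_mono_subseq:
  fixes s :: "nat \<Rightarrow> nat"
  obtains r where "strict_mono r" "incseq (\<lambda>n. s (r n))"
proof -
  obtain f where f: "strict_mono f" "monoseq (\<lambda>n. s (f n))"
    using seq_monosub[of s] by blast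
  from f(2)[unfolded monoseq_iff] show thesis
  proof
    assume "incseq (\<lambda>n. s (f n))"
    with f(1) show thesis by (rule that)
  next
    assume d: "decseq (\<lambda>n. s (f n))"
    obtain n0 where n0: "\<And>n. s (f n0) \<le> s (f n)"
      using ex_has_least_nat[of "\<lambda>_. True" 0 "\<lambda>n. s (f n)"] by auto
    define v where "v = s (f n0)"
    have "s (f n) = v" if "n \<ge> n0" for n
      using decseqD[OF d that] n0[of n] by (simp add: v_def)
    then have "incseq (\<lambda>n. s (f (n + n0)))"
      by (simp add: incseq_def)
    moreover have "strict_mono (\<lambda>n. f (n + n0))"
      using f(1) by (simp add: strict_mono_def)
    ultimately show thesis by (rule that[rotated])
  qed
qed

text \<open>Passing to a subsequence once per variable makes all exponents nondecreasing; any two of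
  the remaining monomials then divide in order.\<close>

lemma dickson_seq:
  fixes m :: "nat \<Rightarrow> 'n::finite mon"
  obtains i j where "i < j" "mdvd (m i) (m j)"
proof -
  have "\<exists>r :: nat \<Rightarrow> nat. strict_mono r \<and> (\<forall>i\<in>A. incseq (\<lambda>k. Poly_Mapping.lookup (m (r k)) i))"
    if "finite A" for A :: "'n set"
    using that
  proof (induction A rule: finite_induct)
    case empty
    show ?case by (intro exI[of _ id]) (auto simp: strict_mono_def)
  next
    case (insert x A)
    then obtain r where r: "strict_mono r" "\<forall>i\<in>A. incseq (\<lambda>k. Poly_Mapping.lookup (m (r k)) i)"
      by blast
    obtain q where q: "strict_mono q" "incseq (\<lambda>k. Poly_Mapping.lookup (m (r (q k))) x)"
      by (rule nat_seq_mono_subseq[of "\<lambda>k. Poly_Mapping.lookup (m (r k)) x"])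
    have "incseq q" using q(1) by (rule strict_mono_mono)
    show ?case
    proof (intro exI[of _ "\<lambda>k. r (q k)"] conjI ballI)
      show "strict_mono (\<lambda>k. r (q k))"
        using r(1) q(1) by (simp add: strict_mono_def)
      fix i assume "i \<in> insert x A"
      then show "incseq (\<lambda>k. Poly_Mapping.lookup (m (r (q k))) i)"
        using q(2) r(2) \<open>incseq q\<close> by (auto simp: incseq_def)
    qed
  qed
  from this[of UNIV] obtain r where r: "strict_mono r"
    "\<forall>i. incseq (\<lambda>k. Poly_Mapping.lookup (m (r k)) i)"
    by auto
  show thesis
  proof (rule that)
    show "r 0 < r 1" using r(1) by (simp add: strict_mono_def)
    show "mdvd (m (r 0)) (m (r 1))"
      using r(2) by (auto simp: mdvd_iff incseq_def)
  qed
qed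

text \<open>\<open>F\<close> consists of the monomials of \<open>M\<close> that are minimal under
  divisibility. Infinitely many of them would contradict \<open>dickson_seq\<close>, and a divisor
  in \<open>M\<close> of least degree is minimal.\<close>

lemma dickson:
  fixes M :: "'n::finite mon set"
  obtains F where "finite F" "F \<subseteq> M" "\<And>m. m \<in> M \<Longrightarrow> \<exists>f\<in>F. mdvd f m"
proof
  let ?F = "{m \<in> M. \<forall>k\<in>M. mdvd k m \<longrightarrow> k = m}"
  show "?F \<subseteq> M" by blast
  show "finite ?F"
  proof (rule ccontr)
    assume "infinite ?F"
    then obtain f :: "nat \<Rightarrow> 'n mon" where f: "inj f" "range f \<subseteq> ?F"
      using infinite_countable_subset[of ?F] by blast
    obtain i j where ij: "i < j" "mdvd (f i) (f j)"
      by (rule dickson_seq)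
    have "f i = f j"
      using f(2) ij(2) by blast
    then show False
      using f(1) ij(1) by (auto dest: injD)
  qed
  fix m assume "m \<in> M"
  then have "m \<in> M \<and> mdvd m m"
    by (simp add: mdvd_iff)
  then obtain k where k: "k \<in> M" "mdvd k m"
    and min: "\<And>k'. k' \<in> M \<Longrightarrow> mdvd k' m \<Longrightarrow> mdeg k \<le> mdeg k'"
    using ex_has_least_nat[of "\<lambda>k. k \<in> M \<and> mdvd k m" m mdeg] by auto
  have "k' = k" if "k' \<in> M" "mdvd k' k" for k'
  proof -
    from that(2) obtain u where u: "k = k' + u" by (auto simp: mdvd_def)
    have "mdeg k \<le> mdeg k'"
      using min[OF that(1)] mdvd_trans[OF that(2) k(2)] by blast
    then have "u = 0" by (simp add: u mdeg_add mdeg_eq_0_iff)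
    then show ?thesis using u by simp
  qed
  then show "\<exists>f\<in>?F. mdvd f m" using k by blast
qed

lemma lookup_mlcm: "Poly_Mapping.lookup (mlcm s t) i = max (Poly_Mapping.lookup s i) (Poly_Mapping.lookup t i)"
  by (simp add: mlcm.rep_eq)

lemma mlcm_diff_add: "mlcm s t - s + s = mlcm s t" "mlcm s t - t + t = mlcm s t"
  by (intro poly_mapping_eqI; simp add: lookup_add lookup_minus lookup_mlcm)+

lemma mdvd_mlcm: "mdvd s m \<Longrightarrow> mdvd t m \<Longrightarrow> mdvd (mlcm s t) m"
  by (simp add: mdvd_iff lookup_mlcm)

section \<open>Existence of homogeneous Groebner bases\<close>

context monomial_order begin

lemma homogeneous_GB_gb_in_degree:
  assumes "homogeneous_GB ord S GG"
  shows "gb_in_degree d S GG"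
proof -
  have "GG \<subseteq> ideal_of S"
    using assms ideal_of_base[of _ GG] by (auto simp: homogeneous_GB_def)
  then show ?thesis
    using assms by (auto simp: homogeneous_GB_def gb_in_degree_def lm_set_def)
qed

text \<open>Dickson's lemma gives finitely many monomials \<open>f\<close> to be realised as leading
  monomials; the component of degree \<open>mdeg f\<close> of a witness still has leading monomial
  \<open>f\<close>. The chosen forms generate the ideal because every element of \<open>S\<close>
  has remainder 0.\<close>

lemma homogeneous_GB_exists:
  assumes S: "\<And>s. s \<in> S \<Longrightarrow> homogeneous s"
  shows "\<exists>GG. homogeneous_GB ord S (GG :: ('n, 'k::field) mpol set)"
proof -
  obtain F where F: "finite F" "F \<subseteq> lm_set ord (ideal_of S)"
    "\<And>m. m \<in> lm_set ord (ideal_of S) \<Longrightarrow> \<exists>f\<in>F. mdvd f m"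
    using dickson[of "lm_set ord (ideal_of S)"] by blast
  have "\<exists>p. p \<in> ideal_of S \<and> p \<noteq> 0 \<and> homogeneous p \<and> lmon ord p = f" if f: "f \<in> F" for f
  proof -
    obtain p where p: "p \<in> ideal_of S" "p \<noteq> 0" "f = lmon ord p"
      using F(2) f by (auto simp: lm_set_def)
    let ?q = "hcomp (mdeg f) p"
    have fk: "f \<in> Poly_Mapping.keys ?q"
      using lmon_in_keys[OF p(2)] p(3) by (simp add: in_keys_iff lookup_hcomp)
    have "lmon ord ?q = f"
    proof (rule lmon_eqI[OF fk])
      fix k assume "k \<in> Poly_Mapping.keys ?q"
      then have "k \<in> Poly_Mapping.keys p"
        by (auto simp: in_keys_iff lookup_hcomp when_def split: if_splits)
      then show "(k, f) \<in> ord"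
        using lmon_ge[OF p(2)] p(3) by simp
    qed
    moreover have "?q \<in> ideal_of S"
      using S p(1) by (rule hcomp_in_ideal)
    moreover have "?q \<noteq> 0"
      using fk by auto
    ultimately show ?thesis
      using homog_hcomp[of "mdeg f" p] by (auto simp: homogeneous_iff)
  qed
  then have "\<exists>P. \<forall>f\<in>F. P f \<in> ideal_of S \<and> P f \<noteq> 0 \<and> homogeneous (P f) \<and> lmon ord (P f) = f"
    by (intro bchoice ballI)
  then obtain P where P: "\<And>f. f \<in> F \<Longrightarrow> P f \<in> ideal_of S" "\<And>f. f \<in> F \<Longrightarrow> P f \<noteq> 0"
    "\<And>f. f \<in> F \<Longrightarrow> homogeneous (P f)" "\<And>f. f \<in> F \<Longrightarrow> lmon ord (P f) = f"
    by blast
  let ?G = "P ` F"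
  have sub: "?G \<subseteq> ideal_of S" using P(1) by blast
  have cov: "\<exists>g\<in>?G. g \<noteq> 0 \<and> mdvd (lmon ord g) m" if "m \<in> lm_set ord (ideal_of S)" for m
    using F(3)[OF that] P by auto
  have gb: "gb_in_degree d S ?G" for d
    unfolding gb_in_degree_def
  proof (intro conjI ballI impI sub)
    fix p assume "p \<in> ideal_of S" "homog d p" "p \<noteq> 0"
    then have "lmon ord p \<in> lm_set ord (ideal_of S)"
      unfolding lm_set_def by blast
    then show "\<exists>g\<in>?G. g \<noteq> 0 \<and> mdvd (lmon ord g) (lmon ord p)"
      by (rule cov)
  qed (use P(3) in blast)
  have "S \<subseteq> ideal_of ?G"
  proof
    fix s assume s: "s \<in> S"
    obtain d where d: "homog d s"
      using S[OF s] by (auto simp: homogeneous_iff)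
    obtain r where r: "is_rem ord ?G s r"
      using is_rem_exists by blast
    have "r = 0"
      using gb_in_degree_rem(3)[OF gb d r] ideal_of_base[OF s] by blast
    then show "s \<in> ideal_of ?G"
      using r red_steps_ideal[of ?G s r] by (simp add: is_rem_def)
  qed
  then have "ideal_of ?G = ideal_of S"
    using ideal_of_subset sub by blast
  then have "homogeneous_GB ord S ?G"
    using F(1) P(3) cov by (auto simp: homogeneous_GB_def)
  then show ?thesis by blast
qed

lemma spoly_in_ideal:
  assumes "f \<in> GG" "g \<in> GG"
  shows "spoly ord f g \<in> ideal_of GG"
  unfolding spoly_def Let_def
  by (intro ideal_of_diff ideal_of_mult ideal_of_base assms)

text \<open>A complete basis qualifies for every \<open>d\<close>: all elements of its ideal,
  S-polynomials included, reduce to 0.\<close>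

lemma homogeneous_GB_upto_exists:
  assumes S: "\<And>s. s \<in> S \<Longrightarrow> homogeneous s"
  shows "\<exists>GG. homogeneous_GB_upto ord d S (GG :: ('n, 'k::field) mpol set)"
proof -
  obtain GG where GG: "homogeneous_GB ord S GG"
    using homogeneous_GB_exists S by blast
  have red: "(red_step ord GG)\<^sup>*\<^sup>* p 0" if p: "p \<in> ideal_of GG" for p
  proof -
    obtain r where r: "is_rem ord GG p r"
      using is_rem_exists by blast
    have steps: "(red_step ord GG)\<^sup>*\<^sup>* p r"
      using r by (simp add: is_rem_def)
    have "r \<in> ideal_of GG"
      using ideal_of_diff[OF p red_steps_ideal[OF steps]] by simp
    have "r = 0"
    proof (rule ccontr)
      assume "r \<noteq> 0"
      then have "lmon ord r \<in> lm_set ord (ideal_of S)"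
        using \<open>r \<in> ideal_of GG\<close> GG by (auto simp: lm_set_def homogeneous_GB_def)
      then obtain g where "g \<in> GG" "g \<noteq> 0" "mdvd (lmon ord g) (lmon ord r)"
        using GG by (auto simp: homogeneous_GB_def)
      then show False
        using r lmon_in_keys[OF \<open>r \<noteq> 0\<close>] unfolding is_rem_def irreducible_iff by blast
    qed
    with steps show ?thesis by simp
  qed
  have "homogeneous_GB_upto ord d S GG"
    using GG red[OF spoly_in_ideal] by (simp add: homogeneous_GB_def homogeneous_GB_upto_def)
  then show ?thesis by blast
qed


subsection \<open>The truncated Buchberger criterion\<close>

text \<open>The building blocks of standard representations: monomial multiples of basis elements,
  sorted by their leading monomial \<open>u + lmon ord g\<close>, which \<open>Z\<close>
  restricts.\<close>

definition shifts :: "('n, 'k::field) mpol set \<Rightarrow> 'n mon set \<Rightarrow> ('n, 'k) mpol set" where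
  "shifts GG Z = (\<lambda>(u, g). PMono u * g) ` {(u, g). g \<in> GG \<and> g \<noteq> 0 \<and> u + lmon ord g \<in> Z}"

lemma shiftsI: "g \<in> GG \<Longrightarrow> g \<noteq> 0 \<Longrightarrow> u + lmon ord g \<in> Z \<Longrightarrow> PMono u * g \<in> shifts GG Z"
  unfolding shifts_def by (rule image_eqI[of _ _ "(u, g)"]) auto

lemma shiftsE:
  assumes "x \<in> shifts GG Z"
  obtains u g where "x = PMono u * g" "g \<in> GG" "g \<noteq> 0" "u + lmon ord g \<in> Z"
  using assms by (auto simp: shifts_def)

text \<open>Fixing the degree makes this set finite, which the order alone does not
  guarantee.\<close>

definition below :: "'n mon \<Rightarrow> 'n mon set" where
  "below m = {k. (k, m) \<in> ord \<and> k \<noteq> m \<and> mdeg k = mdeg m}"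

lemma below_downward: "(k, k') \<in> ord \<Longrightarrow> k' \<in> below m \<Longrightarrow> mdeg k = mdeg k' \<Longrightarrow> k \<in> below m"
  using ord_trans[of k k' m] ord_antisym[of k' m] by (auto simp: below_def)

lemma below_add: "k \<in> below m \<Longrightarrow> w + k \<in> below (w + m)"
  by (auto simp: below_def mdeg_add intro: ord_add_left)

lemma keys_shift:
  assumes "homogeneous g" "g \<noteq> 0" "k \<in> Poly_Mapping.keys (Poly_Mapping.single u c * g)"
  shows "(k, u + lmon ord g) \<in> ord" "mdeg k = mdeg (u + lmon ord g)"
proof -
  show "(k, u + lmon ord g) \<in> ord"
    by (rule keys_single_mult_le[OF assms(3,2)])
  obtain e where e: "homog e g"
    using assms(1) by (auto simp: homogeneous_iff)
  show "mdeg k = mdeg (u + lmon ord g)"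
    using homogD[OF homog_mult[OF homog_single e] assms(3)] mdeg_lmon[OF e assms(2)]
    by (simp add: mdeg_add)
qed

text \<open>All monomials of a shift have the degree of its leading monomial and do not exceed it;
  linear combinations create no new monomials.\<close>

lemma keys_span_shifts:
  assumes GG: "\<And>g. g \<in> GG \<Longrightarrow> homogeneous g"
    and p: "p \<in> kv.span (shifts GG Z)" and k: "k \<in> Poly_Mapping.keys p"
  shows "\<exists>x\<in>Z. (k, x) \<in> ord \<and> mdeg k = mdeg x"
proof -
  have "\<forall>k\<in>Poly_Mapping.keys p. \<exists>x\<in>Z. (k, x) \<in> ord \<and> mdeg k = mdeg x"
    using p
  proof (induction rule: kv.span_induct_alt)
    case (step c x y)
    from step.hyps obtain u g where ug: "x = PMono u * g" "g \<in> GG" "g \<noteq> 0" "u + lmon ord g \<in> Z"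
      by (rule shiftsE)
    show ?case
    proof
      fix k assume "k \<in> Poly_Mapping.keys (PConst c * x + y)"
      then have "k \<in> Poly_Mapping.keys x \<or> k \<in> Poly_Mapping.keys y"
        by (cases "Poly_Mapping.lookup x k = 0") (simp_all add: in_keys_iff lookup_add lookup_PConst_mult)
      then show "\<exists>z\<in>Z. (k, z) \<in> ord \<and> mdeg k = mdeg z"
      proof
        assume "k \<in> Poly_Mapping.keys x"
        then have "k \<in> Poly_Mapping.keys (Poly_Mapping.single u 1 * g)"
          by (simp add: ug(1) PMono_def)
        from keys_shift[OF GG[OF ug(2)] ug(3) this] show ?thesis
          by (intro bexI[OF _ ug(4)]) simp
      next
        assume "k \<in> Poly_Mapping.keys y"
        with step.IH show ?thesis by (rule bspec)
      qed
    qed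
  qed simp
  then show ?thesis using k by blast
qed

text \<open>Each step subtracts a scalar multiple of a shift whose leading monomial occurs in the
  current polynomial, hence lies below \<open>m\<close>. A reduction to 0 thus becomes a
  representation by shifts below \<open>m\<close>.\<close>

lemma red_steps_span:
  assumes GG: "\<And>g. g \<in> GG \<Longrightarrow> homogeneous g"
    and "(red_step ord GG)\<^sup>*\<^sup>* p q" "Poly_Mapping.keys p \<subseteq> below m"
  shows "Poly_Mapping.keys q \<subseteq> below m \<and> p - q \<in> kv.span (shifts GG (below m))"
  using assms(2)
proof (induction rule: rtranclp_induct)
  case base
  then show ?case using assms(3) by (simp add: kv.span_zero)
next
  case (step y z)
  from step.hyps(2) obtain g u c where g: "g \<in> GG" "g \<noteq> 0" "u + lmon ord g \<in> Poly_Mapping.keys y"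
    and z: "z = y - Poly_Mapping.single u c * g"
    by (rule red_stepE)
  have b: "u + lmon ord g \<in> below m" using g(3) step.IH by blast
  have "k \<in> below m" if "k \<in> Poly_Mapping.keys z" for k
  proof (cases "k \<in> Poly_Mapping.keys y")
    case True
    with step.IH show ?thesis by (auto simp: subset_iff)
  next
    case False
    then have "k \<in> Poly_Mapping.keys (Poly_Mapping.single u c * g)"
      using that by (simp add: z in_keys_iff lookup_minus)
    from keys_shift[OF GG[OF g(1)] g(2) this] show ?thesis
      using below_downward[OF _ b] by blast
  qed
  moreover have "y - z \<in> kv.span (shifts GG (below m))"
  proof -
    have "PMono u * g \<in> shifts GG (below m)"
      using g(1,2) b by (rule shiftsI)
    then have "PConst c * (PMono u * g) \<in> kv.span (shifts GG (below m))"
      by (rule kv.span_scale[OF kv.span_base])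
    moreover have "y - z = PConst c * (PMono u * g)"
      unfolding z single_eq_PConst_mult mult.assoc by simp
    ultimately show ?thesis by (simp only:)
  qed
  with step.IH have "(p - y) + (y - z) \<in> kv.span (shifts GG (below m))"
    by (intro kv.span_add) auto
  ultimately show ?case by auto
qed

text \<open>Both multiples have coefficient 1 at the least common multiple, so this monomial
  cancels; homogeneity keeps the others in its degree.\<close>

lemma spoly_keys:
  assumes "homogeneous f" "f \<noteq> 0" "homogeneous g" "g \<noteq> 0"
  shows "Poly_Mapping.keys (spoly ord f g) \<subseteq> below (mlcm (lmon ord f) (lmon ord g))"
proof
  let ?t = "mlcm (lmon ord f) (lmon ord g)"
  let ?a = "Poly_Mapping.single (?t - lmon ord f) (inverse (lcoeff ord f)) * f"
  let ?b = "Poly_Mapping.single (?t - lmon ord g) (inverse (lcoeff ord g)) * g"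
  fix k assume k: "k \<in> Poly_Mapping.keys (spoly ord f g)"
  have s: "spoly ord f g = ?a - ?b"
    by (simp add: spoly_def Let_def)
  have "Poly_Mapping.lookup ?a ?t = 1"
    using lookup_single_mult_lmon[of "?t - lmon ord f" "inverse (lcoeff ord f)" f]
      lcoeff_nonzero[OF assms(2)] by (simp add: mlcm_diff_add)
  moreover have "Poly_Mapping.lookup ?b ?t = 1"
    using lookup_single_mult_lmon[of "?t - lmon ord g" "inverse (lcoeff ord g)" g]
      lcoeff_nonzero[OF assms(4)] by (simp add: mlcm_diff_add)
  ultimately have "k \<noteq> ?t"
    using k by (auto simp: s in_keys_iff lookup_minus)
  moreover from k have "k \<in> Poly_Mapping.keys ?a \<or> k \<in> Poly_Mapping.keys ?b"
    by (auto simp: s in_keys_iff lookup_minus)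
  then have "(k, ?t) \<in> ord \<and> mdeg k = mdeg ?t"
    using keys_shift[OF assms(1,2), of k "?t - lmon ord f" "inverse (lcoeff ord f)"]
      keys_shift[OF assms(3,4), of k "?t - lmon ord g" "inverse (lcoeff ord g)"]
    by (auto simp: mlcm_diff_add)
  ultimately show "k \<in> below ?t"
    by (simp add: below_def)
qed

lemma span_shifts_mult:
  assumes "p \<in> kv.span (shifts GG (below m))"
  shows "PMono w * p \<in> kv.span (shifts GG (below (w + m)))"
  using assms
proof (induction rule: kv.span_induct_alt)
  case base
  show ?case by (simp add: kv.span_zero)
next
  case (step c x y)
  from step.hyps obtain u g where ug: "x = PMono u * g" "g \<in> GG" "g \<noteq> 0" "u + lmon ord g \<in> below m"
    by (rule shiftsE)
  have "PMono w * x = PMono (w + u) * g"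
    by (simp add: ug(1) PMono_add mult.assoc)
  moreover have "(w + u) + lmon ord g \<in> below (w + m)"
    using below_add[OF ug(4), of w] by (simp add: add.assoc)
  ultimately have "PMono w * x \<in> shifts GG (below (w + m))"
    unfolding \<open>PMono w * x = PMono (w + u) * g\<close> using ug(2,3) by (intro shiftsI)
  then have "PConst c * (PMono w * x) + PMono w * y \<in> kv.span (shifts GG (below (w + m)))"
    by (rule kv.span_add[OF kv.span_scale[OF kv.span_base] step.IH])
  then show ?case
    by (simp add: distrib_left mult.left_commute)
qed

text \<open>Two shifted elements with the same leading monomial agree, up to normalisation, modulo
  shifts with smaller leading monomial: their difference is a shifted S-polynomial.\<close>

lemma shifts_congruent:
  assumes gb: "homogeneous_GB_upto ord d S GG" and "mdeg m \<le> d"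
    and f: "f \<in> GG" "f \<noteq> 0" "u + lmon ord f = m"
    and g: "g \<in> GG" "g \<noteq> 0" "v + lmon ord g = m"
  shows "PConst (inverse (lcoeff ord f)) * (PMono u * f) - PConst (inverse (lcoeff ord g)) * (PMono v * g)
    \<in> kv.span (shifts GG (below m))"
proof -
  let ?t = "mlcm (lmon ord f) (lmon ord g)"
  have h: "homogeneous f" "homogeneous g"
    using gb f g by (auto simp: homogeneous_GB_upto_def)
  have "mdvd ?t m"
    using f(3) g(3) by (intro mdvd_mlcm) (metis add.commute mdvd_def)+
  then obtain w where w: "m = w + ?t"
    by (auto simp: mdvd_def add.commute)
  then have "mdeg ?t \<le> d"
    using assms(2) by (simp add: mdeg_add)
  then have "(red_step ord GG)\<^sup>*\<^sup>* (spoly ord f g) 0"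
    using gb f g by (fastforce simp: homogeneous_GB_upto_def)
  moreover have "\<And>g. g \<in> GG \<Longrightarrow> homogeneous g"
    using gb by (auto simp: homogeneous_GB_upto_def)
  ultimately have "spoly ord f g - 0 \<in> kv.span (shifts GG (below ?t))"
    using red_steps_span[OF _ _ spoly_keys[OF h(1) f(2) h(2) g(2)]] by blast
  then have "PMono w * spoly ord f g \<in> kv.span (shifts GG (below m))"
    unfolding w by (intro span_shifts_mult) simp
  moreover have "w + (?t - lmon ord f) = u"
  proof -
    have "w + (?t - lmon ord f) + lmon ord f = u + lmon ord f"
      using w f(3) by (simp add: add.assoc mlcm_diff_add)
    then show ?thesis by simp
  qed
  moreover have "w + (?t - lmon ord g) = v"
  proof -
    have "w + (?t - lmon ord g) + lmon ord g = v + lmon ord g"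
      using w g(3) by (simp add: add.assoc mlcm_diff_add)
    then show ?thesis by simp
  qed
  moreover have "PMono w * spoly ord f g =
    PConst (inverse (lcoeff ord f)) * (PMono (w + (?t - lmon ord f)) * f) -
    PConst (inverse (lcoeff ord g)) * (PMono (w + (?t - lmon ord g)) * g)"
    unfolding spoly_def Let_def single_eq_PConst_mult PMono_add right_diff_distrib
    by (simp only: mult.assoc mult.left_commute)
  ultimately show ?thesis by simp
qed

lemma lookup_shift_lmon: "Poly_Mapping.lookup (PMono u * g) (u + lmon ord g) = lcoeff ord g"
  using lookup_single_mult_lmon[of u 1 g] by (simp add: PMono_def)

lemma lookup_span_below:
  assumes "\<And>g. g \<in> GG \<Longrightarrow> homogeneous g" "p \<in> kv.span (shifts GG (below m))"
  shows "Poly_Mapping.lookup p m = 0"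
proof (rule ccontr)
  assume "Poly_Mapping.lookup p m \<noteq> 0"
  then have "m \<in> Poly_Mapping.keys p" by (simp add: in_keys_iff)
  then obtain x where "x \<in> below m" "(m, x) \<in> ord"
    using keys_span_shifts[OF assms] by blast
  then show False
    using ord_antisym by (auto simp: below_def)
qed

text \<open>Modulo shifts below \<open>m\<close>, all shifts with leading monomial \<open>m\<close>
  are scalar multiples of one normalised shift \<open>t\<close>. So \<open>p\<close> is congruent to
  its coefficient at \<open>m\<close> times \<open>t\<close>, and this coefficient is 0.\<close>

lemma span_cancel_top:
  assumes gb: "homogeneous_GB_upto ord d S GG" and m: "mdeg m \<le> d"
    and p: "p \<in> kv.span (shifts GG (insert m (below m)))" and 0: "Poly_Mapping.lookup p m = 0"
  shows "p \<in> kv.span (shifts GG (below m))"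
proof (cases "\<exists>u g. g \<in> GG \<and> g \<noteq> 0 \<and> u + lmon ord g = m")
  case False
  then have "shifts GG (insert m (below m)) = shifts GG (below m)"
    by (auto simp: shifts_def)
  then show ?thesis using p by simp
next
  case True
  have GG: "\<And>g. g \<in> GG \<Longrightarrow> homogeneous g"
    using gb by (auto simp: homogeneous_GB_upto_def)
  from True obtain v g where g: "g \<in> GG" "g \<noteq> 0" "v + lmon ord g = m"
    by blast
  define t where "t = PConst (inverse (lcoeff ord g)) * (PMono v * g)"
  let ?V = "kv.span (shifts GG (below m))"
  \<comment> \<open>Subtracting from \<open>x\<close> its coefficient at \<open>m\<close> times
    \<open>t\<close> is linear in \<open>x\<close>, so it suffices that generators land in
    \<open>?V\<close>.\<close>
  have base: "x - PConst (Poly_Mapping.lookup x m) * t \<in> ?V" if "x \<in> shifts GG (insert m (below m))" for x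
  proof -
    from that obtain u f where f: "x = PMono u * f" "f \<in> GG" "f \<noteq> 0"
      "u + lmon ord f \<in> insert m (below m)"
      by (rule shiftsE)
    from f(4) show ?thesis
    proof (rule insertE)
      assume um: "u + lmon ord f = m"
      have l: "Poly_Mapping.lookup x m = lcoeff ord f"
        using lookup_shift_lmon[of u f] by (simp add: f(1) um)
      have "PConst (lcoeff ord f) * (PConst (inverse (lcoeff ord f)) * (PMono u * f) - t) \<in> ?V"
        unfolding t_def by (rule kv.span_scale[OF shifts_congruent[OF gb m f(2,3) um g]])
      moreover have "PConst (lcoeff ord f) * (PConst (inverse (lcoeff ord f)) * (PMono u * f)) = x"
        using lcoeff_nonzero[OF f(3)] by (simp add: f(1) mult.assoc[symmetric] PConst_mult)
      ultimately show ?thesis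
        by (simp add: l right_diff_distrib)
    next
      assume "u + lmon ord f \<in> below m"
      then have x: "x \<in> ?V"
        unfolding f(1) using f(2,3) by (intro kv.span_base shiftsI)
      then show ?thesis
        using lookup_span_below[OF GG x] by simp
    qed
  qed
  have "p - PConst (Poly_Mapping.lookup p m) * t \<in> ?V"
    using p
  proof (induction rule: kv.span_induct_alt)
    case base
    show ?case by (simp add: kv.span_zero)
  next
    case (step c x y)
    have "PConst c * (x - PConst (Poly_Mapping.lookup x m) * t) + (y - PConst (Poly_Mapping.lookup y m) * t) \<in> ?V"
      by (rule kv.span_add[OF kv.span_scale[OF base[OF step.hyps]] step.IH])
    moreover have "PConst (Poly_Mapping.lookup (PConst c * x + y) m) =
        PConst c * PConst (Poly_Mapping.lookup x m) + PConst (Poly_Mapping.lookup y m)"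
      by (simp add: lookup_add lookup_PConst_mult PConst_mult PConst_add)
    moreover have "PConst c * (x - PConst (Poly_Mapping.lookup x m) * t) +
        (y - PConst (Poly_Mapping.lookup y m) * t) =
        (PConst c * x + y) - (PConst c * PConst (Poly_Mapping.lookup x m) + PConst (Poly_Mapping.lookup y m)) * t"
      by (simp add: algebra_simps)
    ultimately show ?case
      by metis
  qed
  then show ?thesis using 0 by simp
qed

lemma ideal_homog_span_shifts:
  assumes GG: "\<And>g. g \<in> GG \<Longrightarrow> homogeneous g" and p: "p \<in> ideal_of GG"
  shows "hcomp e p \<in> kv.span (shifts GG {k. mdeg k = e})"
  using p
proof (induction rule: ideal_of_induct)
  case zero
  show ?case by (simp add: kv.span_zero)
next
  case (step a s p)
  let ?V = "kv.span (shifts GG {k. mdeg k = e})"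
  obtain e' where e': "homog e' s"
    using GG[OF step.hyps(1)] by (auto simp: homogeneous_iff)
  have "hcomp e (a * s) \<in> ?V"
  proof (cases "e' \<le> e \<and> s \<noteq> 0")
    case True
    let ?a = "hcomp (e - e') a"
    have "PMono k * s \<in> shifts GG {k. mdeg k = e}" if "k \<in> Poly_Mapping.keys ?a" for k
    proof -
      have "mdeg (k + lmon ord s) = e"
        using homogD[OF homog_hcomp that] mdeg_lmon[OF e'] True by (simp add: mdeg_add)
      then show ?thesis
        using True step.hyps(1) by (intro shiftsI) auto
    qed
    then have "(\<Sum>k\<in>Poly_Mapping.keys ?a. PConst (Poly_Mapping.lookup ?a k) * (PMono k * s)) \<in> ?V"
      by (intro kv.span_sum kv.span_scale kv.span_base) auto
    also have "(\<Sum>k\<in>Poly_Mapping.keys ?a. PConst (Poly_Mapping.lookup ?a k) * (PMono k * s)) = ?a * s"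
      using lookup_sum_single[of ?a]
      by (simp add: sum_distrib_right[symmetric] mult.assoc[symmetric] single_eq_PConst_mult)
    finally show ?thesis
      using True by (simp add: hcomp_mult_homog[OF e'])
  qed (auto simp: hcomp_mult_homog[OF e'] kv.span_zero)
  then show ?case
    unfolding hcomp_add using step.IH by (rule kv.span_add)
qed

text \<open>Start with a representation of \<open>p\<close> by shifts of degree \<open>e\<close> and
  lower the largest leading monomial allowed. While \<open>p\<close> has coefficient 0 there,
  \<open>span_cancel_top\<close> disposes of it. Once the coefficient is nonzero, this monomial
  leads \<open>p\<close>, and some shift must have it as leading monomial, as the shifts below
  cannot produce it.\<close>

lemma gb_upto_gb_in_degree:
  assumes gb: "homogeneous_GB_upto ord d S GG" and "e \<le> d"
  shows "gb_in_degree e S GG"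
proof -
  have GG: "\<And>g. g \<in> GG \<Longrightarrow> homogeneous g" and id: "ideal_of GG = ideal_of S"
    using gb by (auto simp: homogeneous_GB_upto_def)
  have "GG \<subseteq> ideal_of S"
    using ideal_of_base id by blast
  moreover have "\<exists>g\<in>GG. g \<noteq> 0 \<and> mdvd (lmon ord g) (lmon ord p)"
    if p: "p \<in> ideal_of S" "homog e p" "p \<noteq> 0" for p
  proof -
    \<comment> \<open>Within one degree, a nonempty finite downward closed set is the segment up to
      its maximum. This lets the descent restart from \<open>below m\<close>.\<close>
    have top: "\<exists>m\<in>Z. Z = insert m (below m)" if Z: "finite Z" "Z \<noteq> {}"
      "\<And>k k'. k' \<in> Z \<Longrightarrow> (k, k') \<in> ord \<Longrightarrow> mdeg k = e \<Longrightarrow> k \<in> Z" "\<And>k. k \<in> Z \<Longrightarrow> mdeg k = e" for Z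
    proof -
      obtain m where m: "m \<in> Z" "\<forall>k\<in>Z. (k, m) \<in> ord"
        using ord_Max_ex[OF Z(1,2)] by blast
      have "Z = insert m (below m)"
        using m Z(3)[OF m(1)] Z(4) unfolding below_def by auto
      then show ?thesis using m(1) by blast
    qed
    have main: "mdeg m = e \<longrightarrow> p \<in> kv.span (shifts GG (insert m (below m))) \<longrightarrow>
        (\<exists>g\<in>GG. g \<noteq> 0 \<and> mdvd (lmon ord g) (lmon ord p))" for m
      using wf_ord
    proof (induction m rule: wf_induct_rule)
      case (less m)
      show ?case
      proof (intro impI)
        assume m: "mdeg m = e" and pm: "p \<in> kv.span (shifts GG (insert m (below m)))"
        show "\<exists>g\<in>GG. g \<noteq> 0 \<and> mdvd (lmon ord g) (lmon ord p)"
        proof (cases "Poly_Mapping.lookup p m = 0")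
          case True
          then have pb: "p \<in> kv.span (shifts GG (below m))"
            using span_cancel_top[OF gb _ pm] m \<open>e \<le> d\<close> by simp
          have "below m \<noteq> {}"
            using keys_span_shifts[OF GG pb] lmon_in_keys[OF p(3)] by blast
          moreover have "finite (below m)"
            by (rule finite_subset[OF _ finite_mdeg[of e]]) (auto simp: below_def m)
          ultimately have "\<exists>m'\<in>below m. below m = insert m' (below m')"
          proof (intro top)
            fix k k' assume k: "k' \<in> below m" "(k, k') \<in> ord" "mdeg k = e"
            then have "mdeg k = mdeg k'"
              using m by (simp add: below_def)
            with k show "k \<in> below m"
              using below_downward by blast
          next
            fix k assume "k \<in> below m"
            then show "mdeg k = e"
              using m by (simp add: below_def)
          qed
          then obtain m' where m': "m' \<in> below m" "below m = insert m' (below m')"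
            by blast
          then have "(m', m) \<in> ord - Id" "mdeg m' = e"
            using m by (auto simp: below_def)
          then show ?thesis
            using less.IH pb m'(2) by metis
        next
          case False
          have "(k, m) \<in> ord" if "k \<in> Poly_Mapping.keys p" for k
            using keys_span_shifts[OF GG pm that] ord_trans by (auto simp: below_def)
          with False have lm: "lmon ord p = m"
            by (intro lmon_eqI) (auto simp: in_keys_iff)
          have "\<exists>u g. g \<in> GG \<and> g \<noteq> 0 \<and> u + lmon ord g = m"
          proof (rule ccontr)
            assume "\<not> ?thesis"
            then have "shifts GG (insert m (below m)) = shifts GG (below m)"
              by (auto simp: shifts_def)
            then show False
              using pm lookup_span_below[OF GG] False by auto
          qed
          then show ?thesis
            unfolding lm mdvd_def by (metis add.commute)
        qed
      qed
    qed
    have "p \<in> kv.span (shifts GG {k. mdeg k = e})"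
      using ideal_homog_span_shifts[OF GG, where p = p and e = e] p(1) hcomp_homog[OF p(2)] id by simp
    moreover have "{k :: 'n mon. mdeg k = e} \<noteq> {}"
      using mdeg_lmon[OF p(2,3)] by auto
    then have "\<exists>m\<in>{k. mdeg k = e}. {k. mdeg k = e} = insert m (below m)"
      using finite_mdeg by (intro top) auto
    then obtain m where "mdeg m = e" "{k. mdeg k = e} = insert m (below m)"
      by blast
    ultimately show ?thesis
      using main by metis
  qed
  ultimately show ?thesis
    using GG by (auto simp: gb_in_degree_def)
qed

end

section \<open>Krull dimension zero\<close>

text \<open>Krull's argument: by Zorn there is an ideal maximal among those containing
  \<open>I\<close> and missing \<open>M\<close>, and such an ideal is prime. With \<open>M\<close>
  reduced to the unit this gives primes above proper ideals.\<close>

lemma (in cring) exists_primeideal_avoiding: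
  assumes I: "ideal I R" and M: "M \<subseteq> carrier R" "\<one> \<in> M"
    "\<And>a b. a \<in> M \<Longrightarrow> b \<in> M \<Longrightarrow> a \<otimes> b \<in> M" and disj: "I \<inter> M = {}"
  obtains P where "primeideal P R" "I \<subseteq> P" "P \<inter> M = {}"
proof -
  define S where "S = {J. ideal J R \<and> I \<subseteq> J \<and> J \<inter> M = {}}"
  have "\<exists>P\<in>S. \<forall>J\<in>S. P \<subseteq> J \<longrightarrow> J = P"
  proof (rule subset_Zorn)
    fix C assume C: "subset.chain S C"
    then have CS: "C \<subseteq> S" by (simp add: pred_on.chain_def)
    show "\<exists>U\<in>S. \<forall>J\<in>C. J \<subseteq> U"
    proof (cases "C = {}")
      case True
      then show ?thesis using I disj by (auto simp: S_def)
    next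
      case False
      have "S \<subseteq> {J. ideal J R}" by (auto simp: S_def)
      then have "subset.chain {J. ideal J R} C"
        using C unfolding pred_on.chain_def by blast
      from chain_Union_is_ideal[OF this] have "ideal (\<Union>C) R"
        using False by simp
      moreover have "I \<subseteq> \<Union>C"
        using False CS by (auto simp: S_def)
      moreover have "\<Union>C \<inter> M = {}"
        using CS by (auto simp: S_def)
      ultimately have "\<Union>C \<in> S" by (simp add: S_def)
      then show ?thesis by blast
    qed
  qed
  then obtain P where P: "ideal P R" "I \<subseteq> P" "P \<inter> M = {}"
    and max: "\<And>J. ideal J R \<Longrightarrow> P \<subseteq> J \<Longrightarrow> J \<inter> M = {} \<Longrightarrow> J = P"
    unfolding S_def by (smt (verit) mem_Collect_eq order_trans)
  interpret P: ideal P R by fact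
  have meets: "\<exists>p\<in>P. \<exists>r\<in>carrier R. p \<oplus> r \<otimes> a \<in> M" if a: "a \<in> carrier R" "a \<notin> P" for a
  proof -
    let ?J = "P <+>\<^bsub>R\<^esub> PIdl a"
    have J: "ideal ?J R"
      by (intro add_ideals P cgenideal_ideal a)
    have Jel: "p \<oplus> r \<otimes> a \<in> ?J" if "p \<in> P" "r \<in> carrier R" for p r
      using that by (auto simp: set_add_def' cgenideal_def)
    have "P \<subseteq> ?J"
    proof
      fix p assume "p \<in> P"
      with Jel[of p \<zero>] a(1) show "p \<in> ?J"
        by (simp add: P.Icarr)
    qed
    moreover have "a \<in> ?J"
      using Jel[of \<zero> \<one>] a(1) by simp
    ultimately have "?J \<inter> M \<noteq> {}"
      using max[OF J] a(2) by blast
    then show ?thesis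
      by (auto simp: set_add_def' cgenideal_def)
  qed
  have "primeideal P R"
  proof (rule primeidealI[OF P(1) is_cring])
    show "carrier R \<noteq> P"
      using P(3) M(1,2) by blast
    fix a b assume ab: "a \<in> carrier R" "b \<in> carrier R" "a \<otimes> b \<in> P"
    show "a \<in> P \<or> b \<in> P"
    proof (rule ccontr)
      assume "\<not> (a \<in> P \<or> b \<in> P)"
      then obtain p r q s where *: "p \<in> P" "r \<in> carrier R" "p \<oplus> r \<otimes> a \<in> M"
        "q \<in> P" "s \<in> carrier R" "q \<oplus> s \<otimes> b \<in> M"
        using meets[OF ab(1)] meets[OF ab(2)] by blast
      have pq: "p \<in> carrier R" "q \<in> carrier R"
        using * P.Icarr by auto
      \<comment> \<open>A product of two elements of \<open>M\<close>, expanded so that every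
        summand has a factor \<open>p\<close>, \<open>q\<close> or \<open>a \<otimes> b\<close> from
        \<open>P\<close>.\<close>
      have "(p \<oplus> r \<otimes> a) \<otimes> (q \<oplus> s \<otimes> b) =
          (q \<oplus> s \<otimes> b) \<otimes> p \<oplus> (r \<otimes> a) \<otimes> q \<oplus> (r \<otimes> s) \<otimes> (a \<otimes> b)"
        using * ab pq by algebra
      also have "\<dots> \<in> P"
      proof (intro P.a_closed)
        show "(q \<oplus> s \<otimes> b) \<otimes> p \<in> P" using * ab pq by (intro P.I_l_closed) auto
        show "(r \<otimes> a) \<otimes> q \<in> P" using * ab pq by (intro P.I_l_closed) auto
        show "(r \<otimes> s) \<otimes> (a \<otimes> b) \<in> P" using ab(3) by (rule P.I_l_closed) (use * in simp)
      qed
      finally show False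
        using M(3)[OF *(3,6)] P(3) by blast
    qed
  qed
  with P that show thesis by blast
qed

text \<open>The elements \<open>a^k (1 - a b)\<close> form a multiplicative set. If it missed 0,
  some prime \<open>P\<close> would avoid it; then \<open>a\<close> is not in \<open>P\<close> and
  \<open>P + (a)\<close> is proper, so a prime strictly above \<open>P\<close> would exist.\<close>

lemma (in cring) power_mult_eq_if_primes_maximal:
  assumes no_chain: "\<And>P Q. primeideal P R \<Longrightarrow> primeideal Q R \<Longrightarrow> \<not> P \<subset> Q" and a: "a \<in> carrier R"
  obtains k :: nat and b where "b \<in> carrier R" "a [^] k \<otimes> (\<one> \<ominus> a \<otimes> b) = \<zero>"
proof (rule ccontr)
  assume not: "\<not> thesis"
  define M where "M = (\<lambda>(k :: nat, b). a [^] k \<otimes> (\<one> \<ominus> a \<otimes> b)) ` (UNIV \<times> carrier R)"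
  have MI: "a [^] k \<otimes> (\<one> \<ominus> a \<otimes> b) \<in> M" if "b \<in> carrier R" for k :: nat and b
    unfolding M_def using that by (intro image_eqI[of _ _ "(k, b)"]) auto
  have "\<one> \<in> M"
    using MI[of \<zero> 0] a by (simp add: a_minus_def)
  moreover have "x \<otimes> y \<in> M" if xy: "x \<in> M" "y \<in> M" for x y
  proof -
    from xy obtain k l :: nat and b c where bc: "b \<in> carrier R" "c \<in> carrier R"
      "x = a [^] k \<otimes> (\<one> \<ominus> a \<otimes> b)" "y = a [^] l \<otimes> (\<one> \<ominus> a \<otimes> c)"
      by (auto simp: M_def)
    define u v where "u = a [^] k" and "v = a [^] l"
    have uv: "u \<in> carrier R" "v \<in> carrier R"
      using a by (auto simp: u_def v_def)
    \<comment> \<open>Closure under products: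
      \<open>(1 - a b) (1 - a c) = 1 - a (b + c - a b c)\<close>.\<close>
    have "(u \<otimes> (\<one> \<ominus> a \<otimes> b)) \<otimes> (v \<otimes> (\<one> \<ominus> a \<otimes> c)) =
        (u \<otimes> v) \<otimes> (\<one> \<ominus> a \<otimes> (b \<oplus> c \<ominus> a \<otimes> (b \<otimes> c)))"
      using uv bc(1,2) a by algebra
    also have "u \<otimes> v = a [^] (k + l)"
      using a by (simp add: u_def v_def nat_pow_mult)
    finally show ?thesis
      using MI[of "b \<oplus> c \<ominus> a \<otimes> (b \<otimes> c)" "k + l"] bc a by (simp add: u_def v_def)
  qed
  moreover have "M \<subseteq> carrier R"
    using a by (auto simp: M_def)
  moreover have "{\<zero>} \<inter> M = {}"
  proof (rule ccontr)
    assume "{\<zero>} \<inter> M \<noteq> {}"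
    then have "\<zero> \<in> M" by blast
    then obtain k :: nat and b where "b \<in> carrier R" "\<zero> = a [^] k \<otimes> (\<one> \<ominus> a \<otimes> b)"
      by (auto simp: M_def)
    then show False using not that[of b k] by simp
  qed
  ultimately obtain P where P: "primeideal P R" "P \<inter> M = {}"
    using exists_primeideal_avoiding[OF zeroideal] by metis
  interpret P: primeideal P R by fact
  let ?J = "P <+>\<^bsub>R\<^esub> PIdl a"
  have J: "ideal ?J R"
    by (intro add_ideals P.is_ideal cgenideal_ideal a)
  have Jel: "p \<oplus> r \<otimes> a \<in> ?J" if "p \<in> P" "r \<in> carrier R" for p r
    using that by (auto simp: set_add_def' cgenideal_def)
  \<comment> \<open>From \<open>1 = p + r a\<close> it would follow that \<open>p = 1 - a r\<close>,
    an element of \<open>M\<close> with exponent 0.\<close>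
  have "\<one> \<notin> ?J"
  proof
    assume "\<one> \<in> ?J"
    then obtain p r where pr: "p \<in> P" "r \<in> carrier R" "\<one> = p \<oplus> r \<otimes> a"
      by (auto simp: set_add_def' cgenideal_def)
    have "p = (p \<oplus> r \<otimes> a) \<ominus> a \<otimes> r"
      using pr(1,2) a P.Icarr[OF pr(1)] by algebra
    then have "p = \<one> \<ominus> a \<otimes> r"
      using pr(3) by simp
    then have "p \<in> M"
      using MI[OF pr(2), of 0] a pr(2) by simp
    then show False using pr(1) P(2) by blast
  qed
  then obtain Q where Q: "primeideal Q R" "?J \<subseteq> Q"
    using exists_primeideal_avoiding[OF J, of "{\<one>}"] by auto
  have "P \<subseteq> ?J"
  proof
    fix p assume "p \<in> P"
    with Jel[of p \<zero>] a show "p \<in> ?J"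
      by (simp add: P.Icarr)
  qed
  moreover have "a \<in> ?J"
    using Jel[of \<zero> \<one>] a by simp
  moreover have "a \<in> M"
    using MI[of \<zero> 1] a by (simp add: a_minus_def)
  ultimately have "P \<subset> Q"
    using Q(2) P(2) by blast
  then show False
    using no_chain P(1) Q(1) by blast
qed

lemma krull_dim_eq_0_no_chain:
  assumes "krull_dim R = 0" "primeideal P R" "primeideal Q R"
  shows "\<not> P \<subset> Q"
proof
  assume PQ: "P \<subset> Q"
  let ?D = "{ereal (real l) | l. \<exists>P. (\<forall>i\<le>l. primeideal (P i) R) \<and> (\<forall>i<l. P i \<subset> P (Suc i))}"
  have "\<exists>P. (\<forall>i\<le>1. primeideal (P i) R) \<and> (\<forall>i<1. P i \<subset> P (Suc i))"
    using assms PQ by (intro exI[of _ "\<lambda>i :: nat. if i = 0 then P else Q"]) auto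
  then have "ereal (real 1) \<in> ?D" by blast
  then have "ereal (real 1) \<le> Sup ?D" by (rule Sup_upper)
  then show False
    using assms(1) by (simp add: krull_dim_def)
qed

lemma krull_dim_eq_0I:
  assumes "primeideal P0 R" "\<And>P. primeideal P R \<Longrightarrow> P = P0"
  shows "krull_dim R = 0"
proof -
  have "{ereal (real l) | l. \<exists>P. (\<forall>i\<le>l. primeideal (P i) R) \<and> (\<forall>i<l. P i \<subset> P (Suc i))} = {0}"
  proof (intro equalityI subsetI)
    fix x assume "x \<in> {ereal (real l) | l. \<exists>P. (\<forall>i\<le>l. primeideal (P i) R) \<and> (\<forall>i<l. P i \<subset> P (Suc i))}"
    then obtain l P where l: "x = ereal (real l)" "\<forall>i\<le>l. primeideal (P i) R" "\<forall>i<l. P i \<subset> P (Suc i)"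
      by blast
    have "l = 0"
    proof (rule ccontr)
      assume "l \<noteq> 0"
      then have "P 0 = P0" "P 1 = P0" "P 0 \<subset> P 1"
        using l assms(2) by auto
      then show False by simp
    qed
    then show "x \<in> {0}" using l(1) by simp
  next
    fix x :: ereal assume "x \<in> {0}"
    moreover have "\<exists>P. (\<forall>i\<le>0. primeideal (P i) R) \<and> (\<forall>i<0. P i \<subset> P (Suc i))"
      using assms(1) by auto
    ultimately show "x \<in> {ereal (real l) | l. \<exists>P. (\<forall>i\<le>l. primeideal (P i) R) \<and> (\<forall>i<l. P i \<subset> P (Suc i))}"
      by (auto intro!: exI[of _ 0])
  qed
  then show ?thesis
    by (simp add: krull_dim_def)
qed

lemma minus_ring_of_type: "x \<ominus>\<^bsub>ring_of_type_algebra\<^esub> y = (x :: ('n, 'k::field) mpol) - y"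
proof -
  interpret R: cring "ring_of_type_algebra :: ('n, 'k) mpol ring" by (rule cring_mpol)
  have "\<ominus>\<^bsub>ring_of_type_algebra\<^esub> y = - y"
    by (rule R.add.inv_equality[of "- y" y, folded a_inv_def]) auto
  then show ?thesis
    by (simp add: a_minus_def)
qed

text \<open>If all primes of \<open>R / I\<close> are maximal, then \<open>x\<^sup>k (1 - x b) \<in> I\<close> for some \<open>k\<close> and \<open>b\<close>; for
  homogeneous \<open>I\<close> the component of degree \<open>k\<close> of this element is \<open>x\<^sup>k\<close>.\<close>

lemma dim_0_imp_power_in_ideal:
  fixes S :: "('n::finite, 'k::field) mpol set"
  assumes S: "\<And>s. s \<in> S \<Longrightarrow> homogeneous s" and dim: "dim_ideal (ideal_of S) = 0"
  shows "\<exists>k. PVar i ^ k \<in> ideal_of S"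
proof -
  let ?R = "ring_of_type_algebra :: ('n, 'k) mpol ring"
  let ?I = "ideal_of S"
  let ?Q = "?R Quot ?I"
  let ?h = "a_r_coset ?R ?I"
  interpret R: cring ?R by (rule cring_mpol)
  interpret I: ideal ?I ?R by (rule ideal_of_is_ideal)
  interpret Q: cring ?Q by (rule I.quotient_is_cring[OF R.is_cring])
  interpret h: ring_hom_cring ?R ?Q ?h
    by (rule I.rcos_ring_hom_cring[OF R.is_cring])
  let ?x = "PVar i :: ('n, 'k) mpol"
  have carr: "?h y \<in> carrier ?Q" for y by simp
  obtain k :: nat and b where b: "b \<in> carrier ?Q"
    "?h ?x [^]\<^bsub>?Q\<^esub> k \<otimes>\<^bsub>?Q\<^esub> (\<one>\<^bsub>?Q\<^esub> \<ominus>\<^bsub>?Q\<^esub> ?h ?x \<otimes>\<^bsub>?Q\<^esub> b) = \<zero>\<^bsub>?Q\<^esub>"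
    using Q.power_mult_eq_if_primes_maximal[OF krull_dim_eq_0_no_chain[OF dim[unfolded dim_ideal_def]] carr]
    by blast
  obtain b' where b': "b = ?h b'"
    using b(1) by (auto simp: FactRing_def A_RCOSETS_def')
  have pw: "?h (?x ^ k) = ?h ?x [^]\<^bsub>?Q\<^esub> k"
  proof (induction k)
    case 0
    show ?case using h.hom_one by simp
  next
    case (Suc k)
    have "?h (?x ^ Suc k) = ?h (?x ^ k) \<otimes>\<^bsub>?Q\<^esub> ?h ?x"
      using h.hom_mult[of "?x ^ k" ?x] by (simp add: mult.commute)
    then show ?case using Suc.IH by simp
  qed
  have "?h (?x ^ k * (1 - ?x * b')) = ?h (?x ^ k) \<otimes>\<^bsub>?Q\<^esub> (\<one>\<^bsub>?Q\<^esub> \<ominus>\<^bsub>?Q\<^esub> ?h ?x \<otimes>\<^bsub>?Q\<^esub> ?h b')"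
    using h.hom_mult[of "?x ^ k" "1 - ?x * b'"] h.hom_mult[of ?x b'] h.hom_one
      h.hom_sub[of 1 "?x * b'"]
    by (simp add: minus_ring_of_type)
  then have "?h (?x ^ k * (1 - ?x * b')) = \<zero>\<^bsub>?Q\<^esub>"
    using b(2) pw b' by simp
  then have "?x ^ k * (1 - ?x * b') \<in> ?I"
    using I.rcos_const_imp_mem by (simp add: FactRing_def)
  then have "hcomp k (?x ^ k * (1 - ?x * b')) \<in> ?I"
    using S by (rule hcomp_in_ideal[rotated])
  moreover have "hcomp k (?x ^ k * (1 - ?x * b')) = ?x ^ k"
  proof -
    have x: "homog k (?x ^ k)" "homog (Suc k) (?x ^ Suc k)"
      using homog_power[OF homog_PVar[of i], of k] homog_power[OF homog_PVar[of i], of "Suc k"] by auto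
    have "?x ^ k * (1 - ?x * b') = ?x ^ k - b' * ?x ^ Suc k"
      by (simp add: algebra_simps)
    then show ?thesis
      using hcomp_mult_homog[OF x(2), of k b'] hcomp_homog[OF x(1)] by (simp add: hcomp_diff)
  qed
  ultimately show ?thesis by auto
qed

lemma mon_split:
  fixes m :: "'n mon"
  assumes "Poly_Mapping.lookup m i \<ge> k"
  shows "m = (m - Poly_Mapping.single i k) + Poly_Mapping.single i k"
  using assms by (intro poly_mapping_eqI) (auto simp: lookup_add lookup_minus lookup_single when_def)

lemma PMono_divisible:
  assumes "Poly_Mapping.lookup m i \<ge> k"
  shows "\<exists>q. (PMono m :: ('n, 'k::field) mpol) = q * PVar i ^ k"
proof -
  have "(PMono m :: ('n, 'k) mpol) = PMono (m - Poly_Mapping.single i k) * PMono (Poly_Mapping.single i k)"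
    using mon_split[OF assms] by (metis PMono_add)
  then show ?thesis
    unfolding PMono_power_single by blast
qed

text \<open>A prime of the quotient pulls back to a prime containing every variable, hence the
  maximal ideal \<open>?m\<close> of polynomials without constant term, hence equal to it. So the
  quotient has exactly one prime.\<close>

lemma dim_0I:
  fixes S :: "('n::finite, 'k::field) mpol set"
  assumes S: "\<And>s. s \<in> S \<Longrightarrow> homogeneous s \<and> pdeg s \<ge> 1"
    and pow: "\<And>i. \<exists>k. PVar i ^ k \<in> ideal_of S"
  shows "dim_ideal (ideal_of S) = 0"
proof -
  let ?R = "ring_of_type_algebra :: ('n, 'k) mpol ring"
  let ?I = "ideal_of S"
  let ?Q = "?R Quot ?I"
  let ?h = "a_r_coset ?R ?I"
  interpret R: cring ?R by (rule cring_mpol)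
  interpret I: ideal ?I ?R by (rule ideal_of_is_ideal)
  interpret Q: cring ?Q by (rule I.quotient_is_cring[OF R.is_cring])
  interpret h: ring_hom_cring ?R ?Q ?h
    by (rule I.rcos_ring_hom_cring[OF R.is_cring])
  let ?m = "{f :: ('n, 'k) mpol. Poly_Mapping.lookup f 0 = 0}"
  have uniq: "P = ?h ` ?m" if P: "primeideal P ?Q" for P
  proof -
    let ?P = "{f. ?h f \<in> P}"
    have "primeideal {f \<in> carrier ?R. ?h f \<in> P} ?R"
      by (rule h.ring.primeideal_vimage[OF R.is_cring P])
    then interpret P': primeideal ?P ?R by simp
    have var: "PVar i \<in> ?P" for i
    proof -
      obtain k where "PVar i ^ k \<in> ?I" using pow by blast
      then have "?h (PVar i ^ k) = \<zero>\<^bsub>?Q\<^esub>"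
        using R.a_rcos_zero[OF I.is_ideal] by (simp add: FactRing_def)
      moreover have "\<zero>\<^bsub>?Q\<^esub> \<in> P"
        using P by (simp add: primeideal_def ideal_def additive_subgroup.zero_closed)
      ultimately have "PVar i ^ k \<in> ?P" by simp
      then show ?thesis
      proof (induction k)
        case 0
        \<comment> \<open>Here \<open>1\<close> lies in the prime, which would then be everything;
          the claim holds without deriving the contradiction.\<close>
        then have "x \<in> ?P" for x
          using P'.I_l_closed[of 1 x] by simp
        then show ?case by blast
      next
        case (Suc k)
        then show ?case
          using P'.I_prime[of "PVar i" "PVar i ^ k"] by auto
      qed
    qed
    have sub: "f \<in> ?P" if "f \<in> ?m" for f
    proof -
      have tm: "Poly_Mapping.single m c \<in> ?P" if "m \<in> Poly_Mapping.keys f" for m c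
      proof -
        have "m \<noteq> 0"
          using that \<open>f \<in> ?m\<close> by (auto simp: in_keys_iff)
        then obtain i where "Poly_Mapping.lookup m i \<noteq> 0"
          using poly_mapping_eqI[of m 0] by auto
        then obtain q where "(PMono m :: ('n, 'k) mpol) = q * PVar i"
          using PMono_divisible[of 1 m i] by auto
        then have "Poly_Mapping.single m c = (PConst c * q) * PVar i"
          by (simp add: single_eq_PConst_mult mult.assoc)
        then show ?thesis
          using P'.I_l_closed[OF var[of i], of "PConst c * q"] by simp
      qed
      have "(\<Sum>m\<in>A. Poly_Mapping.single m (Poly_Mapping.lookup f m)) \<in> ?P"
        if "finite A" "A \<subseteq> Poly_Mapping.keys f" for A
        using that
      proof (induction A rule: finite_induct)
        case empty
        show ?case using P'.zero_closed by simp
      next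
        case (insert m A)
        have "Poly_Mapping.single m (Poly_Mapping.lookup f m) \<in> ?P"
          using tm insert.prems by blast
        with insert show ?case
          using P'.a_closed[of "Poly_Mapping.single m (Poly_Mapping.lookup f m)"
              "\<Sum>m\<in>A. Poly_Mapping.single m (Poly_Mapping.lookup f m)"]
          by simp
      qed
      from this[of "Poly_Mapping.keys f"] show ?thesis
        using lookup_sum_single[of f] by simp
    qed
    have eq: "?P = ?m"
    proof (rule equalityI)
      show "?m \<subseteq> ?P" using sub by blast
      show "?P \<subseteq> ?m"
      proof
        fix f assume f: "f \<in> ?P"
        let ?c = "Poly_Mapping.lookup f 0"
        show "f \<in> ?m"
        proof (rule ccontr)
          assume "f \<notin> ?m"
          then have c: "?c \<noteq> 0" by simp
          have "PConst ?c - f \<in> ?m"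
            by (simp add: lookup_minus PConst_def)
          then have "PConst ?c - f \<in> ?P" using sub by blast
          then have "PConst ?c \<in> ?P"
            using P'.a_closed[of "PConst ?c - f" f] f by simp
          then have "PConst (1 / ?c) * PConst ?c \<in> ?P"
            using P'.I_l_closed[of "PConst ?c" "PConst (1 / ?c)"] by simp
          then have "1 \<in> ?P"
            using c by (simp add: PConst_mult)
          then have "x \<in> ?P" for x
            using P'.I_l_closed[of 1 x] by simp
          then show False
            using P'.I_notcarr by auto
        qed
      qed
    qed
    have "P \<subseteq> carrier ?Q"
      using P by (simp add: primeideal_def ideal_def additive_subgroup.a_subset)
    then have "P = ?h ` ?P"
      by (auto simp: FactRing_def A_RCOSETS_def' image_iff)
    then show ?thesis using eq by simp
  qed
  \<comment> \<open>A proper ideal ensures that a prime exists; for the zero ring the dimension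
    would be minus infinity instead of 0.\<close>
  have "1 \<notin> ?I"
    using lookup_0_ideal_pos[of S 1] S by auto
  then have "\<one>\<^bsub>?Q\<^esub> \<noteq> \<zero>\<^bsub>?Q\<^esub>"
    using I.rcos_const_imp_mem[of 1] by (auto simp: FactRing_def)
  then obtain P0 where "primeideal P0 ?Q"
    using Q.exists_primeideal_avoiding[OF Q.zeroideal, of "{\<one>\<^bsub>?Q\<^esub>}"] by auto
  then show ?thesis
    unfolding dim_ideal_def using uniq by (metis krull_dim_eq_0I)
qed

section \<open>Standard monomials of zero-dimensional ideals\<close>

context monomial_order begin

lemma not_lm_exponent_bound:
  fixes S :: "('n, 'k::field) mpol set"
  assumes "PVar i ^ k \<in> ideal_of S" "m \<notin> lm_set ord (ideal_of S)"
  shows "Poly_Mapping.lookup m i < k"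
proof (rule ccontr)
  assume "\<not> Poly_Mapping.lookup m i < k"
  then obtain q where "(PMono m :: ('n, 'k) mpol) = q * PVar i ^ k"
    using PMono_divisible[of k m i] by auto
  then have "PMono m \<in> ideal_of S"
    using assms(1) by (simp add: ideal_of_mult)
  then show False
    using PMono_in_ideal_lm assms(2) by blast
qed

lemma finite_not_lm:
  fixes S :: "('n, 'k::field) mpol set"
  assumes "\<And>i. \<exists>k. PVar i ^ k \<in> ideal_of S"
  shows "finite (- lm_set ord (ideal_of S))"
proof -
  have "\<exists>f. \<forall>i. PVar i ^ f i \<in> ideal_of S"
    using assms by (intro choice allI)
  then obtain f where "\<And>i. PVar i ^ f i \<in> ideal_of S"
    by blast
  then have "- lm_set ord (ideal_of S) \<subseteq> {m. \<forall>i. Poly_Mapping.lookup m i \<le> f i}"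
    using not_lm_exponent_bound[of _ _ S] by (auto intro: less_imp_le)
  then show ?thesis
    using finite_bounded_mon by (rule finite_subset)
qed

text \<open>Each exponent of a standard monomial is below \<open>N\<close>. This is the origin of
  the degree bound \<open>D\<close>.\<close>

lemma mdeg_not_lm_le:
  fixes S :: "('n, 'k::field) mpol set"
  assumes "\<And>i. PVar i ^ N \<in> ideal_of S" "m \<notin> lm_set ord (ideal_of S)"
  shows "mdeg m \<le> card (UNIV :: 'n set) * N"
proof -
  have "mdeg m \<le> (\<Sum>i\<in>(UNIV :: 'n set). N)"
    unfolding mdeg_def
    by (rule sum_mono) (use not_lm_exponent_bound[OF assms(1) assms(2)] in \<open>simp add: less_imp_le\<close>)
  then show ?thesis by simp
qed

lemma mdeg_le_max_std_degree:
  assumes "finite (- lm_set ord (ideal_of S))" "m \<notin> lm_set ord (ideal_of S)"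
  shows "mdeg m \<le> max_std_degree ord S"
  unfolding max_std_degree_def using assms by (intro Max_ge) auto

text \<open>The exponent vector 0 is the monomial 1. As it is standard, the \<open>Max\<close> in
  \<open>max_std_degree\<close> does not range over an empty set.\<close>

lemma zero_not_lm:
  assumes "\<And>s. s \<in> S \<Longrightarrow> homogeneous s \<and> pdeg s \<ge> 1"
  shows "0 \<notin> lm_set ord (ideal_of S)"
proof
  assume "0 \<in> lm_set ord (ideal_of S)"
  then obtain p where "p \<in> ideal_of S" "p \<noteq> 0" "0 = lmon ord p"
    by (auto simp: lm_set_def)
  then show False
    using lookup_0_ideal_pos[OF assms] lmon_in_keys[of p] by (auto simp: in_keys_iff)
qed

lemma max_std_degree_le:
  assumes "\<And>s. s \<in> S \<Longrightarrow> homogeneous s \<and> pdeg s \<ge> 1"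
    and "finite (- lm_set ord (ideal_of S))"
    and "\<And>m. m \<notin> lm_set ord (ideal_of S) \<Longrightarrow> mdeg m \<le> D"
  shows "max_std_degree ord S \<le> D"
  unfolding max_std_degree_def
  using assms(2,3) zero_not_lm[OF assms(1)] by (subst Max_le_iff) auto

text \<open>Without standard monomials of degree \<open>d\<close>,
  \<open>standard_monomials_span\<close> leaves only the ideal. This handles all degrees from the
  stopping degree on.\<close>

lemma homog_in_ideal_of_lm:
  fixes p :: "('n, 'k::field) mpol"
  assumes "\<And>s. s \<in> S \<Longrightarrow> homogeneous s" "\<And>m. mdeg m = d \<Longrightarrow> m \<in> lm_set ord (ideal_of S)" "homog d p"
  shows "p \<in> ideal_of S"
proof -
  have "mon_d ord d S = {}"
    using assms(2) by (auto simp: mon_d_def)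
  then have "p \<in> kv.span (ideal_of S)"
    using standard_monomials_span[of S, OF assms(1,3)] by simp
  also have "kv.span (ideal_of S) = ideal_of S"
    by (auto simp: kv.span_eq_iff intro!: kv.subspaceI ideal_of_add ideal_of_mult)
  finally show ?thesis .
qed

end

section \<open>Linear actions of finite groups\<close>

locale linear_action =
  fixes G :: "('g, 'b) monoid_scheme"
    and \<phi> :: "'g \<Rightarrow> ('n::finite, 'k::field) mpol \<Rightarrow> ('n, 'k) mpol"
  assumes group_G: "group G"
    and finite_G: "finite (carrier G)"
    and linear: "acts_linearly G \<phi>"
    and non_modular: "\<not> CHAR('k) dvd Coset.order G"
begin

sublocale action: group_action G UNIV \<phi>
  using linear by (simp add: acts_linearly_def)

sublocale Grp: group G
  by (rule group_G)

lemma automorphism: "g \<in> carrier G \<Longrightarrow> algebra_automorphism (\<phi> g)"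
  using linear by (simp add: acts_linearly_def)

context
  fixes g assumes g: "g \<in> carrier G"
begin

lemma phi_one: "\<phi> g 1 = 1"
  and phi_add: "\<phi> g (p + q) = \<phi> g p + \<phi> g q"
  and phi_mult: "\<phi> g (p * q) = \<phi> g p * \<phi> g q"
  and phi_PConst_mult: "\<phi> g (PConst c * p) = PConst c * \<phi> g p"
  using automorphism[OF g] by (auto simp: algebra_automorphism_def)

lemma phi_PConst: "\<phi> g (PConst c) = PConst c"
  using phi_PConst_mult[of c 1] by (simp add: phi_one)

lemma phi_zero: "\<phi> g 0 = 0"
  using phi_PConst[of 0] by simp

lemma phi_uminus: "\<phi> g (- p) = - \<phi> g p"
  using phi_add[of p "- p"] phi_zero by (simp add: minus_unique)

lemma phi_diff: "\<phi> g (p - q) = \<phi> g p - \<phi> g q"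
  using phi_add[of p "- q"] by (simp add: phi_uminus)

lemma phi_sum: "\<phi> g (sum f A) = (\<Sum>i\<in>A. \<phi> g (f i))"
  by (induction A rule: infinite_finite_induct) (auto simp: phi_zero phi_add)

lemma homog_phi_PVar: "homog 1 (\<phi> g (PVar i))"
proof -
  have "PVar i \<in> (linear_forms :: ('n, 'k) mpol set)"
    unfolding linear_forms_def by (rule kv.span_base) simp
  then have "\<phi> g (PVar i) \<in> linear_forms"
    using linear g by (auto simp: acts_linearly_def)
  moreover have "linear_forms \<subseteq> {p :: ('n, 'k) mpol. homog 1 p}"
    unfolding linear_forms_def
  proof (rule kv.span_minimal)
    show "range PVar \<subseteq> {p :: ('n, 'k) mpol. homog 1 p}"
      by (auto intro: homog_PVar simp del: One_nat_def)
    show "kv.subspace {p :: ('n, 'k) mpol. homog 1 p}"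
      by (rule kv.subspaceI) (auto intro: homog_add homog_PConst_mult)
  qed
  ultimately show ?thesis by blast
qed

lemma homog_phi_PMono: "mdeg m = d \<Longrightarrow> homog d (\<phi> g (PMono m))"
proof (induction d arbitrary: m)
  case 0
  then show ?case by (simp add: mdeg_eq_0_iff phi_one homog_one)
next
  case (Suc d)
  then have "m \<noteq> 0" by auto
  then obtain i where i: "Poly_Mapping.lookup m i \<ge> 1"
    by (metis lookup_zero poly_mapping_eqI less_one not_le)
  let ?m = "m - Poly_Mapping.single i 1"
  have m: "m = ?m + Poly_Mapping.single i 1"
    by (rule mon_split[OF i])
  then have "mdeg m = mdeg ?m + 1"
    by (metis mdeg_add mdeg_single)
  then have "homog d (\<phi> g (PMono ?m))"
    using Suc by simp
  from homog_mult[OF this homog_phi_PVar[of i]] have "homog (Suc d) (\<phi> g (PMono ?m * PVar i))"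
    by (simp add: phi_mult)
  also have "PMono ?m * PVar i = PMono m"
    unfolding PVar_def PMono_add[symmetric] by (simp only: m[symmetric])
  finally show ?case .
qed

lemma homog_phi:
  assumes "homog d p"
  shows "homog d (\<phi> g p)"
proof -
  have "\<phi> g p = (\<Sum>m\<in>Poly_Mapping.keys p. PConst (Poly_Mapping.lookup p m) * \<phi> g (PMono m))"
    by (subst lookup_sum_single) (simp add: phi_sum single_eq_PConst_mult phi_PConst_mult)
  then show ?thesis
    using homogD[OF assms] by (auto intro!: homog_sum homog_PConst_mult homog_phi_PMono)
qed

text \<open>A linear action maps each component into its own degree. Hence components of invariants
  are invariant.\<close>

lemma phi_hcomp: "\<phi> g (hcomp d p) = hcomp d (\<phi> g p)"
proof -
  define D where "D = insert d (mdeg ` Poly_Mapping.keys p)"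
  have D: "finite D" "d \<in> D" by (auto simp: D_def)
  have "(\<Sum>e\<in>D. hcomp e p) = p"
    by (rule sum_hcomp) (auto simp: D_def)
  then have "hcomp d (\<phi> g p) = hcomp d (\<phi> g (\<Sum>e\<in>D. hcomp e p))"
    by simp
  also have "\<dots> = (\<Sum>e\<in>D. hcomp d (\<phi> g (hcomp e p)))"
    by (simp add: phi_sum hcomp_sum)
  also have "\<dots> = (\<Sum>e\<in>D. if e = d then \<phi> g (hcomp d p) else 0)"
  proof (rule sum.cong[OF refl])
    fix e
    show "hcomp d (\<phi> g (hcomp e p)) = (if e = d then \<phi> g (hcomp d p) else 0)"
      using homog_phi[OF homog_hcomp[of e p]] by (auto simp: hcomp_homog hcomp_homog_neq)
  qed
  also have "\<dots> = \<phi> g (hcomp d p)"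
    using D by simp
  finally show ?thesis by simp
qed

end

lemma phi_comp: "h \<in> carrier G \<Longrightarrow> g \<in> carrier G \<Longrightarrow> \<phi> h (\<phi> g p) = \<phi> (h \<otimes>\<^bsub>G\<^esub> g) p"
  using action.composition_rule[of p h g] by simp

lemma phi_unit: "\<phi> \<one>\<^bsub>G\<^esub> p = p"
  using fun_cong[OF action.id_eq_one, of p] by simp

abbreviation "Inv \<equiv> invariant_ring G \<phi>"

lemma Inv_add: "p \<in> Inv \<Longrightarrow> q \<in> Inv \<Longrightarrow> p + q \<in> Inv"
  and Inv_mult: "p \<in> Inv \<Longrightarrow> q \<in> Inv \<Longrightarrow> p * q \<in> Inv"
  and Inv_PConst: "PConst c \<in> Inv"
  and Inv_hcomp: "p \<in> Inv \<Longrightarrow> hcomp d p \<in> Inv"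
  by (simp_all add: invariant_ring_def phi_add phi_mult phi_PConst phi_hcomp)

section \<open>The Reynolds operator\<close>

lemma order_nonzero: "(of_nat (Coset.order G) :: 'k) \<noteq> 0"
  using non_modular by (simp add: of_nat_eq_0_iff_char_dvd)

lemma of_nat_eq_PConst: "(of_nat n :: ('n, 'k) mpol) = PConst (of_nat n)"
  by (induction n) (simp_all add: PConst_add[symmetric])

abbreviation "R \<equiv> Rey G \<phi>"

lemma sum_translate:
  assumes h: "h \<in> carrier G"
  shows "(\<Sum>g\<in>carrier G. f (h \<otimes>\<^bsub>G\<^esub> g)) = (\<Sum>g\<in>carrier G. f g)"
  by (rule sum.reindex_bij_witness[of _ "\<lambda>g. inv\<^bsub>G\<^esub> h \<otimes>\<^bsub>G\<^esub> g" "\<lambda>g. h \<otimes>\<^bsub>G\<^esub> g"])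
    (use h in \<open>auto simp: Grp.m_assoc[symmetric]\<close>)

lemma Rey_invariant: "R p \<in> Inv"
  unfolding invariant_ring_def
  using sum_translate[where f = "\<lambda>g. \<phi> g p"]
  by (auto simp: Rey_def phi_PConst_mult phi_sum phi_comp)

lemma Rey_of_invariant:
  assumes "p \<in> Inv" shows "R p = p"
proof -
  have "(\<Sum>g\<in>carrier G. \<phi> g p) = PConst (of_nat (Coset.order G)) * p"
    using assms by (simp add: invariant_ring_def Coset.order_def of_nat_eq_PConst)
  then show ?thesis
    using order_nonzero by (simp add: Rey_def mult.assoc[symmetric] PConst_mult)
qed

lemma Rey_zero: "R 0 = 0"
  by (simp add: Rey_def phi_zero)

lemma Rey_add: "R (p + q) = R p + R q"
  by (simp add: Rey_def phi_add sum.distrib distrib_left)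

lemma Rey_PConst_mult: "R (PConst c * p) = PConst c * R p"
  by (simp add: Rey_def phi_PConst_mult sum_distrib_left mult.left_commute)

lemma Rey_mult_invariant: "q \<in> Inv \<Longrightarrow> R (p * q) = R p * q"
  by (simp add: Rey_def phi_mult invariant_ring_def sum_distrib_right mult.assoc)

lemma homog_Rey: "homog d p \<Longrightarrow> homog d (R p)"
  unfolding Rey_def by (intro homog_PConst_mult homog_sum homog_phi)

text \<open>The Reynolds operator is linear over the invariants, so
  \<open>R (a * s) = R a * s\<close> for \<open>s\<close> in \<open>S\<close>.\<close>

lemma Rey_in_ideal:
  assumes "S \<subseteq> Inv" "p \<in> ideal_of S"
  shows "R p \<in> ideal_of S"
  using assms(2)
proof (induction rule: ideal_of_induct)
  case (step a s p)
  have "R (a * s) \<in> ideal_of S"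
    using assms(1) step.hyps(1) ideal_of_mult[OF ideal_of_base[OF step.hyps(1)]]
    by (simp add: Rey_mult_invariant subset_iff)
  then show ?case
    unfolding Rey_add using step.IH by (rule ideal_of_add)
qed (simp add: Rey_zero)

text \<open>The elements of \<open>G\<close> that send \<open>m\<close> to a given orbit member form
  a left coset of the stabilizer, so the sum over \<open>G\<close> counts each orbit member equally
  often.\<close>

lemma orbit_sum_eq_Rey:
  "\<exists>c. c \<noteq> 0 \<and> orbit_sum G \<phi> m = PConst c * R (PMono m)"
proof -
  let ?p = "PMono m :: ('n, 'k) mpol"
  let ?O = "orbit G \<phi> ?p" and ?St = "stabilizer G \<phi> ?p"
  have O: "?O = (\<lambda>g. \<phi> g ?p) ` carrier G"
    by (auto simp: orbit_def)
  have fib: "card {g \<in> carrier G. \<phi> g ?p = q} = card ?St" if "q \<in> ?O" for q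
  proof -
    from that obtain h where h: "h \<in> carrier G" "q = \<phi> h ?p"
      by (auto simp: O)
    have "bij_betw (\<lambda>g. h \<otimes>\<^bsub>G\<^esub> g) ?St {g \<in> carrier G. \<phi> g ?p = q}"
    proof (rule bij_betw_byWitness[where f' = "\<lambda>g. inv\<^bsub>G\<^esub> h \<otimes>\<^bsub>G\<^esub> g"])
      show "\<forall>a\<in>?St. inv\<^bsub>G\<^esub> h \<otimes>\<^bsub>G\<^esub> (h \<otimes>\<^bsub>G\<^esub> a) = a"
        "\<forall>a\<in>{g \<in> carrier G. \<phi> g ?p = q}. h \<otimes>\<^bsub>G\<^esub> (inv\<^bsub>G\<^esub> h \<otimes>\<^bsub>G\<^esub> a) = a"
        using h(1) by (auto simp: stabilizer_def Grp.m_assoc[symmetric])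
      show "(\<lambda>g. h \<otimes>\<^bsub>G\<^esub> g) ` ?St \<subseteq> {g \<in> carrier G. \<phi> g ?p = q}"
        using h by (auto simp: stabilizer_def phi_comp[symmetric])
      show "(\<lambda>g. inv\<^bsub>G\<^esub> h \<otimes>\<^bsub>G\<^esub> g) ` {g \<in> carrier G. \<phi> g ?p = q} \<subseteq> ?St"
      proof (intro subsetI, elim imageE)
        fix x g assume x: "x = inv\<^bsub>G\<^esub> h \<otimes>\<^bsub>G\<^esub> g" and "g \<in> {g \<in> carrier G. \<phi> g ?p = q}"
        then have g: "g \<in> carrier G" "\<phi> g ?p = \<phi> h ?p" using h by auto
        have "\<phi> (inv\<^bsub>G\<^esub> h) (\<phi> g ?p) = ?p"
          using h(1) by (simp add: g(2) phi_comp phi_unit)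
        then show "x \<in> ?St"
          using h(1) g(1) by (simp add: x stabilizer_def phi_comp)
      qed
    qed
    then show ?thesis
      using bij_betw_same_card by fastforce
  qed
  have "(\<Sum>g\<in>carrier G. \<phi> g ?p) = (\<Sum>q\<in>?O. \<Sum>g\<in>{g \<in> carrier G. \<phi> g ?p = q}. \<phi> g ?p)"
    unfolding O by (rule sum.image_gen[OF finite_G])
  also have "\<dots> = (\<Sum>q\<in>?O. PConst (of_nat (card ?St)) * q)"
    using fib by (intro sum.cong) (auto simp: of_nat_eq_PConst[symmetric])
  also have "\<dots> = PConst (of_nat (card ?St)) * orbit_sum G \<phi> m"
    by (simp add: orbit_sum_def sum_distrib_left)
  finally have eq: "R ?p = PConst (1 / of_nat (Coset.order G) * of_nat (card ?St)) * orbit_sum G \<phi> m"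
    by (simp add: Rey_def mult.assoc[symmetric] PConst_mult)
  \<comment> \<open>By the orbit-stabilizer theorem the order of the stabilizer divides
    \<open>|G|\<close>, so it is invertible in the field.\<close>
  have "of_nat (card ?O) * of_nat (card ?St) = (of_nat (Coset.order G) :: 'k)"
    using action.orbit_stabilizer_theorem[of ?p] by (simp flip: of_nat_mult)
  then have nz: "(of_nat (card ?St) :: 'k) \<noteq> 0"
    using order_nonzero by auto
  let ?c = "of_nat (Coset.order G) / of_nat (card ?St) :: 'k"
  have "orbit_sum G \<phi> m = PConst ?c * R ?p"
    using nz order_nonzero by (simp add: eq mult.assoc[symmetric] PConst_mult)
  moreover have "?c \<noteq> 0"
    using nz order_nonzero by simp
  ultimately show ?thesis by blast
qed


subsection \<open>Powers of the variables in the Hilbert ideal\<close>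

text \<open>The coefficients of \<open>\<Prod>\<^sub>g (T - g.x)\<close>, which vanishes at \<open>T = x\<close>, are homogeneous invariants.\<close>

definition orbit_poly :: "'g set \<Rightarrow> ('n, 'k) mpol \<Rightarrow> ('n, 'k) mpol poly" where
  "orbit_poly A x = (\<Prod>g\<in>A. [:- \<phi> g x, 1:])"

text \<open>Giving \<open>T\<close> degree 1, every factor \<open>T - g.x\<close> is homogeneous of
  degree 1 and monic in \<open>T\<close>; the induction uses the coefficient recurrence for
  multiplication by one factor.\<close>

lemma coeff_orbit_poly:
  assumes "finite A" "A \<subseteq> carrier G"
  shows "(k \<le> card A \<longrightarrow> homog (card A - k) (coeff (orbit_poly A (PVar i)) k)) \<and>
    (k > card A \<longrightarrow> coeff (orbit_poly A (PVar i)) k = 0) \<and> coeff (orbit_poly A (PVar i)) (card A) = 1"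
  using assms
proof (induction A arbitrary: k rule: finite_induct)
  case empty
  show ?case by (auto simp: orbit_poly_def homog_one coeff_1)
next
  case (insert g A)
  let ?Q = "orbit_poly A (PVar i)" and ?y = "\<phi> g (PVar i)"
  have c: "coeff (orbit_poly (insert g A) (PVar i)) k =
      - (?y * coeff ?Q k) + (case k of 0 \<Rightarrow> 0 | Suc j \<Rightarrow> coeff ?Q j)" for k
    using insert.hyps by (simp add: orbit_poly_def coeff_pCons split: nat.split)
  have A: "A \<subseteq> carrier G" "g \<in> carrier G" using insert.prems by auto
  note IH = insert.IH[OF A(1)]
  have card: "card (insert g A) = Suc (card A)" using insert.hyps by simp
  have y: "homog 1 ?y" by (rule homog_phi_PVar[OF A(2)])
  show ?case
    unfolding card
  proof (intro conjI impI)
    assume k: "k \<le> Suc (card A)"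
    have "homog (Suc (card A) - k) (?y * coeff ?Q k)"
    proof (cases "k \<le> card A")
      case True
      then have "homog (1 + (card A - k)) (?y * coeff ?Q k)"
        using IH[of k] y by (intro homog_mult) auto
      then show ?thesis using True by (simp add: Suc_diff_le)
    next
      case False
      then show ?thesis using IH[of k] by simp
    qed
    moreover have "homog (Suc (card A) - k) (case k of 0 \<Rightarrow> 0 | Suc j \<Rightarrow> coeff ?Q j)"
      using IH k by (auto split: nat.split)
    ultimately show "homog (Suc (card A) - k) (coeff (orbit_poly (insert g A) (PVar i)) k)"
      unfolding c by (intro homog_add homog_uminus)
  next
    assume "k > Suc (card A)"
    then show "coeff (orbit_poly (insert g A) (PVar i)) k = 0"
      unfolding c using IH[of k] IH[of "k - 1"] by (auto split: nat.split)
  next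
    show "coeff (orbit_poly (insert g A) (PVar i)) (Suc (card A)) = 1"
      unfolding c using IH[of "Suc (card A)"] IH[of "card A"] by simp
  qed
qed

lemma phi_coeff_orbit_poly:
  assumes "finite A" "h \<in> carrier G" "A \<subseteq> carrier G"
  shows "\<phi> h (coeff (\<Prod>g\<in>A. [:- f g, 1:]) k) = coeff (\<Prod>g\<in>A. [:- \<phi> h (f g), 1:]) k"
  using assms(1)
proof (induction A arbitrary: k rule: finite_induct)
  case empty
  then show ?case
    using assms(2) by (simp add: coeff_1 phi_one phi_zero)
next
  case (insert g A)
  then show ?case
    using assms(2)
    by (simp add: coeff_pCons phi_add phi_diff phi_mult phi_uminus phi_zero split: nat.split)
qed

text \<open>Applying \<open>h\<close> to the coefficients turns the factor \<open>T - g.x\<close>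
  into \<open>T - hg.x\<close>, and left translation by \<open>h\<close> only permutes the
  factors.\<close>

lemma coeff_orbit_poly_invariant: "coeff (orbit_poly (carrier G) x) k \<in> Inv"
proof -
  have "\<phi> h (coeff (orbit_poly (carrier G) x) k) = coeff (orbit_poly (carrier G) x) k"
    if h: "h \<in> carrier G" for h
  proof -
    have "(\<Prod>g\<in>carrier G. [:- \<phi> h (\<phi> g x), 1:]) = (\<Prod>g\<in>carrier G. [:- \<phi> g x, 1:])"
      by (rule prod.reindex_bij_witness[of _ "\<lambda>g. inv\<^bsub>G\<^esub> h \<otimes>\<^bsub>G\<^esub> g" "\<lambda>g. h \<otimes>\<^bsub>G\<^esub> g"])
        (use h in \<open>auto simp: Grp.m_assoc[symmetric] phi_comp\<close>)
    then show ?thesis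
      using phi_coeff_orbit_poly[OF finite_G h order_refl, of "\<lambda>g. \<phi> g x" k]
      by (simp add: orbit_poly_def)
  qed
  then show ?thesis by (simp add: invariant_ring_def)
qed

lemma PVar_power_in_ideal:
  assumes S: "\<And>f d. f \<in> Inv \<Longrightarrow> homog d f \<Longrightarrow> 1 \<le> d \<Longrightarrow> d \<le> Coset.order G \<Longrightarrow> f \<in> ideal_of S"
  shows "PVar i ^ Coset.order G \<in> ideal_of S"
proof -
  let ?P = "orbit_poly (carrier G) (PVar i)" and ?x = "PVar i :: ('n, 'k) mpol"
  define N where "N = Coset.order G"
  have N: "card (carrier G) = N" by (simp add: N_def Coset.order_def)
  note co = coeff_orbit_poly[OF finite_G order_refl, unfolded N]
  have deg: "degree ?P = N"
  proof (rule antisym)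
    show "degree ?P \<le> N" using co by (intro degree_le) blast
    show "N \<le> degree ?P" using co by (intro le_degree) simp
  qed
  have "poly ?P ?x = (\<Prod>g\<in>carrier G. poly [:- \<phi> g ?x, 1:] ?x)"
    unfolding orbit_poly_def by (rule poly_prod)
  also have "\<dots> = 0"
    by (rule prod_zero[OF finite_G]) (auto intro!: bexI[of _ "\<one>\<^bsub>G\<^esub>"] simp: phi_unit)
  finally have "(\<Sum>k\<le>N. coeff ?P k * ?x ^ k) = 0"
    by (simp add: poly_altdef deg)
  \<comment> \<open>The polynomial is monic and vanishes at \<open>?x\<close>. Its coefficients for
    \<open>k < N\<close> are invariant forms of degree \<open>N - k\<close>, which lies between 1
    and \<open>N\<close>.\<close>
  then have "?x ^ N = - (\<Sum>k<N. coeff ?P k * ?x ^ k)"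
    using co[of N] by (simp add: lessThan_Suc_atMost[symmetric] add_eq_0_iff2)
  also have "\<dots> = (\<Sum>k<N. (- (?x ^ k)) * coeff ?P k)"
    by (simp add: sum_negf[symmetric] mult.commute)
  also have "\<dots> \<in> ideal_of S"
  proof (intro ideal_of_sum ideal_of_mult)
    fix k assume k: "k \<in> {..<N}"
    show "coeff ?P k \<in> ideal_of S"
      by (rule S[of _ "N - k"]) (use co[of k] k coeff_orbit_poly_invariant in \<open>auto simp: N_def\<close>)
  qed
  finally show ?thesis by (simp add: N_def)
qed

end

section \<open>Minimal generators of the invariant ring\<close>

lemma subalgebra_hull: "K_subalgebra (K_subalgebra hull S)"
  unfolding K_subalgebra_def hull_def by auto

lemma
  shows hull_PConst: "PConst c \<in> K_subalgebra hull S"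
    and hull_add: "p \<in> K_subalgebra hull S \<Longrightarrow> q \<in> K_subalgebra hull S \<Longrightarrow> p + q \<in> K_subalgebra hull S"
    and hull_mult: "p \<in> K_subalgebra hull S \<Longrightarrow> q \<in> K_subalgebra hull S \<Longrightarrow> p * q \<in> K_subalgebra hull S"
  using subalgebra_hull[of S] by (auto simp: K_subalgebra_def)

lemma hull_sum:
  assumes "\<And>i. i \<in> A \<Longrightarrow> f i \<in> K_subalgebra hull S"
  shows "sum f A \<in> K_subalgebra hull S"
  using assms
  by (induction A rule: infinite_finite_induct) (use hull_PConst[of 0 S] in \<open>auto intro: hull_add\<close>)

text \<open>Constants plus the ideal form a subalgebra containing \<open>T\<close>. This turns
  redundancy of algebra generators into redundancy of ideal generators.\<close>

lemma hull_subset_const_plus_ideal: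
  fixes p :: "('n, 'k::field) mpol"
  assumes "p \<in> K_subalgebra hull T"
  obtains c where "p - PConst c \<in> ideal_of T"
proof -
  let ?U = "{p. \<exists>c. p - PConst c \<in> ideal_of T}"
  have "K_subalgebra ?U"
    unfolding K_subalgebra_def
  proof (intro conjI ballI subsetI)
    fix x :: "('n, 'k) mpol" assume "x \<in> range PConst"
    then obtain c where "x = PConst c" by blast
    then have "x - PConst c \<in> ideal_of T" by simp
    then show "x \<in> ?U" by blast
  next
    fix p q :: "('n, 'k) mpol" assume "p \<in> ?U" "q \<in> ?U"
    then obtain a b where ab: "p - PConst a \<in> ideal_of T" "q - PConst b \<in> ideal_of T"
      by blast
    have "(p + q) - PConst (a + b) = (p - PConst a) + (q - PConst b)"
      by (simp add: PConst_add[symmetric])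
    then have "(p + q) - PConst (a + b) \<in> ideal_of T"
      using ideal_of_add[OF ab] by (simp only:)
    then show "p + q \<in> ?U" by blast
    have "p * q - PConst (a * b) = p * (q - PConst b) + PConst b * (p - PConst a)"
      by (simp add: PConst_mult[symmetric] algebra_simps)
    then have "p * q - PConst (a * b) \<in> ideal_of T"
      using ideal_of_add[OF ideal_of_mult[OF ab(2)] ideal_of_mult[OF ab(1)]] by (simp only:)
    then show "p * q \<in> ?U" by blast
  qed
  moreover have "T \<subseteq> ?U"
  proof
    fix t assume "t \<in> T"
    then have "t - PConst 0 \<in> ideal_of T" by (simp add: ideal_of_base)
    then show "t \<in> ?U" by blast
  qed
  ultimately have "K_subalgebra hull T \<subseteq> ?U"
    by (rule hull_minimal[rotated])
  then show thesis using assms that by blast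
qed

context linear_action begin

text \<open>Hilbert's argument: write an invariant form as a sum of products \<open>a * s\<close>
  and apply the Reynolds operator. The multipliers become invariant, of degree smaller by
  \<open>pdeg s\<close>, and lie in the algebra by induction.\<close>

lemma generates_Inv:
  assumes S: "\<And>s. s \<in> S \<Longrightarrow> homogeneous s \<and> s \<in> Inv \<and> pdeg s \<ge> 1"
    and gen: "\<And>f d. f \<in> Inv \<Longrightarrow> homog d f \<Longrightarrow> d \<ge> 1 \<Longrightarrow> f \<in> ideal_of S"
  shows "K_subalgebra hull S = Inv"
proof (rule equalityI)
  show "K_subalgebra hull S \<subseteq> Inv"
    by (rule hull_minimal) (use S in \<open>auto simp: K_subalgebra_def intro: Inv_add Inv_mult Inv_PConst\<close>)
  let ?A = "K_subalgebra hull S"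
  have hom: "\<forall>f. f \<in> Inv \<longrightarrow> homog e f \<longrightarrow> f \<in> ?A" for e
  proof (induction e rule: less_induct)
    case (less e)
    show ?case
    proof (intro allI impI)
      fix f assume f: "f \<in> Inv" "homog e f"
      show "f \<in> ?A"
      proof (cases "e = 0")
        case True
        then show ?thesis
          using homog_0_eq_PConst[of f] f(2) hull_PConst by metis
      next
        case False
        then have "f \<in> ideal_of S"
          using gen f by simp
        \<comment> \<open>For the given \<open>f\<close> this is \<open>f\<close> itself, but in
          this shape the claim is additive over the members of the ideal.\<close>
        then have "hcomp e (R f) \<in> ?A"
        proof (induction rule: ideal_of_induct)
          case zero
          show ?case using hull_PConst[of 0 S] by (simp add: Rey_zero)
        next
          case (step a s p)
          note s = S[OF step.hyps(1)]
          have "hcomp e (R (a * s)) \<in> ?A"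
          proof (cases "pdeg s \<le> e")
            case True
            have "hcomp (e - pdeg s) (R a) \<in> ?A"
            proof -
              have "e - pdeg s < e"
                using True s by linarith
              from less.IH[OF this] show ?thesis
                using Inv_hcomp[OF Rey_invariant] homog_hcomp by blast
            qed
            moreover have "s \<in> ?A"
              using step.hyps(1) hull_subset[of S K_subalgebra] by blast
            ultimately have "hcomp (e - pdeg s) (R a) * s \<in> ?A"
              by (rule hull_mult)
            then show ?thesis
              using True s homog_pdeg[of s] by (simp add: Rey_mult_invariant hcomp_mult_homog)
          next
            case False
            then show ?thesis
              using s homog_pdeg[of s] hull_PConst[of 0 S]
              by (simp add: Rey_mult_invariant hcomp_mult_homog)
          qed
          then show ?case
            unfolding Rey_add hcomp_add using step.IH by (rule hull_add)
        qed
        then show ?thesis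
          using f by (simp add: Rey_of_invariant hcomp_homog)
      qed
    qed
  qed
  show "Inv \<subseteq> ?A"
  proof
    fix f assume "f \<in> Inv"
    then have "(\<Sum>d\<in>mdeg ` Poly_Mapping.keys f. hcomp d f) \<in> ?A"
      using hom homog_hcomp Inv_hcomp by (intro hull_sum) blast
    then show "f \<in> ?A"
      using sum_hcomp[of f "mdeg ` Poly_Mapping.keys f"] by simp
  qed
qed

text \<open>If a proper subset \<open>T\<close> generated the algebra, a missing \<open>s\<close>
  would be a constant plus an element of the ideal of \<open>T\<close>. The component of degree
  \<open>pdeg s\<close>, which is positive, drops the constant and contradicts
  \<open>min\<close>.\<close>

lemma minimal_generating_setI:
  assumes S: "\<And>s. s \<in> S \<Longrightarrow> homogeneous s \<and> s \<in> Inv \<and> pdeg s \<ge> 1"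
    and gen: "\<And>f d. f \<in> Inv \<Longrightarrow> homog d f \<Longrightarrow> d \<ge> 1 \<Longrightarrow> f \<in> ideal_of S"
    and min: "\<And>s. s \<in> S \<Longrightarrow> s \<notin> ideal_of (S - {s})"
  shows "minimal_generating_set S Inv"
proof -
  have "K_subalgebra hull T \<noteq> Inv" if T: "T \<subset> S" for T
  proof
    assume eq: "K_subalgebra hull T = Inv"
    from T obtain s where s: "s \<in> S" "s \<notin> T" by blast
    then have "s \<in> K_subalgebra hull T" using S eq by blast
    then obtain c where c: "s - PConst c \<in> ideal_of T"
      by (rule hull_subset_const_plus_ideal)
    have "hcomp (pdeg s) (s - PConst c) \<in> ideal_of T"
      using c by (rule hcomp_in_ideal[rotated]) (use T S in blast)
    moreover have "hcomp (pdeg s) (s - PConst c) = s"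
      using S[OF s(1)] hcomp_homog[OF homog_pdeg, of s] hcomp_homog_neq[OF homog_PConst[of c], of "pdeg s"]
      by (simp add: hcomp_diff)
    moreover have "ideal_of T \<subseteq> ideal_of (S - {s})"
      using T s by (intro ideal_of_mono) auto
    ultimately show False using min[OF s(1)] by auto
  qed
  then show ?thesis
    using generates_Inv[OF S gen] by (simp add: minimal_generating_set_def)
qed

end


section \<open>The algorithm\<close>

text \<open>Treats both variants of step (b) at once. Nonzero scalars, which may depend on
  \<open>m\<close>, change neither ideals nor degrees nor invariance.\<close>

locale invariant_algebra = monomial_order ord + linear_action G \<phi>
  for ord :: "'n::finite mon rel" and G :: "('g, 'b) monoid_scheme"
    and \<phi> :: "'g \<Rightarrow> ('n, 'k::field) mpol \<Rightarrow> ('n, 'k) mpol" +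
  fixes \<beta> :: "'n mon \<Rightarrow> ('n, 'k) mpol"
  assumes candidate: "\<exists>c. c \<noteq> 0 \<and> \<beta> m = PConst c * Rey G \<phi> (PMono m)"
begin

definition B :: "nat \<Rightarrow> ('n, 'k) mpol set \<Rightarrow> ('n, 'k) mpol set" where
  "B d S = \<beta> ` mon_d ord d S"

lemma finite_B: "finite (B d S)"
  unfolding B_def mon_d_def by (rule finite_imageI, rule finite_subset[OF _ finite_mdeg[of d]]) auto

lemma candidate_props: "homog (mdeg m) (\<beta> m)" "\<beta> m \<in> Inv"
  using candidate[of m]
  by (auto intro!: homog_PConst_mult homog_Rey homog_PMono Inv_mult Inv_PConst Rey_invariant)

lemma B_props: "b \<in> B d S \<Longrightarrow> homog d b" "b \<in> B d S \<Longrightarrow> b \<in> Inv"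
  using candidate_props by (auto simp: B_def mon_d_def)

lemma B_generates:
  assumes S: "\<And>s. s \<in> S \<Longrightarrow> homogeneous s" "S \<subseteq> Inv" and f: "f \<in> Inv" "homog d f"
  shows "f \<in> ideal_of (S \<union> B d S)"
proof -
  have "f \<in> kv.span (PMono ` mon_d ord d S \<union> ideal_of S)"
    using standard_monomials_span[of S, OF S(1) f(2)] .
  then have "R f \<in> ideal_of (S \<union> B d S)"
  proof (induction rule: kv.span_induct_alt)
    case base
    show ?case by (simp add: Rey_zero)
  next
    case (step c x y)
    have "R x \<in> ideal_of (S \<union> B d S)"
      using step.hyps
    proof
      assume "x \<in> PMono ` mon_d ord d S"
      then obtain m where m: "m \<in> mon_d ord d S" "x = PMono m" by blast
      obtain a where a: "a \<noteq> 0" "\<beta> m = PConst a * R (PMono m)"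
        using candidate by blast
      have "\<beta> m \<in> ideal_of (S \<union> B d S)"
        using m(1) by (intro ideal_of_base) (auto simp: B_def)
      then have "PConst (1 / a) * \<beta> m \<in> ideal_of (S \<union> B d S)"
        by (rule ideal_of_mult)
      then show ?thesis
        using a by (simp add: m(2) mult.assoc[symmetric] PConst_mult)
    next
      assume "x \<in> ideal_of S"
      then have "R x \<in> ideal_of S"
        using Rey_in_ideal S(2) by blast
      then show ?thesis
        using ideal_of_mono[of S "S \<union> B d S"] by blast
    qed
    then show ?case
      unfolding Rey_add Rey_PConst_mult using step.IH by (intro ideal_of_add ideal_of_mult)
  qed
  then show ?thesis
    using f(1) by (simp add: Rey_of_invariant)
qed

section \<open>Degree bounds and the loop invariant\<close>

abbreviation N :: nat where "N \<equiv> Coset.order G"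

definition D :: nat where "D = card (UNIV :: 'n set) * N"

lemma N_le_D: "N \<le> D"
proof -
  have "card (UNIV :: 'n set) \<ge> 1" by (simp add: Suc_leI card_gt_0_iff)
  then show ?thesis unfolding D_def by (metis mult_le_mono1 nat_mult_1)
qed

definition good :: "('n, 'k) mpol set \<Rightarrow> nat \<Rightarrow> bool" where
  "good S d \<longleftrightarrow> finite S \<and>
     (\<forall>p\<in>S. homogeneous p \<and> p \<in> Inv \<and> 1 \<le> pdeg p \<and> pdeg p < d \<and> pdeg p \<le> D) \<and>
     (\<forall>s\<in>S. s \<notin> ideal_of (S - {s}))"

definition covers :: "('n, 'k) mpol set \<Rightarrow> nat \<Rightarrow> bool" where
  "covers S d \<longleftrightarrow> (\<forall>f e. f \<in> Inv \<longrightarrow> homog e f \<longrightarrow> 1 \<le> e \<longrightarrow> e < d \<longrightarrow> f \<in> ideal_of S)"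

text \<open>The value 0 stands for a bound not yet known.\<close>

definition dmax_ok :: "('n, 'k) mpol set \<Rightarrow> nat \<Rightarrow> nat \<Rightarrow> bool" where
  "dmax_ok S d dmax \<longleftrightarrow>
     (dmax \<noteq> 0 \<longrightarrow> d \<le> dmax \<and> (\<forall>m. m \<notin> lm_set ord (ideal_of S) \<longrightarrow> mdeg m \<le> dmax))"

text \<open>Holds after two degrees without new generators: the gap step has then made the Groebner basis
  complete and, in dimension zero, has set \<open>dmax\<close>.\<close>

definition settled :: "('n, 'k) mpol set \<Rightarrow> ('n, 'k) mpol set \<Rightarrow> nat \<Rightarrow> bool" where
  "settled S GG dmax \<longleftrightarrow>
     homogeneous_GB ord S GG \<and> (S \<noteq> {} \<and> dim_ideal (ideal_of S) = 0 \<longrightarrow> dmax \<noteq> 0)"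

text \<open>During a scan \<open>S\<close> may already hold generators of degree \<open>d\<close>,
  hence \<open>good S (d + 1)\<close> next to \<open>covers S d\<close>; the pending candidates make
  up for the rest of degree \<open>d\<close>. The gap rule acts between the two states when the
  largest generator degree is \<open>d - 2\<close>, which explains \<open>pdeg p + 2 < d\<close>
  before and \<open>pdeg p + 1 < d\<close> after it.\<close>

fun state_inv :: "('n, 'k) mpol state \<Rightarrow> bool" where
  "state_inv (Enter d S GG dmax) \<longleftrightarrow> 1 \<le> d \<and> good S d \<and> covers S d \<and> dmax_ok S d dmax \<and>
     ((\<forall>p\<in>S. pdeg p + 2 < d) \<longrightarrow> settled S GG dmax)"
| "state_inv (Scan d S GG dmax M) \<longleftrightarrow> 1 \<le> d \<and> good S (d + 1) \<and> covers S d \<and> dmax_ok S d dmax \<and>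
     ((\<forall>p\<in>S. pdeg p + 1 < d) \<longrightarrow> settled S GG dmax) \<and>
     gb_in_degree d S GG \<and> finite M \<and> (\<forall>b\<in>M. homog d b \<and> b \<in> Inv) \<and> (M \<noteq> {} \<longrightarrow> d \<le> D) \<and>
     (\<forall>f. f \<in> Inv \<longrightarrow> homog d f \<longrightarrow> f \<in> ideal_of (S \<union> M))"
| "state_inv (Return S) \<longleftrightarrow>
     (\<exists>d. good S d \<and> covers S d \<and> (\<forall>m. d \<le> mdeg m \<longrightarrow> m \<in> lm_set ord (ideal_of S)))"

lemma goodD:
  assumes "good S d" "p \<in> S"
  shows "homogeneous p" "p \<in> Inv" "1 \<le> pdeg p" "pdeg p < d" "pdeg p \<le> D"
  using assms by (auto simp: good_def)

lemma covers_power: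
  assumes "covers S d" "N < d"
  shows "PVar i ^ N \<in> ideal_of S"
  using assms by (intro PVar_power_in_ideal) (auto simp: covers_def)

lemma dim_0_finite:
  assumes "good S d" "dim_ideal (ideal_of S) = 0"
  shows "finite (- lm_set ord (ideal_of S))"
  using dim_0_imp_power_in_ideal[OF goodD(1)[OF assms(1)] assms(2)] by (rule finite_not_lm)

text \<open>Candidates exist only up to degree \<open>D\<close>: if \<open>d\<close> exceeds
  \<open>D\<close>, it exceeds \<open>N\<close>, so the ideal contains the \<open>N\<close>-th
  powers of the variables and has no standard monomials of degree \<open>d\<close>.\<close>

lemma enter_scan:
  assumes inv: "state_inv (Enter d S GG dmax)" and gb: "gb_in_degree d S GG'"
    and dm: "dmax_ok S d dmax'" and st: "(\<forall>p\<in>S. pdeg p + 1 < d) \<Longrightarrow> settled S GG' dmax'"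
  shows "state_inv (Scan d S GG' dmax' (B d S))"
proof -
  from inv have d: "1 \<le> d" and good: "good S d" and cov: "covers S d" by auto
  have "d \<le> D" if "B d S \<noteq> {}"
  proof (rule ccontr)
    assume "\<not> d \<le> D"
    then have "N < d" using N_le_D by simp
    from that obtain m where m: "mdeg m = d" "m \<notin> lm_set ord (ideal_of S)"
      by (auto simp: B_def mon_d_def)
    have "mdeg m \<le> D"
      unfolding D_def by (rule mdeg_not_lm_le[OF covers_power[OF cov \<open>N < d\<close>] m(2)])
    then show False using m(1) \<open>\<not> d \<le> D\<close> by simp
  qed
  moreover have "good S (d + 1)"
    using good by (auto simp: good_def)
  moreover have "f \<in> ideal_of (S \<union> B d S)" if "f \<in> Inv" "homog d f" for f
    using B_generates[of S f d] goodD[OF good] that by blast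
  ultimately show ?thesis
    using d cov gb dm st finite_B B_props by auto
qed

text \<open>No element of \<open>S\<close> has degree above \<open>d\<close>, so if an old
  \<open>s\<close> became redundant, then \<open>s = h + c b\<close> with \<open>h\<close> in the
  ideal of the others and a constant \<open>c\<close>. If \<open>c = 0\<close>, \<open>s\<close> was
  redundant before; otherwise \<open>b\<close> lies in the ideal of \<open>S\<close>.\<close>

lemma good_insert:
  assumes good: "good S (d + 1)" and b: "homog d b" "b \<in> Inv" "1 \<le> d" "d \<le> D" and nb: "b \<notin> ideal_of S"
  shows "good (insert b S) (d + 1)"
proof -
  have b0: "b \<noteq> 0" using nb by auto
  have pb: "pdeg b = d" using b(1) b0 by (rule pdeg_homog)
  have bS: "b \<notin> S" using nb ideal_of_base by blast
  have "s \<notin> ideal_of (insert b S - {s})" if s: "s \<in> insert b S" for s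
  proof (cases "s = b")
    case True
    then show ?thesis using nb bS by simp
  next
    case False
    then have sS: "s \<in> S" using s by simp
    show ?thesis
    proof
      assume "s \<in> ideal_of (insert b S - {s})"
      then have "s \<in> ideal_of (insert b (S - {s}))"
        using False by (simp add: insert_Diff_if)
      moreover have "homog (pdeg s) s" "pdeg s \<le> d"
        using goodD[OF good sS] homog_pdeg by auto
      moreover have "\<And>t. t \<in> S - {s} \<Longrightarrow> homogeneous t"
        using goodD(1)[OF good] by blast
      ultimately obtain h c where h: "h \<in> ideal_of (S - {s})" "s = h + PConst c * b"
        using ideal_of_insert_homogE[of s b "S - {s}" "pdeg s" d] b(1) by metis
      show False
      proof (cases "c = 0")
        case True
        then show False using h good sS by (auto simp: good_def)
      next
        case c: False
        have "h \<in> ideal_of S"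
          using h(1) ideal_of_mono[of "S - {s}" S] by blast
        then have "s - h \<in> ideal_of S"
          by (rule ideal_of_diff[OF ideal_of_base[OF sS]])
        then have "PConst c * b \<in> ideal_of S"
          by (metis add_diff_cancel_left' h(2))
        then have "PConst (1 / c) * (PConst c * b) \<in> ideal_of S"
          by (rule ideal_of_mult)
        then show False
          using c nb by (simp add: mult.assoc[symmetric] PConst_mult)
      qed
    qed
  qed
  then show ?thesis
    using good b pb unfolding good_def homogeneous_iff by auto
qed

lemma lm_set_mono: "I \<subseteq> J \<Longrightarrow> lm_set ord I \<subseteq> lm_set ord J"
  by (auto simp: lm_set_def)

lemma state_inv_step:
  assumes "step ord B s t" "state_inv s"
  shows "state_inv t"
  using assms
proof (cases rule: step.cases)
  case (gap_stop S d GG' GG dmax)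
  then have inv: "good S d" "covers S d" using assms(2) by auto
  have "mdeg m < d" if "m \<notin> lm_set ord (ideal_of S)" for m
    using mdeg_le_max_std_degree[OF dim_0_finite[OF inv(1) gap_stop(6)] that] gap_stop(7) by simp
  then have "\<forall>m. d \<le> mdeg m \<longrightarrow> m \<in> lm_set ord (ideal_of S)"
    by (meson not_le)
  then show ?thesis using inv gap_stop(2) by auto
next
  case (gap_dim_zero S d GG' GG dmax)
  then have inv: "good S d" "1 \<le> d" using assms(2) by auto
  have ok: "dmax_ok S d (max_std_degree ord S)"
    using mdeg_le_max_std_degree[OF dim_0_finite[OF inv(1) gap_dim_zero(6)]] gap_dim_zero(7)
    by (simp add: dmax_ok_def)
  \<comment> \<open>The new bound is at least \<open>d\<close>, hence at least 1, and is not
    mistaken for an unknown one.\<close>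
  have "settled S GG' (max_std_degree ord S)"
    using gap_dim_zero(5,7) inv(2) by (simp add: settled_def)
  then show ?thesis
    unfolding gap_dim_zero(2)
    using enter_scan[OF _ homogeneous_GB_gb_in_degree[OF gap_dim_zero(5)] ok] assms(2) gap_dim_zero(1)
    by blast
next
  case (gap_dim_nonzero S d GG' GG dmax)
  have "dmax_ok S d dmax" "settled S GG' dmax"
    using assms(2) gap_dim_nonzero(1,5,6) by (auto simp: settled_def)
  then show ?thesis
    unfolding gap_dim_nonzero(2)
    using enter_scan[OF _ homogeneous_GB_gb_in_degree[OF gap_dim_nonzero(5)]] assms(2) gap_dim_nonzero(1)
    by blast
next
  case (truncated S d GG' GG dmax)
  have "dmax_ok S d dmax" using assms(2) truncated(1) by auto
  \<comment> \<open>A generator of degree \<open>d - 1\<close> makes the premise for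
    \<open>settled\<close> false.\<close>
  moreover have "\<not> (\<forall>p\<in>S. pdeg p + 1 < d)"
    using truncated(3) by (auto simp: has_deg_minus_def)
  ultimately show ?thesis
    unfolding truncated(2)
    using enter_scan[OF _ gb_upto_gb_in_degree[OF truncated(4) order_refl]] assms(2) truncated(1)
    by blast
next
  case (unchanged S d GG dmax)
  have good: "good S d" and dm: "dmax_ok S d dmax" using assms(2) unchanged(1) by auto
  \<comment> \<open>All generators have degree below \<open>d\<close>, and the degrees
    \<open>d - 1\<close> and \<open>d - 2\<close> do not occur. The basis kept from earlier is
    therefore complete.\<close>
  have "pdeg p + 2 < d" if "p \<in> S" for p
    using goodD(4)[OF good that] unchanged(3,4) that
    by (auto simp: has_deg_minus_def)
      (metis Suc_lessI add_2_eq_Suc' less_Suc_eq)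
  then have st: "settled S GG dmax" using assms(2) unchanged(1) by simp
  then have "gb_in_degree d S GG"
    using homogeneous_GB_gb_in_degree unfolding settled_def by blast
  then show ?thesis
    unfolding unchanged(2) using enter_scan dm st assms(2) unchanged(1) by blast
next
  case (insert_candidate b M GG r d S dmax)
  have inv: "1 \<le> d" "good S (d + 1)" "covers S d" "dmax_ok S d dmax" "gb_in_degree d S GG" "finite M"
    "\<forall>b\<in>M. homog d b \<and> b \<in> Inv" "d \<le> D"
    "\<forall>f. f \<in> Inv \<longrightarrow> homog d f \<longrightarrow> f \<in> ideal_of (S \<union> M)"
    using assms(2) insert_candidate(1,3) by auto
  have b: "homog d b" "b \<in> Inv" using inv(7) insert_candidate(3) by auto
  have S: "\<And>s. s \<in> S \<Longrightarrow> homogeneous s" using goodD(1)[OF inv(2)] .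
  have nb: "b \<notin> ideal_of S"
    using gb_in_degree_rem(3)[OF inv(5) b(1) insert_candidate(4)] insert_candidate(5) by blast
  have sub: "ideal_of S \<subseteq> ideal_of (insert b S)"
    by (rule ideal_of_mono) auto
  have "good (insert b S) (d + 1)"
    by (rule good_insert[OF inv(2) b inv(1) inv(8) nb])
  moreover have "covers (insert b S) d"
    using inv(3) sub by (auto simp: covers_def)
  \<comment> \<open>A larger ideal has fewer standard monomials, so the bound persists.\<close>
  moreover have "dmax_ok (insert b S) d dmax"
    using inv(4) lm_set_mono[OF sub] by (auto simp: dmax_ok_def)
  moreover have "pdeg b = d"
    using b(1) nb by (intro pdeg_homog) auto
  moreover have "gb_in_degree d (insert b S) (insert r GG)"
    by (rule gb_in_degree_insert[OF inv(5) b(1) insert_candidate(4,5) S])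
  moreover have "insert b S \<union> (M - {b}) = S \<union> M"
    using insert_candidate(3) by blast
  ultimately show ?thesis
    unfolding insert_candidate(2) using inv by auto
next
  case (skip_candidate b M GG r d S dmax)
  have inv: "1 \<le> d" "good S (d + 1)" "covers S d" "dmax_ok S d dmax" "gb_in_degree d S GG" "finite M"
    "\<forall>b\<in>M. homog d b \<and> b \<in> Inv" "d \<le> D" "(\<forall>p\<in>S. pdeg p + 1 < d) \<longrightarrow> settled S GG dmax"
    "\<forall>f. f \<in> Inv \<longrightarrow> homog d f \<longrightarrow> f \<in> ideal_of (S \<union> M)"
    using assms(2) skip_candidate(1,3) by auto
  have "b \<in> ideal_of S"
    using gb_in_degree_rem(3)[OF inv(5) _ skip_candidate(4)] inv(7) skip_candidate(3,5) by blast
  then have "b \<in> ideal_of (S \<union> (M - {b}))"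
    using ideal_of_mono[of S "S \<union> (M - {b})"] by blast
  then have "ideal_of (S \<union> M) \<subseteq> ideal_of (S \<union> (M - {b}))"
    by (intro ideal_of_subset) (auto intro: ideal_of_base)
  then show ?thesis
    unfolding skip_candidate(2) using inv by auto
next
  case (stop d dmax S GG)
  have inv: "1 \<le> d" "good S (d + 1)" "covers S d" "dmax_ok S d d"
    "\<forall>f. f \<in> Inv \<longrightarrow> homog d f \<longrightarrow> f \<in> ideal_of S"
    using assms(2) stop(1,3) by auto
  have "covers S (d + 1)"
    using inv(3,5) by (auto simp: covers_def less_Suc_eq)
  moreover have "\<forall>m. d + 1 \<le> mdeg m \<longrightarrow> m \<in> lm_set ord (ideal_of S)"
    using inv(1,4) by (auto simp: dmax_ok_def Suc_le_eq not_less[symmetric])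
  ultimately show ?thesis
    unfolding stop(2) state_inv.simps using inv(2) by blast
next
  case (next_degree d dmax S GG)
  have inv: "1 \<le> d" "good S (d + 1)" "covers S d" "dmax_ok S d dmax"
    "\<forall>f. f \<in> Inv \<longrightarrow> homog d f \<longrightarrow> f \<in> ideal_of S"
    "(\<forall>p\<in>S. pdeg p + 1 < d) \<longrightarrow> settled S GG dmax"
    using assms(2) next_degree(1) by auto
  have "covers S (d + 1)"
    using inv(3,5) by (auto simp: covers_def less_Suc_eq)
  moreover have "dmax_ok S (d + 1) dmax"
    using inv(4) next_degree(3) by (auto simp: dmax_ok_def)
  ultimately show ?thesis
    unfolding next_degree(2) state_inv.simps using inv by simp
qed

lemma state_inv_initial: "state_inv initial_state"
proof -
  \<comment> \<open>The empty set is a complete Groebner basis of the zero ideal, so the run starts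
    in a settled state.\<close>
  have "lm_set ord (ideal_of ({} :: ('n, 'k) mpol set)) = {}"
    by (auto simp: lm_set_def ideal_of_empty)
  then show ?thesis
    by (simp add: initial_state_def good_def covers_def dmax_ok_def settled_def homogeneous_GB_def)
qed

lemma state_inv_reachable: "reachable ord B s \<Longrightarrow> state_inv s"
  unfolding reachable_def
  by (induction rule: rtranclp_induct) (auto intro: state_inv_initial state_inv_step)

section \<open>Termination and correctness\<close>

text \<open>Generators have degree at most \<open>D\<close>, so the gap step occurs by degree
  \<open>D + 2\<close> and later states are settled. By then the ideal contains powers of all
  variables and has dimension zero, so \<open>dmax\<close> would be nonzero.\<close>

lemma Enter_bound:
  assumes "state_inv (Enter d S GG 0)"
  shows "d \<le> D + 3"
proof (rule ccontr)
  assume d: "\<not> d \<le> D + 3"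
  have good: "good S d" and cov: "covers S d" using assms by auto
  have "pdeg p + 2 < d" if "p \<in> S" for p
    using goodD(5)[OF good that] d by simp
  then have "settled S GG 0" using assms by simp
  moreover have pw: "PVar i ^ N \<in> ideal_of S" for i
    using N_le_D d by (intro covers_power[OF cov]) simp
  then have "dim_ideal (ideal_of S) = 0"
    using goodD[OF good] by (intro dim_0I) blast+
  \<comment> \<open>\<open>settled\<close> speaks of \<open>dmax\<close> only for nonempty
    \<open>S\<close>; an empty \<open>S\<close> would make a power of a variable zero.\<close>
  moreover have "S \<noteq> {}"
  proof
    assume "S = {}"
    then have "PMono (Poly_Mapping.single undefined N) = (0 :: ('n, 'k) mpol)"
      using pw[of undefined] by (simp add: ideal_of_empty PMono_power_single)
    then show False
      by (metis keys_PMono keys_zero empty_not_insert)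
  qed
  ultimately show False by (simp add: settled_def)
qed

text \<open>Lexicographic measure: whether a bound is still unknown, the distance from
  \<open>d\<close> to the last possible degree, the number of pending candidates. The factor 2 in
  \<open>rank2\<close> makes room for both \<open>Enter d\<close> to \<open>Scan d\<close> and
  \<open>Scan d\<close> to \<open>Enter (d + 1)\<close>.\<close>

fun rank1 :: "('n, 'k) mpol state \<Rightarrow> nat" where
  "rank1 (Enter d S GG dmax) = (if dmax = 0 then 1 else 0)"
| "rank1 (Scan d S GG dmax M) = (if dmax = 0 then 1 else 0)"
| "rank1 (Return S) = 0"

fun rank2 :: "('n, 'k) mpol state \<Rightarrow> nat" where
  "rank2 (Enter d S GG dmax) = 2 * ((if dmax = 0 then D + 3 else dmax) - d) + 2"
| "rank2 (Scan d S GG dmax M) = 2 * ((if dmax = 0 then D + 3 else dmax) - d) + 1"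
| "rank2 (Return S) = 0"

fun rank3 :: "('n, 'k) mpol state \<Rightarrow> nat" where
  "rank3 (Enter d S GG dmax) = 0"
| "rank3 (Scan d S GG dmax M) = card M"
| "rank3 (Return S) = 0"

lemma step_decreases:
  assumes "step ord B s t" "state_inv s"
  shows "(t, s) \<in> measures [rank1, rank2, rank3]"
  using assms
proof (cases rule: step.cases)
  case (gap_dim_zero S d GG' GG dmax)
  have inv: "good S d" "1 \<le> d" "dmax_ok S d dmax" using assms(2) gap_dim_zero(1) by auto
  \<comment> \<open>A known bound can only be lowered by recomputation. If none was known,
    \<open>rank1\<close> drops, as the new bound is nonzero.\<close>
  have "max_std_degree ord S \<le> dmax" if "dmax \<noteq> 0"
  proof (rule max_std_degree_le)
    show "\<And>s. s \<in> S \<Longrightarrow> homogeneous s \<and> 1 \<le> pdeg s"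
      using goodD[OF inv(1)] by blast
    show "finite (- lm_set ord (ideal_of S))"
      by (rule dim_0_finite[OF inv(1) gap_dim_zero(6)])
  qed (use inv(3) that in \<open>simp add: dmax_ok_def\<close>)
  then show ?thesis
    unfolding gap_dim_zero(1,2) using gap_dim_zero(7) inv(2) by auto
next
  case (insert_candidate b M GG r d S dmax)
  have "card (M - {b}) < card M"
    using assms(2) insert_candidate(1,3) by (intro card_Diff1_less) auto
  then show ?thesis unfolding insert_candidate(1,2) by simp
next
  case (skip_candidate b M GG r d S dmax)
  have "card (M - {b}) < card M"
    using assms(2) skip_candidate(1,3) by (intro card_Diff1_less) auto
  then show ?thesis unfolding skip_candidate(1,2) by simp
next
  case (next_degree d dmax S GG)
  have "state_inv (Enter (d + 1) S GG dmax)"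
    using state_inv_step[OF assms] next_degree(2) by simp
  \<comment> \<open>The invariant of the successor state ensures that the truncated difference in
    \<open>rank2\<close> really decreases.\<close>
  then have "d + 1 \<le> (if dmax = 0 then D + 3 else dmax)"
    using Enter_bound[of "d + 1" S GG] by (cases "dmax = 0") (auto simp: dmax_ok_def)
  then show ?thesis unfolding next_degree(1,2) by auto
qed simp_all

lemma step_exists:
  assumes "state_inv s" "\<nexists>S. s = Return S"
  shows "\<exists>t. step ord B s t"
proof (cases s)
  case (Enter d S GG dmax)
  have S: "\<And>s. s \<in> S \<Longrightarrow> homogeneous s"
    using assms(1) goodD(1) unfolding Enter by auto
  obtain GG1 where GG1: "homogeneous_GB ord S GG1"
    using homogeneous_GB_exists S by blast
  obtain GG2 where GG2: "homogeneous_GB_upto ord d S GG2"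
    using homogeneous_GB_upto_exists S by blast
  show ?thesis
    unfolding Enter
    using GG1 GG2 step.gap_stop step.gap_dim_zero step.gap_dim_nonzero step.truncated step.unchanged
    by metis
next
  case (Scan d S GG dmax M)
  show ?thesis
  proof (cases "M = {}")
    case True
    then show ?thesis
      unfolding Scan using step.stop step.next_degree by metis
  next
    case False
    then obtain b where "b \<in> M" by blast
    moreover obtain r where "is_rem ord GG b r"
      using is_rem_exists by blast
    ultimately show ?thesis
      unfolding Scan using step.insert_candidate step.skip_candidate by metis
  qed
qed (use assms(2) in blast)

theorem terminates_B: "terminates ord B"
  unfolding terminates_def
proof (intro conjI allI impI notI)
  assume "\<exists>run. run 0 = initial_state \<and> (\<forall>i. step ord B (run i) (run (Suc i)))"
  then obtain run where run: "run 0 = initial_state" "\<And>i. step ord B (run i) (run (Suc i))"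
    by blast
  have "state_inv (run i)" for i
    by (induction i) (use run state_inv_initial state_inv_step in auto)
  then have "(run (Suc i), run i) \<in> measures [rank1, rank2, rank3]" for i
    using step_decreases run(2) by blast
  moreover have "wf (measures [rank1, rank2, rank3])"
    by (rule wf_measures)
  ultimately show False
    unfolding wf_iff_no_infinite_down_chain by blast
next
  fix s assume "reachable ord B s"
  then show "(\<exists>S. s = Return S) \<or> (\<exists>t. step ord B s t)"
    using state_inv_reachable step_exists by blast
qed

text \<open>Below the stopping degree the invariant puts all invariant forms of positive degree into
  the ideal; from there on every monomial is a leading monomial, so all forms lie in it.\<close>

theorem returns_B:
  assumes "returns ord B S"
  shows "finite S \<and> (\<forall>p\<in>S. homogeneous p \<and> p \<in> Inv) \<and> minimal_generating_set S Inv"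
proof -
  have "state_inv (Return S)"
    using assms state_inv_reachable unfolding returns_def by blast
  then obtain d where d: "good S d" "covers S d"
    "\<And>m. d \<le> mdeg m \<Longrightarrow> m \<in> lm_set ord (ideal_of S)"
    by auto
  have "f \<in> ideal_of S" if f: "f \<in> Inv" "homog e f" "e \<ge> 1" for f e
  proof (cases "e < d")
    case True
    then show ?thesis using d(2) f by (auto simp: covers_def)
  next
    case False
    then show ?thesis
      using homog_in_ideal_of_lm[OF goodD(1)[OF d(1)] d(3) f(2)] by simp
  qed
  then have "minimal_generating_set S Inv"
    using goodD[OF d(1)] d(1) by (intro minimal_generating_setI) (auto simp: good_def)
  then show ?thesis
    using d(1) by (auto simp: good_def)
qed

end


theorem mainTheorem1:
  fixes G :: "('g, 'b) monoid_scheme"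
    and \<phi> :: "'g \<Rightarrow> ('n::finite, 'k::field) mpol \<Rightarrow> ('n, 'k) mpol"
    and ord :: "'n mon rel"
  assumes "group G"
    and "finite (carrier G)"
    and "acts_linearly G \<phi>"
    and "\<not> CHAR('k) dvd Coset.order G"
    and "global_monomial_order ord"
  shows "(terminates ord (reynolds_candidates ord G \<phi>) \<and>
          (\<forall>S. returns ord (reynolds_candidates ord G \<phi>) S \<longrightarrow>
             finite S \<and> (\<forall>p\<in>S. homogeneous p \<and> p \<in> invariant_ring G \<phi>) \<and>
             minimal_generating_set S (invariant_ring G \<phi>))) \<and>
         (permutes_variables G \<phi> \<longrightarrow>
          terminates ord (orbit_sum_candidates ord G \<phi>) \<and>
          (\<forall>S. returns ord (orbit_sum_candidates ord G \<phi>) S \<longrightarrow>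
             finite S \<and> (\<forall>p\<in>S. homogeneous p \<and> p \<in> invariant_ring G \<phi>) \<and>
             minimal_generating_set S (invariant_ring G \<phi>)))"
proof -
  interpret monomial_order ord
    using assms(5) by unfold_locales
  interpret linear_action G \<phi>
    using assms by (intro linear_action.intro)
  interpret rey: invariant_algebra ord G \<phi> "\<lambda>m. Rey G \<phi> (PMono m)"
    by unfold_locales (rule exI[of _ 1], simp)
  interpret orb: invariant_algebra ord G \<phi> "orbit_sum G \<phi>"
    by unfold_locales (rule orbit_sum_eq_Rey)
  have "rey.B = reynolds_candidates ord G \<phi>"
    by (intro ext) (simp add: rey.B_def reynolds_candidates_def)
  moreover have "orb.B = orbit_sum_candidates ord G \<phi>"
    by (intro ext) (simp add: orb.B_def orbit_sum_candidates_def)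
  ultimately show ?thesis
    using rey.terminates_B rey.returns_B orb.terminates_B orb.returns_B by auto
qed

end
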